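(* Let $d\geq 2$, $l\geq 1$ and $2\leq\alpha_2<\alpha_3$ be integers with $\gcd(\alpha_2,d)=\gcd(\alpha_2,\alpha_3)=1$, and let $X=\{x+y(x^{d}+z^{\alpha_{2}})^{l}+t^{\alpha_{3}}=0\}\subset\mathbb{A}^{4}=\mathrm{Spec}(\mathbb{C}[x,y,z,t])$ be the corresponding Koras-Russell threefold, with the $\mathbb{C}^*$-action induced by the linear action on $\mathbb{A}^4$ with weights $(\alpha_2\alpha_3,-(dl-1)\alpha_2\alpha_3,d\alpha_3,\alpha_2)$ on $(x,y,z,t)$. Let $(a,b)\in\mathbb{Z}^2$ be any pair with $a\alpha_3+b\alpha_2=1$, put $a'=a/d$ and $b'=b$, and let $$\mathcal{D}_{d}=\left\{ \tfrac{a'}{\alpha_{2}}\right\} D_{d,\alpha_{3}}+\left\{ \tfrac{b'}{\alpha_{3}}\right\} D_{d,\alpha_{2}}+\left[0,\tfrac{1}{\alpha_{2}\alpha_{3}}\right]E_{d}$$ on the blow-up $\tilde{\mathbb{A}}^2_{(u',v'^d)}$ of the ideal $(u',v'^d)$ in $\mathbb{A}^2=\mathrm{Spec}(\mathbb{C}[u',v'])$, where $E_d$ is the exceptional divisor and $D_{d,\alpha_2}$, $D_{d,\alpha_3}$ are the strict transforms of the curves $\{v'+(u'+v'^d)^l=0\}$ and $\{u'=0\}$ respectively. Then $X$ is isomorphic, as a $\mathbb{C}^*$-variety, to $\mathbb{S}(\tilde{\mathbb{A}}_{(u',v'^{d})}^{2}/\!/\mu_{dl-1},\mathcal{D}_{d(dl-1)})$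 for $$\mathcal{D}_{d(dl-1)}=\left\{ \tfrac{a'}{\alpha_{2}}\right\} D_{d(dl-1),\alpha_{3}}+\left\{ \tfrac{b'}{\alpha_{3}}\right\} D_{d(dl-1),\alpha_{2}}+\left[0,\tfrac{1}{(dl-1)\alpha_{2}\alpha_{3}}\right]E_{d(dl-1)},$$ where $\mathcal{D}_{d}=\varphi_{\mu_{dl-1}}^{*}(\mathcal{D}_{d(dl-1)})$, $\varphi_{\mu_{dl-1}}:\tilde{\mathbb{A}}_{(u',v'^{d})}^{2}\to\tilde{\mathbb{A}}_{(u',v'^{d})}^{2}/\!/\mu_{dl-1}$ is the quotient morphism, and $E_{d(dl-1)}$ is the exceptional divisor of the blow-up of the singularity in $\mathbb{A}^{2}/\!/\mu_{dl-1}$.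
   Context: $\mu_m$ denotes the group of complex $m$-th roots of unity and $/\!/$ the algebraic quotient. The group $\mu_{dl-1}$ acts on $\mathbb{A}^2=\mathrm{Spec}(\mathbb{C}[u',v'])$ by $\xi\cdot(u',v')=(\xi^d u',\xi v')$, and correspondingly on the blow-up $\tilde{\mathbb{A}}^2_{(u',v'^d)}$ (this is the action induced by $\xi\cdot(u,v)=(\xi u,\xi v)$ with $u'=u^d$, $v'=v$). The quotient $\tilde{\mathbb{A}}^2_{(u',v'^d)}/\!/\mu_{dl-1}$ maps birationally to $\mathbb{A}^2/\!/\mu_{dl-1}$, with exceptional divisor $E_{d(dl-1)}$ (the image of $E_d$); $D_{d(dl-1),\alpha_2}$ and $D_{d(dl-1),\alpha_3}$ are the prime divisors on this quotient corresponding to $D_{d,\alpha_2}$ and $D_{d,\alpha_3}$ through the relation $\mathcal{D}_{d}=\varphi_{\mu_{dl-1}}^{*}(\mathcal{D}_{d(dl-1)})$. For $\mathbb{T}=\mathbb{C}^*$ the character lattice and its dual are $M=N=\mathbb{Z}$. A polyhedral divisor with tail cone $\{0\}$ on a normal variety $Y$ is a finite formal sum $\mathcal{D}=\sum\Delta_i D_i$ (also written $\sum \Delta_i\otimes D_i$), with $D_i$ prime divisors and $\Delta_i=[a_i,b_i]\subset\mathbb{Q}$ closed bounded intervals with rational endpoints ($\{q\}$ denotes the single point interval $[q,q]$). For $n\in\mathbb{Z}$, $\mathcal{D}(n)=\sum\min_{v\in\Delta_i}(nv)\,D_i$, a Weil $\mathbb{Q}$-divisor, and $$\mathbb{S}(Y,\mathcal{D})=\mathrm{Spec}\Big(\bigoplus_{n\in\mathbb{Z}}\Gamma(Y,\mathcal{O}_Y(\mathcal{D}(n)))\Big)$$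 with the $\mathbb{C}^*$-action given by the $\mathbb{Z}$-grading, where sections of $\mathcal{O}_Y(D)$ for a $\mathbb{Q}$-divisor $D$ are the sections of $\mathcal{O}_Y(\lfloor D\rfloor)$. For a $\mathbb{C}^*$-variety $X=\mathrm{Spec}(A)$ the grading is $A_n=\{f\in A\mid f(\lambda\cdot x)=\lambda^n f(x)\}$. The pull-back of $\mathcal{D}'=\sum\Delta'_i\otimes D'_i$ by a dominant morphism $\varphi$ is $\varphi^*(\mathcal{D}')=\sum\Delta'_i\otimes\varphi^*(D'_i)$, with $\varphi^*(D'_i)$ the usual pull-back (so $\Delta\otimes mD=m\Delta\otimes D$).
   Formalization: The pair (a,b) is additionally required to have d dividing a, so that a'=a/d is an integer; for pairs with d not dividing a the claimed isomorphism fails (e.g. d=2, l=1, α₂=3, α₃=5, a=-1, b=2). *)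

theory Defs
  imports
    Complex_Main
    "HOL-Library.Poly_Mapping"
    "HOL-Library.Interval"
    "HOL-Computational_Algebra.Polynomial"
    "HOL-Computational_Algebra.Fraction_Field"
    "HOL-Algebra.QuotRing"
    "HOL-Algebra.Generated_Rings"
begin

section \<open>Varieties as sets of local rings\<close>

text \<open>An integral separated scheme is determined by the set of its local rings, viewed as
  subrings of its function field (Chevalley's point of view). A scheme is therefore a set of
  subsets of a fixed field, its points being identified with their local rings; a prime divisor
  is identified with the local ring of its generic point.\<close>

definition ring_of :: "'k::comm_ring_1 set \<Rightarrow> 'k ring" where
  "ring_of A = \<lparr>carrier = A, mult = (*), one = 1, zero = 0, add = (+)\<rparr>"

definition localization :: "'k::field set \<Rightarrow> 'k set \<Rightarrow> 'k set" where
  "localization A P = {a / s | a s. a \<in> A \<and> s \<in> A - P}"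

definition Spec :: "'k::field set \<Rightarrow> 'k set set" where
  "Spec A = localization A ` {P. primeideal P (ring_of A)}"

text \<open>The blow-up of \<open>Spec A\<close> along the ideal generated by a finite set \<open>F\<close>, glued from its
  affine charts \<open>Spec A[g/f : g \<in> F]\<close>.\<close>

definition blow_up :: "'k::field set \<Rightarrow> 'k set \<Rightarrow> 'k set set" where
  "blow_up A F = (\<Union>f\<in>F - {0}. Spec (generate_ring (ring_of UNIV) (A \<union> (\<lambda>g. g / f) ` F)))"

definition max_ideal :: "'k::field set \<Rightarrow> 'k set" where
  "max_ideal R = R - Units (ring_of R)"

text \<open>\<open>R' \<in> Y'\<close> dominates \<open>R \<in> Y\<close> iff the morphism \<open>Y' \<rightarrow> Y\<close> given by an inclusion of function
  fields maps the point \<open>R'\<close> to the point \<open>R\<close>.\<close>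

definition dominates :: "'k::field set \<Rightarrow> 'k set \<Rightarrow> bool" where
  "dominates R' R \<longleftrightarrow> R \<subseteq> R' \<and> max_ideal R' \<inter> R = max_ideal R"

definition fraction_field_of :: "'k::field set \<Rightarrow> 'k set" where
  "fraction_field_of R = {a / b | a b. a \<in> R \<and> b \<in> R - {0}}"

definition function_field :: "'k::field set set \<Rightarrow> 'k set" where
  "function_field Y = (\<Union>R\<in>Y. fraction_field_of R)"

definition uniformizer :: "'k::field set \<Rightarrow> 'k \<Rightarrow> bool" where
  "uniformizer R p \<longleftrightarrow> p \<in> max_ideal R \<and> p \<noteq> 0 \<and>
     (\<forall>f\<in>R - {0}. \<exists>e\<in>Units (ring_of R). \<exists>n::nat. f = e * p ^ n)"

text \<open>On a normal variety the points of codimension one are exactly those whose local ring is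
  a discrete valuation ring.\<close>

definition prime_divisors :: "'k::field set set \<Rightarrow> 'k set set" where
  "prime_divisors Y = {R \<in> Y. \<exists>p. uniformizer R p}"

text \<open>Only meaningful for a nonzero \<open>f\<close> in the fraction field of the discrete valuation ring \<open>R\<close>.\<close>

definition ord_at :: "'k::field set \<Rightarrow> 'k \<Rightarrow> int" where
  "ord_at R f = (THE k. \<exists>p. uniformizer R p \<and> (\<exists>e\<in>Units (ring_of R). f = e * p powi k))"

text \<open>A curve not contained in the centre is given by its generic point \<open>C\<close>; its strict transform
  is the closure of the unique point of \<open>Y\<close> over \<open>C\<close>.\<close>

definition strict_transform :: "'k::field set set \<Rightarrow> 'k set \<Rightarrow> 'k set" where
  "strict_transform Y C = (THE R. R \<in> Y \<and> dominates R C)"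

text \<open>The (reduced) exceptional divisor in \<open>Y\<close> over the point \<open>c\<close>, when it is irreducible.\<close>

definition exceptional_divisor :: "'k::field set set \<Rightarrow> 'k set \<Rightarrow> 'k set" where
  "exceptional_divisor Y c = (THE E. E \<in> prime_divisors Y \<and> dominates E c)"

text \<open>A finite group \<open>G\<close> of field automorphisms acting on \<open>Y\<close>: the local ring of the quotient
  at the image of the point \<open>R\<close> is the ring of invariants \<open>R \<inter> K\<^sup>G\<close>.\<close>

definition quotient_map :: "('k::field \<Rightarrow> 'k) set \<Rightarrow> 'k set \<Rightarrow> 'k set" where
  "quotient_map G R = {f \<in> R. \<forall>\<sigma>\<in>G. \<sigma> f = f}"

definition group_quotient :: "'k::field set set \<Rightarrow> ('k \<Rightarrow> 'k) set \<Rightarrow> 'k set set" where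
  "group_quotient Y G = quotient_map G ` Y"


section \<open>Polyhedral divisors\<close>

type_synonym 'k polyhedral_divisor = "'k set \<Rightarrow>\<^sub>0 rat interval"

text \<open>\<open>\<D>(n)\<close>, a Weil divisor with rational coefficients.\<close>

definition pdiv_eval :: "'k polyhedral_divisor \<Rightarrow> int \<Rightarrow> 'k set \<Rightarrow>\<^sub>0 rat" where
  "pdiv_eval \<D> n = Poly_Mapping.map (\<lambda>\<Delta>. LEAST m. m \<in> (\<lambda>v. of_int n * v) ` set_of \<Delta>) \<D>"

text \<open>\<open>\<Gamma>(Y, O(D))\<close> for normal \<open>Y\<close>.\<close>

definition sections :: "'k::field set set \<Rightarrow> ('k set \<Rightarrow>\<^sub>0 rat) \<Rightarrow> 'k set" where
  "sections Y D = {f \<in> function_field Y.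
     f \<noteq> 0 \<longrightarrow> (\<forall>R\<in>prime_divisors Y. 0 \<le> ord_at R f + \<lfloor>Poly_Mapping.lookup D R\<rfloor>)}"

text \<open>Pull-back of a prime divisor by a finite morphism \<open>\<phi>\<close> of normal varieties, with function
  field of the target included in that of the source: the multiplicity at a prime divisor \<open>R\<close>
  over \<open>P\<close> is the order along \<open>R\<close> of a local equation of \<open>P\<close>.\<close>

definition pullback_prime ::
    "'k::field set set \<Rightarrow> ('k set \<Rightarrow> 'k set) \<Rightarrow> 'k set \<Rightarrow> 'k set \<Rightarrow>\<^sub>0 int" where
  "pullback_prime Y \<phi> P = (\<Sum>R | R \<in> prime_divisors Y \<and> \<phi> R = P.
     Poly_Mapping.single R (THE e. \<exists>p. uniformizer P p \<and> e = ord_at R p))"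

definition pdiv_tensor :: "rat interval \<Rightarrow> ('k set \<Rightarrow>\<^sub>0 int) \<Rightarrow> 'k polyhedral_divisor" where
  "pdiv_tensor \<Delta> W = (\<Sum>R\<in>Poly_Mapping.keys W.
     Poly_Mapping.single R (interval_of (of_int (Poly_Mapping.lookup W R)) * \<Delta>))"

definition pdiv_pullback :: "'k::field set set \<Rightarrow> ('k set \<Rightarrow> 'k set) \<Rightarrow>
    'k polyhedral_divisor \<Rightarrow> 'k polyhedral_divisor" where
  "pdiv_pullback Y \<phi> \<D> = (\<Sum>P\<in>Poly_Mapping.keys \<D>.
     pdiv_tensor (Poly_Mapping.lookup \<D> P) (pullback_prime Y \<phi> P))"


section \<open>Affine varieties with an action of the multiplicative group\<close>

text \<open>An affine \<open>\<complex>\<^sup>*\<close>-variety is given by its coordinate algebra with the induced action on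
  functions, \<open>(\<lambda> \<cdot> f)(p) = f(\<lambda> \<cdot> p)\<close>; the part of degree \<open>n\<close> is then the space of \<open>f\<close> with
  \<open>\<lambda> \<cdot> f = \<lambda>\<^sup>n f\<close>. Isomorphisms are the equivariant isomorphisms of \<open>\<complex>\<close>-algebras.\<close>

record 'a cstar_algebra = "(complex, 'a) module" +
  cstar_act :: "complex \<Rightarrow> 'a \<Rightarrow> 'a"

definition cstar_isomorphic ::
    "('a, 'm) cstar_algebra_scheme \<Rightarrow> ('b, 'n) cstar_algebra_scheme \<Rightarrow> bool" where
  "cstar_isomorphic A B \<longleftrightarrow> (\<exists>h\<in>ring_iso A B.
     (\<forall>c. \<forall>f\<in>carrier A. h (c \<odot>\<^bsub>A\<^esub> f) = c \<odot>\<^bsub>B\<^esub> h f) \<and>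
     (\<forall>s. s \<noteq> 0 \<longrightarrow> (\<forall>f\<in>carrier A. h (cstar_act A s f) = cstar_act B s (h f))))"

type_synonym point4 = "complex \<times> complex \<times> complex \<times> complex"

inductive_set polynomial_functions4 :: "(point4 \<Rightarrow> complex) set" where
  const: "(\<lambda>_. c) \<in> polynomial_functions4"
| coord_x: "(\<lambda>(x, y, z, t). x) \<in> polynomial_functions4"
| coord_y: "(\<lambda>(x, y, z, t). y) \<in> polynomial_functions4"
| coord_z: "(\<lambda>(x, y, z, t). z) \<in> polynomial_functions4"
| coord_t: "(\<lambda>(x, y, z, t). t) \<in> polynomial_functions4"
| add: "f \<in> polynomial_functions4 \<Longrightarrow> g \<in> polynomial_functions4 \<Longrightarrow>
    (\<lambda>p. f p + g p) \<in> polynomial_functions4"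
| mult: "f \<in> polynomial_functions4 \<Longrightarrow> g \<in> polynomial_functions4 \<Longrightarrow>
    (\<lambda>p. f p * g p) \<in> polynomial_functions4"

text \<open>A closed subvariety \<open>X\<close> of affine 4-space stable under an action \<open>act\<close>.\<close>

definition affine_cstar_variety ::
    "point4 set \<Rightarrow> (complex \<Rightarrow> point4 \<Rightarrow> point4) \<Rightarrow> (point4 \<Rightarrow> complex) cstar_algebra" where
  "affine_cstar_variety X act =
    \<lparr>carrier = (\<lambda>f. restrict f X) ` polynomial_functions4,
     mult = (\<lambda>f g. \<lambda>p\<in>X. f p * g p),
     one = (\<lambda>p\<in>X. 1),
     zero = (\<lambda>p\<in>X. 0),
     add = (\<lambda>f g. \<lambda>p\<in>X. f p + g p),
     smult = (\<lambda>c f. \<lambda>p\<in>X. c * f p),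
     cstar_act = (\<lambda>s f. \<lambda>p\<in>X. f (act s p))\<rparr>"

definition linear_cstar_action :: "int \<Rightarrow> int \<Rightarrow> int \<Rightarrow> int \<Rightarrow> complex \<Rightarrow> point4 \<Rightarrow> point4" where
  "linear_cstar_action wx wy wz wt s =
     (\<lambda>(x, y, z, t). (s powi wx * x, s powi wy * y, s powi wz * z, s powi wt * t))"

definition koras_russell :: "nat \<Rightarrow> nat \<Rightarrow> nat \<Rightarrow> nat \<Rightarrow> point4 set" where
  "koras_russell d l \<alpha>\<^sub>2 \<alpha>\<^sub>3 = {(x, y, z, t). x + y * (x ^ d + z ^ \<alpha>\<^sub>2) ^ l + t ^ \<alpha>\<^sub>3 = 0}"


section \<open>The affine plane, its blow-up and its quotient\<close>

type_synonym plane_field = "complex poly poly fract"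

definition plane_const :: "complex \<Rightarrow> plane_field" where
  "plane_const c = Fract [:[:c:]:] 1"

text \<open>The coordinate \<open>u'\<close> is the variable of the inner polynomials, \<open>v'\<close> that of the outer ones.\<close>

definition plane_u :: plane_field where "plane_u = Fract [:[:0, 1:]:] 1"

definition plane_v :: plane_field where "plane_v = Fract [:0, 1:] 1"

text \<open>The coordinate ring \<open>\<complex>[u', v']\<close>.\<close>

definition plane :: "plane_field set" where
  "plane = range (\<lambda>p. Fract p 1)"

text \<open>The generic point of the irreducible curve \<open>{f = 0}\<close>.\<close>

definition plane_curve :: "plane_field \<Rightarrow> plane_field set" where
  "plane_curve f = localization plane (PIdl\<^bsub>ring_of plane\<^esub> f)"

definition plane_origin :: "plane_field set" where
  "plane_origin = localization plane (Idl\<^bsub>ring_of plane\<^esub> {plane_u, plane_v})"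

definition blown_up_plane :: "nat \<Rightarrow> plane_field set set" where
  "blown_up_plane d = blow_up plane {plane_u, plane_v ^ d}"

text \<open>The group \<open>\<mu>\<^sub>m\<close> acting by \<open>\<xi> \<cdot> (u', v') = (\<xi>\<^sup>d u', \<xi> v')\<close>, as a group of automorphisms of
  the function field; such an automorphism is determined by \<open>\<xi>\<close>.\<close>

definition root_group :: "nat \<Rightarrow> nat \<Rightarrow> (plane_field \<Rightarrow> plane_field) set" where
  "root_group d m = {\<sigma> \<in> ring_iso (ring_of UNIV) (ring_of UNIV).
     (\<forall>c. \<sigma> (plane_const c) = plane_const c) \<and>
     (\<exists>\<xi>. \<xi> ^ m = 1 \<and> \<sigma> plane_u = plane_const (\<xi> ^ d) * plane_u \<and>
       \<sigma> plane_v = plane_const \<xi> * plane_v)}"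

text \<open>\<open>\<S>(Y, \<D>)\<close>, the spectrum of \<open>\<Oplus>\<^sub>n \<Gamma>(Y, O(\<D>(n)))\<close>, for \<open>Y\<close> with function field inside
  \<open>\<complex>(u', v')\<close>. A finitely supported family \<open>F\<close> is multiplied by convolution, i.e. as the
  Laurent polynomial with coefficients \<open>F n\<close>, and \<open>\<complex>\<^sup>*\<close> acts in degree \<open>n\<close> by the character
  \<open>s\<^sup>n\<close>.\<close>

definition S_variety ::
    "plane_field set set \<Rightarrow> plane_field polyhedral_divisor \<Rightarrow> (int \<Rightarrow>\<^sub>0 plane_field) cstar_algebra"
  where
  "S_variety Y \<D> =
    \<lparr>carrier = {F. \<forall>n. Poly_Mapping.lookup F n \<in> sections Y (pdiv_eval \<D> n)},
     mult = (*), one = 1, zero = 0, add = (+),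
     smult = (\<lambda>c. Poly_Mapping.map (\<lambda>f. plane_const c * f)),
     cstar_act = (\<lambda>s. Poly_Mapping.mapp (\<lambda>n f. plane_const (s powi n) * f))\<rparr>"

end

theory Submission
  imports Defs
    "HOL-Computational_Algebra.Polynomial_Factorial"
    "HOL-Computational_Algebra.Field_as_Ring"
    "HOL-Computational_Algebra.Fundamental_Theorem_Algebra"
begin

text \<open>Put \<open>m = dl - 1\<close>, let \<open>L\<close> be the field of \<open>\<mu>\<^sub>m\<close>-invariants in \<open>\<complex>(u', v')\<close>, and let
  \<open>T = v' + (u' + v'\<^sup>d)\<^sup>l\<close>. Over a point of the threefold with \<open>y \<noteq> 0\<close> choose \<open>\<eta>\<close> with \<open>\<eta>\<^sup>m = y\<close> and put
  \<open>u' = z\<^sup>\<alpha>\<^sup>2 \<eta>\<^sup>d\<close>, \<open>v' = x \<eta>\<close>. Another choice of \<open>\<eta>\<close> moves \<open>(u', v')\<close> by \<open>\<mu>\<^sub>m\<close>, and since \<open>m + 1 = dl\<close> the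
  equation of the threefold becomes \<open>t\<^sup>\<alpha>\<^sup>3 \<eta> = - T(u', v')\<close>. So \<open>u'\<close> vanishes to order
  \<open>\<alpha>\<^sub>2\<close> along \<open>{z = 0}\<close> and \<open>T\<close> to order \<open>\<alpha>\<^sub>3\<close> along \<open>{t = 0}\<close>, which explains the denominators in the
  coefficients of \<open>D\<^sub>3\<close> and \<open>D\<^sub>2\<close>. As
  \<open>a' d\<alpha>\<^sub>3 + b' \<alpha>\<^sub>2 = 1\<close>, the function \<open>z\<^sup>a\<^sup>' t\<^sup>b\<^sup>'\<close> has weight one, and every homogeneous rational function
  of degree \<open>n\<close> is \<open>g(u', v') (z\<^sup>a\<^sup>' t\<^sup>b\<^sup>')\<^sup>n\<close> for a unique \<open>g \<in> L\<close>.

  Write \<open>g = u'\<^sup>i T\<^sup>j h\<close>. In terms of \<open>x, y, z, t\<close> a monomial \<open>u'\<^sup>p v'\<^sup>q\<close> of \<open>h\<close> contributes, up to sign,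
  \<open>x\<^sup>q z\<^sup>\<alpha>\<^sup>2\<^sup>p \<cdot> z\<^sup>e\<^sup>1 t\<^sup>e\<^sup>2 \<cdot> \<eta>\<^sup>k\<close> with \<open>e\<^sub>1 = \<alpha>\<^sub>2 i + a' n\<close>, \<open>e\<^sub>2 = \<alpha>\<^sub>3 j + b' n\<close>, \<open>k = d(i + p) + j + q\<close>. The
  condition on a section of degree \<open>n\<close> at \<open>D\<^sub>3\<close> says \<open>e\<^sub>1 \<ge> 0\<close>, the one at \<open>D\<^sub>2\<close> says \<open>e\<^sub>2 \<ge> 0\<close>; along
  \<open>E\<close> the order is the smallest \<open>k\<close>, so the condition there says, given the two others, that all \<open>k\<close> are
  nonnegative, and they are divisible by \<open>m\<close> by invariance, so that \<open>\<eta>\<^sup>k\<close> is a power of \<open>y\<close>; at all other divisors the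
  conditions say that \<open>h\<close> is a polynomial. Hence sections are exactly the regular functions
  (\<open>sections_eq_piece\<close>, \<open>represents_piece\<close>, \<open>represents_coords\<close>). The correspondence is one to one because
  the points with \<open>y z t \<noteq> 0\<close> are dense in the threefold (\<open>polyfun_determined\<close>) and form, over each
  \<open>(u', v')\<close> with \<open>u' T \<noteq> 0\<close>, a \<open>\<complex>\<^sup>*\<close>-orbit on which the weight-one function takes all nonzero values
  (\<open>represents_unique\<close>).

  To read off the conditions one has to know all prime divisors of the quotient as discrete valuation
  rings. A discrete valuation ring is maximal among the proper subrings of its fraction field
  (\<open>dvr_maximal\<close>), so it suffices to show that the local ring of a point over the origin is contained in
  that of \<open>E\<close> (\<open>subset_exc_ring\<close>) and that of any other point on a curve in that of the curve
  (\<open>subset_curve_ring\<close>). The same two facts identify the exceptional divisor and the fibres of the quotient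
  map over \<open>E'\<close>, \<open>D\<^sub>2'\<close>, \<open>D\<^sub>3'\<close>; with the ramification indices \<open>m, 1, 1\<close> there, this gives the pull-back
  formula.\<close>

section \<open>Discrete valuations of a field\<close>

lemma Units_ring_of: "Units (ring_of R) = {f \<in> R. f \<noteq> 0 \<and> inverse f \<in> (R::'k::field set)}"
proof -
  have "g = inverse f" if "g * f = 1" for f g :: 'k
    using that by (metis inverse_unique mult.commute)
  then show ?thesis
    unfolding Units_def ring_of_def
    by (auto intro!: bexI[of _ "inverse _"] simp: mult.commute)
qed

lemma max_ideal_iff:
  "f \<in> max_ideal R \<longleftrightarrow> f \<in> R \<and> (f = 0 \<or> inverse f \<notin> (R::'k::field set))"
  by (auto simp: max_ideal_def Units_ring_of)

definition valuation_ring :: "('k::field \<Rightarrow> int) \<Rightarrow> 'k set" where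
  "valuation_ring \<nu> = {f. f = 0 \<or> 0 \<le> \<nu> f}"

locale discrete_valuation =
  fixes \<nu> :: "'k::field \<Rightarrow> int"
  assumes val_mult: "\<lbrakk>f \<noteq> 0; g \<noteq> 0\<rbrakk> \<Longrightarrow> \<nu> (f * g) = \<nu> f + \<nu> g"
    and val_add: "\<lbrakk>f \<noteq> 0; g \<noteq> 0; f + g \<noteq> 0; k \<le> \<nu> f; k \<le> \<nu> g\<rbrakk> \<Longrightarrow> k \<le> \<nu> (f + g)"
begin

lemma val_1 [simp]: "\<nu> 1 = 0"
  using val_mult[of 1 1] by simp

lemma val_inverse: "f \<noteq> 0 \<Longrightarrow> \<nu> (inverse f) = - \<nu> f"
  using val_mult[of f "inverse f"] by simp

lemma val_divide: "\<lbrakk>f \<noteq> 0; g \<noteq> 0\<rbrakk> \<Longrightarrow> \<nu> (f / g) = \<nu> f - \<nu> g"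
  by (simp add: divide_inverse val_mult val_inverse)

lemma val_power: "f \<noteq> 0 \<Longrightarrow> \<nu> (f ^ n) = int n * \<nu> f"
  by (induction n) (simp_all add: val_mult algebra_simps)

lemma val_powi: "f \<noteq> 0 \<Longrightarrow> \<nu> (f powi k) = k * \<nu> f"
  by (auto simp: power_int_def val_power val_inverse power_inverse)

lemma val_uminus: "f \<noteq> 0 \<Longrightarrow> \<nu> (- f) = \<nu> f"
  using val_mult[of "-1" f] val_mult[of "-1" "-1"] by simp

abbreviation val_ring :: "'k set" where "val_ring \<equiv> valuation_ring \<nu>"

lemma val_ring_closed:
  "0 \<in> val_ring" "1 \<in> val_ring"
  "f \<in> val_ring \<Longrightarrow> g \<in> val_ring \<Longrightarrow> f * g \<in> val_ring"
  "f \<in> val_ring \<Longrightarrow> g \<in> val_ring \<Longrightarrow> f + g \<in> val_ring"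
  "f \<in> val_ring \<Longrightarrow> - f \<in> val_ring"
proof -
  show "f * g \<in> val_ring" if "f \<in> val_ring" "g \<in> val_ring"
    using that by (cases "f = 0 \<or> g = 0") (auto simp: valuation_ring_def val_mult)
  show "f + g \<in> val_ring" if "f \<in> val_ring" "g \<in> val_ring"
    using that val_add[of f g 0] by (cases "f = 0 \<or> g = 0 \<or> f + g = 0") (auto simp: valuation_ring_def)
  show "- f \<in> val_ring" if "f \<in> val_ring"
    using that by (cases "f = 0") (auto simp: valuation_ring_def val_uminus)
qed (auto simp: valuation_ring_def)

end

text \<open>The restriction of a valuation to a subfield need not have value group \<open>\<int>\<close>; the
  generator \<open>e\<close> of its value group is the ramification index, by which orders along the
  restricted ring have to be divided.\<close>

locale restricted_valuation = discrete_valuation \<nu> for \<nu> :: "'k::field \<Rightarrow> int" +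
  fixes L :: "'k set" and e :: int
  assumes L_1: "1 \<in> L" and L_mult: "\<lbrakk>f \<in> L; g \<in> L\<rbrakk> \<Longrightarrow> f * g \<in> L"
    and L_inverse: "f \<in> L \<Longrightarrow> inverse f \<in> L"
    and e_pos: "0 < e" and e_attained: "\<exists>p\<in>L. p \<noteq> 0 \<and> \<nu> p = e"
    and e_dvd: "\<lbrakk>f \<in> L; f \<noteq> 0\<rbrakk> \<Longrightarrow> e dvd \<nu> f"
begin

lemma L_divide: "\<lbrakk>f \<in> L; g \<in> L\<rbrakk> \<Longrightarrow> f / g \<in> L"
  by (simp add: divide_inverse L_mult L_inverse)

lemma L_power: "f \<in> L \<Longrightarrow> f ^ n \<in> L"
  by (induction n) (auto simp: L_1 L_mult)

lemma L_powi: "f \<in> L \<Longrightarrow> f powi k \<in> L"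
  by (simp add: power_int_def L_power L_inverse)

lemma Units_val_ring: "Units (ring_of (val_ring \<inter> L)) = {f \<in> L. f \<noteq> 0 \<and> \<nu> f = 0}"
  by (auto simp: Units_ring_of valuation_ring_def val_inverse L_inverse)

lemma max_ideal_val_ring: "max_ideal (val_ring \<inter> L) = {f \<in> L. f = 0 \<or> 0 < \<nu> f}"
  unfolding max_ideal_def Units_val_ring by (auto simp: valuation_ring_def)

lemma uniformizer_iff: "uniformizer (val_ring \<inter> L) p \<longleftrightarrow> p \<in> L \<and> p \<noteq> 0 \<and> \<nu> p = e"
proof
  assume p: "uniformizer (val_ring \<inter> L) p"
  obtain p0 where p0: "p0 \<in> L" "p0 \<noteq> 0" "\<nu> p0 = e" using e_attained by blast
  from p have p': "p \<in> L" "p \<noteq> 0" "0 < \<nu> p"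
    by (auto simp: uniformizer_def max_ideal_val_ring)
  have "p0 \<in> val_ring \<inter> L - {0}" using p0 e_pos by (auto simp: valuation_ring_def)
  with p obtain g n where g: "g \<in> Units (ring_of (val_ring \<inter> L))" "p0 = g * p ^ n"
    unfolding uniformizer_def by blast
  have "e = int n * \<nu> p"
    using g p0 p' by (auto simp: Units_val_ring val_mult val_power)
  then have "\<nu> p dvd e" by simp
  moreover have "e dvd \<nu> p" using e_dvd p' by blast
  ultimately show "p \<in> L \<and> p \<noteq> 0 \<and> \<nu> p = e"
    using p' e_pos by (metis zdvd_antisym_nonneg order_less_imp_le)
next
  assume p: "p \<in> L \<and> p \<noteq> 0 \<and> \<nu> p = e"
  have "\<exists>g\<in>Units (ring_of (val_ring \<inter> L)). \<exists>n::nat. f = g * p ^ n"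
    if f: "f \<in> val_ring \<inter> L - {0}" for f
  proof -
    obtain k where k: "\<nu> f = e * k" using e_dvd f by (auto simp: dvd_def)
    have "0 \<le> k" using k f e_pos by (auto simp: valuation_ring_def zero_le_mult_iff)
    then have "f / p ^ nat k \<in> Units (ring_of (val_ring \<inter> L))" "f = f / p ^ nat k * p ^ nat k"
      using f p k by (auto simp: Units_val_ring L_divide L_power val_divide val_power)
    then show ?thesis by blast
  qed
  then show "uniformizer (val_ring \<inter> L) p"
    using p e_pos by (auto simp: uniformizer_def max_ideal_val_ring)
qed

lemma has_uniformizer: "\<exists>p. uniformizer (val_ring \<inter> L) p"
  using e_attained by (auto simp: uniformizer_iff)

lemma ord_at_val_ring:
  assumes f: "f \<in> L" "f \<noteq> 0"
  shows "ord_at (val_ring \<inter> L) f = \<nu> f div e"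
proof -
  obtain k where k: "\<nu> f = e * k" using e_dvd f by (auto simp: dvd_def)
  obtain p where p: "p \<in> L" "p \<noteq> 0" "\<nu> p = e" using e_attained by blast
  show ?thesis unfolding ord_at_def uniformizer_iff Units_val_ring
  proof (rule the_equality)
    have "f = f / p powi k * p powi k" using p by simp
    moreover have "f / p powi k \<in> {f \<in> L. f \<noteq> 0 \<and> \<nu> f = 0}"
      using p f k by (auto simp: L_divide L_powi val_divide val_powi)
    ultimately show "\<exists>q. (q \<in> L \<and> q \<noteq> 0 \<and> \<nu> q = e) \<and>
        (\<exists>g\<in>{f \<in> L. f \<noteq> 0 \<and> \<nu> f = 0}. f = g * q powi (\<nu> f div e))"
      using p k e_pos by (intro exI[of _ p] conjI bexI[of _ "f / p powi k"]) auto
  next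
    fix j assume "\<exists>q. (q \<in> L \<and> q \<noteq> 0 \<and> \<nu> q = e) \<and>
        (\<exists>g\<in>{f \<in> L. f \<noteq> 0 \<and> \<nu> f = 0}. f = g * q powi j)"
    then show "j = \<nu> f div e"
      using f e_pos by (auto simp: val_mult val_powi)
  qed
qed

end

text \<open>The orders of the nonzero elements of \<open>L\<close> form a subgroup of \<open>\<int>\<close>, whose least positive
  element is the ramification index.\<close>

lemma (in discrete_valuation) restricted_valuation_exists:
  assumes "1 \<in> L" "\<And>f g. \<lbrakk>f \<in> L; g \<in> L\<rbrakk> \<Longrightarrow> f * g \<in> L" "\<And>f. f \<in> L \<Longrightarrow> inverse f \<in> L"
    and f: "f \<in> L" "f \<noteq> 0" "\<nu> f \<noteq> 0"
  shows "\<exists>e. restricted_valuation \<nu> L e"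
proof -
  define G where "G = {\<nu> g | g. g \<in> L \<and> g \<noteq> 0}"
  have G_diff: "x - y \<in> G" if "x \<in> G" "y \<in> G" for x y
  proof -
    from that obtain g h where gh: "g \<in> L" "g \<noteq> 0" "h \<in> L" "h \<noteq> 0" "x = \<nu> g" "y = \<nu> h"
      unfolding G_def by blast
    then have "g * inverse h \<in> L" "\<nu> (g * inverse h) = x - y"
      by (simp_all add: assms(2,3) val_mult val_inverse)
    then show ?thesis using gh unfolding G_def
      by (metis (mono_tags, lifting) mem_Collect_eq mult_eq_0_iff inverse_nonzero_iff_nonzero)
  qed
  have G0: "0 \<in> G" using assms(1) by (force simp: G_def intro: exI[of _ 1])
  have G_neg: "- x \<in> G" if "x \<in> G" for x using G_diff[OF G0 that] by simp
  have G_add: "x + y \<in> G" if "x \<in> G" "y \<in> G" for x y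
    using G_diff[OF that(1) G_neg[OF that(2)]] by simp
  have G_mult: "x * k \<in> G" if x: "x \<in> G" for x k
  proof -
    have nat: "x * int n \<in> G" for n by (induction n) (auto simp: G0 G_add x algebra_simps)
    show ?thesis using nat G_neg[OF nat] by (cases k rule: int_cases2) auto
  qed
  have fG: "\<nu> f \<in> G" using f by (auto simp: G_def)
  define n where "n = (LEAST n::nat. 0 < n \<and> int n \<in> G)"
  have "\<exists>n::nat. 0 < n \<and> int n \<in> G"
    using fG G_neg[OF fG] f(3) by (intro exI[of _ "nat \<bar>\<nu> f\<bar>"]) (auto simp: abs_if)
  then have n: "0 < n" "int n \<in> G" and least: "\<And>k. 0 < k \<Longrightarrow> int k \<in> G \<Longrightarrow> n \<le> k"
    unfolding n_def by (metis (mono_tags, lifting) LeastI, metis (mono_tags, lifting) LeastI)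
      (metis (mono_tags, lifting) Least_le)
  have dvd: "int n dvd x" if "x \<in> G" for x
  proof -
    have "x mod int n = x - int n * (x div int n)" by (simp add: minus_mult_div_eq_mod)
    then have r: "x mod int n \<in> G" using G_diff[OF that G_mult[OF n(2)]] by simp
    have bd: "0 \<le> x mod int n" "x mod int n < int n" using n(1) by auto
    have "\<not> 0 < x mod int n"
    proof
      assume "0 < x mod int n"
      then have "n \<le> nat (x mod int n)" using r by (intro least) auto
      then show False using bd by linarith
    qed
    then show ?thesis using bd by (simp add: dvd_eq_mod_eq_0)
  qed
  have dvd': "int n dvd \<nu> h" if "h \<in> L" "h \<noteq> 0" for h
    using that by (intro dvd) (auto simp: G_def)
  obtain g where "g \<in> L" "g \<noteq> 0" "\<nu> g = int n" using n(2) by (auto simp: G_def)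
  then have "restricted_valuation \<nu> L (int n)"
    using assms n(1) dvd'
    by (intro restricted_valuation.intro discrete_valuation_axioms restricted_valuation_axioms.intro)
      (auto simp: G_def)
  then show ?thesis ..
qed

text \<open>A discrete valuation ring is maximal among the proper subrings of its fraction field: a
  new element would have negative order, hence would make a uniformizer invertible.\<close>

lemma dvr_maximal:
  assumes p: "uniformizer R p" and R_mult: "\<And>f g. \<lbrakk>f \<in> R; g \<in> R\<rbrakk> \<Longrightarrow> f * g \<in> R" and "R \<subseteq> S"
    and S_mult: "\<And>f g. \<lbrakk>f \<in> S; g \<in> S\<rbrakk> \<Longrightarrow> f * g \<in> S"
    and f: "f \<in> S" "f \<in> fraction_field_of R" and g: "g \<notin> S" "g \<in> fraction_field_of R"
  shows "f \<in> (R :: 'k::field set)"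
proof (cases "f = 0")
  case True
  then show ?thesis using p R_mult f(2) by (auto simp: fraction_field_of_def)
next
  case False
  have p0: "p \<noteq> 0" "p \<in> R" using p by (auto simp: uniformizer_def max_ideal_iff)
  have rep: "\<exists>c\<in>Units (ring_of R). \<exists>i j::nat. h * p ^ j = c * p ^ i"
    if "h \<in> fraction_field_of R" "h \<noteq> 0" for h
  proof -
    obtain a b where ab: "h = a / b" "a \<in> R - {0}" "b \<in> R - {0}"
      using \<open>h \<in> fraction_field_of R\<close> \<open>h \<noteq> 0\<close> unfolding fraction_field_of_def by auto
    obtain c1 i where c1: "c1 \<in> Units (ring_of R)" "a = c1 * p ^ i"
      using p ab(2) unfolding uniformizer_def by blast
    obtain c2 j where c2: "c2 \<in> Units (ring_of R)" "b = c2 * p ^ j"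
      using p ab(3) unfolding uniformizer_def by blast
    have "c1 / c2 \<in> Units (ring_of R)"
      using c1(1) c2(1) R_mult by (auto simp: Units_ring_of divide_inverse)
    moreover have "h * p ^ j = c1 / c2 * p ^ i"
      using ab c1 c2 by (auto simp: field_simps)
    ultimately show ?thesis by blast
  qed
  have S_pow: "c * x ^ n \<in> S" if "c \<in> S" "x \<in> S" for c x n
    using that by (induction n) (auto simp: mult.left_commute[of c] S_mult)
  have R_pow: "c * x ^ n \<in> R" if "c \<in> R" "x \<in> R" for c x n
    using that by (induction n) (auto simp: mult.left_commute[of c] R_mult)
  obtain c i j where c: "c \<in> Units (ring_of R)" "f * p ^ j = c * p ^ i"
    using rep[OF f(2) False] by blast
  show ?thesis
  proof (cases "j \<le> i")
    case True
    have "f = c * p ^ (i - j)" using c(2) p0 True by (simp add: power_diff field_simps)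
    then show ?thesis using R_pow c(1) p0 by (auto simp: Units_ring_of)
  next
    case False
    have "f = c * inverse (p ^ (j - i))"
      using c(2) p0 False by (simp add: power_diff field_simps)
    moreover have "c \<noteq> 0" "inverse c \<in> S" using c(1) \<open>R \<subseteq> S\<close> by (auto simp: Units_ring_of)
    ultimately have "inverse (p ^ (j - i)) \<in> S"
      using S_mult[OF f(1), of "inverse c"] by (simp add: field_simps)
    then have "inverse (p ^ (j - i)) * p ^ (j - i - 1) \<in> S"
      using p0 \<open>R \<subseteq> S\<close> by (intro S_pow) auto
    moreover have "inverse (p ^ (j - i)) * p ^ (j - i - 1) = inverse p"
    proof -
      have "j - i = Suc (j - i - 1)" using False by simp
      then have "p ^ (j - i) = p * p ^ (j - i - 1)" by (metis power_Suc)
      then show ?thesis using p0 by (simp add: field_simps)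
    qed
    ultimately have inv_p: "inverse p \<in> S" by simp
    have "g \<noteq> 0"
      using g(1) S_mult p0 R_mult R_pow g(2) \<open>R \<subseteq> S\<close> by (auto simp: fraction_field_of_def)
    obtain c i j where c: "c \<in> Units (ring_of R)" "g * p ^ j = c * p ^ i"
      using rep[OF g(2) \<open>g \<noteq> 0\<close>] by blast
    have "g = c * p ^ i * inverse p ^ j" using c(2) p0 by (simp add: power_inverse field_simps)
    moreover have "c * p ^ i \<in> S" using R_pow c(1) p0 \<open>R \<subseteq> S\<close> by (auto simp: Units_ring_of)
    ultimately have "g \<in> S" using S_pow inv_p by simp
    then show ?thesis using g(1) by simp
  qed
qed

section \<open>Localizations and blow-up charts inside a field\<close>

lemma ring_of_simps [simp]:
  "carrier (ring_of A) = A" "mult (ring_of A) = (*)" "one (ring_of A) = 1"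
  "zero (ring_of A) = 0" "add (ring_of A) = (+)"
  by (simp_all add: ring_of_def)

locale subring_set =
  fixes A :: "'k::comm_ring_1 set"
  assumes A_1: "1 \<in> A" and A_neg: "f \<in> A \<Longrightarrow> - f \<in> A"
    and A_add: "\<lbrakk>f \<in> A; g \<in> A\<rbrakk> \<Longrightarrow> f + g \<in> A"
    and A_mult: "\<lbrakk>f \<in> A; g \<in> A\<rbrakk> \<Longrightarrow> f * g \<in> A"
begin

lemma A_0: "0 \<in> A"
  using A_add[OF A_1 A_neg[OF A_1]] by simp

lemma A_power: "f \<in> A \<Longrightarrow> f ^ n \<in> A"
  by (induction n) (auto simp: A_1 A_mult)

lemma cring_ring_of: "cring (ring_of A)"
proof (intro cringI abelian_groupI comm_monoidI)
  fix x assume "x \<in> carrier (ring_of A)"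
  then show "\<exists>y\<in>carrier (ring_of A). y \<oplus>\<^bsub>ring_of A\<^esub> x = \<zero>\<^bsub>ring_of A\<^esub>"
    by (intro bexI[of _ "- x"]) (auto simp: A_neg)
qed (auto simp: A_0 A_1 A_add A_mult algebra_simps)

lemma a_inv_ring_of: "f \<in> A \<Longrightarrow> \<ominus>\<^bsub>ring_of A\<^esub> f = - f"
  using cring.sum_zero_eq_neg[OF cring_ring_of, of "- f" f] by (simp add: A_neg)

end

locale prime_of_subring = subring_set A for A :: "'k::field set" +
  fixes P :: "'k set"
  assumes P_sub: "P \<subseteq> A" and P_0: "0 \<in> P" and P_add: "\<lbrakk>f \<in> P; g \<in> P\<rbrakk> \<Longrightarrow> f + g \<in> P"
    and P_mult: "\<lbrakk>f \<in> A; g \<in> P\<rbrakk> \<Longrightarrow> f * g \<in> P"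
    and P_1: "1 \<notin> P" and P_prime: "\<lbrakk>f \<in> A; g \<in> A; f * g \<in> P\<rbrakk> \<Longrightarrow> f \<in> P \<or> g \<in> P"
begin

lemma localization_superset: "A \<subseteq> localization A P"
  unfolding localization_def using A_1 P_1 by force

lemma localization_mult:
  assumes "f \<in> localization A P" "g \<in> localization A P"
  shows "f * g \<in> localization A P"
proof -
  obtain a s b t where "f = a / s" "g = b / t" "a \<in> A" "b \<in> A" "s \<in> A - P" "t \<in> A - P"
    using assms unfolding localization_def by blast
  then have "f * g = (a * b) / (s * t)" "a * b \<in> A" "s * t \<in> A - P"
    using A_mult P_prime by auto
  then show ?thesis unfolding localization_def by blast
qed

text \<open>An element of \<open>P\<close> stays a nonunit: if \<open>1/f = a/s\<close> then \<open>s = a f\<close> would lie in \<open>P\<close>.\<close>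

lemma max_ideal_localization:
  assumes f: "f \<in> A"
  shows "f \<in> max_ideal (localization A P) \<longleftrightarrow> f \<in> P"
proof
  assume "f \<in> max_ideal (localization A P)"
  then have "f = 0 \<or> inverse f \<notin> localization A P" by (simp add: max_ideal_iff)
  then show "f \<in> P"
    using f A_1 P_0 unfolding localization_def by (auto simp: inverse_eq_divide)
next
  assume fP: "f \<in> P"
  have "False" if "f \<noteq> 0" and inv: "inverse f \<in> localization A P"
  proof -
    obtain a s where as: "inverse f = a / s" "a \<in> A" "s \<in> A" "s \<notin> P"
      using inv unfolding localization_def by auto
    have "s \<noteq> 0" using as P_0 by auto
    with as \<open>f \<noteq> 0\<close> have "s = a * f" by (simp add: field_simps)
    then show False using as P_mult fP by auto
  qed
  then show "f \<in> max_ideal (localization A P)"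
    using localization_superset f by (auto simp: max_ideal_iff)
qed

lemma localization_subset:
  assumes "A \<subseteq> S" "\<And>f g. \<lbrakk>f \<in> S; g \<in> S\<rbrakk> \<Longrightarrow> f * g \<in> S" "\<And>s. s \<in> A - P \<Longrightarrow> inverse s \<in> S"
  shows "localization A P \<subseteq> S"
  using assms unfolding localization_def by (auto simp: divide_inverse)

end

lemma (in subring_set) ideal_iff:
  "ideal P (ring_of A) \<longleftrightarrow> P \<subseteq> A \<and> 0 \<in> P \<and> (\<forall>f\<in>P. \<forall>g\<in>P. f + g \<in> P) \<and> (\<forall>f\<in>A. \<forall>g\<in>P. f * g \<in> P)"
proof
  assume "ideal P (ring_of A)"
  then interpret ideal P "ring_of A" .
  show "P \<subseteq> A \<and> 0 \<in> P \<and> (\<forall>f\<in>P. \<forall>g\<in>P. f + g \<in> P) \<and> (\<forall>f\<in>A. \<forall>g\<in>P. f * g \<in> P)"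
    using a_subset I_l_closed additive_subgroup.zero_closed[OF is_additive_subgroup]
      additive_subgroup.a_closed[OF is_additive_subgroup] by auto
next
  assume P: "P \<subseteq> A \<and> 0 \<in> P \<and> (\<forall>f\<in>P. \<forall>g\<in>P. f + g \<in> P) \<and> (\<forall>f\<in>A. \<forall>g\<in>P. f * g \<in> P)"
  interpret cring "ring_of A" by (rule cring_ring_of)
  have neg: "- f \<in> P" if "f \<in> P" for f
  proof -
    have "- 1 * f \<in> P" using P A_neg[OF A_1] that by blast
    then show ?thesis by simp
  qed
  show "ideal P (ring_of A)"
  proof (rule idealI[OF ring_axioms])
    show "subgroup P (add_monoid (ring_of A))"
    proof (rule group.subgroupI)
      show "Group.group (add_monoid (ring_of A))" by (rule add.is_group)
      show "inv\<^bsub>add_monoid (ring_of A)\<^esub> a \<in> P" if "a \<in> P" for a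
        using a_inv_ring_of[of a] neg P that by (auto simp: a_inv_def)
    qed (use P in auto)
  next
    fix f g assume "f \<in> P" "g \<in> carrier (ring_of A)"
    then have "g * f \<in> P" using P by auto
    then show "f \<otimes>\<^bsub>ring_of A\<^esub> g \<in> P" "g \<otimes>\<^bsub>ring_of A\<^esub> f \<in> P"
      by (simp_all add: mult.commute)
  qed
qed

text \<open>Membership conditions for subsets of the field replace the structure-based notions from here on.\<close>

lemma primeideal_iff:
  assumes "subring_set (A :: 'k::field set)"
  shows "primeideal P (ring_of A) \<longleftrightarrow> prime_of_subring A P"
proof -
  interpret subring_set A by fact
  have "primeideal P (ring_of A) \<longleftrightarrow> ideal P (ring_of A) \<and> 1 \<notin> P \<and>
      (\<forall>f\<in>A. \<forall>g\<in>A. f * g \<in> P \<longrightarrow> f \<in> P \<or> g \<in> P)"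
  proof
    assume "primeideal P (ring_of A)"
    then interpret primeideal P "ring_of A" .
    have "1 \<notin> P" using one_imp_carrier I_notcarr by auto
    then show "ideal P (ring_of A) \<and> 1 \<notin> P \<and> (\<forall>f\<in>A. \<forall>g\<in>A. f * g \<in> P \<longrightarrow> f \<in> P \<or> g \<in> P)"
      using I_prime is_ideal by auto
  next
    assume *: "ideal P (ring_of A) \<and> 1 \<notin> P \<and> (\<forall>f\<in>A. \<forall>g\<in>A. f * g \<in> P \<longrightarrow> f \<in> P \<or> g \<in> P)"
    show "primeideal P (ring_of A)"
      using * A_1 by (intro primeidealI cring_ring_of) auto
  qed
  then show ?thesis
    unfolding ideal_iff prime_of_subring_def prime_of_subring_axioms_def
    using subring_set_axioms by blast
qed

lemma subring_generate_ring: "subring_set (generate_ring (ring_of UNIV) (H :: 'k::comm_ring_1 set))"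
proof -
  have neg: "\<ominus>\<^bsub>ring_of UNIV\<^esub> f = - f" for f :: 'k
    by (rule subring_set.a_inv_ring_of) (unfold_locales, auto)
  let ?G = "generate_ring (ring_of UNIV) H"
  show ?thesis
  proof
    show "1 \<in> ?G" using generate_ring.one[of "ring_of UNIV" H] by simp
    show "- f \<in> ?G" if "f \<in> ?G" for f
      using generate_ring.a_inv[OF that] by (simp add: neg)
    show "f + g \<in> ?G" if "f \<in> ?G" "g \<in> ?G" for f g
      using generate_ring.eng_add[OF that] by simp
    show "f * g \<in> ?G" if "f \<in> ?G" "g \<in> ?G" for f g
      using generate_ring.eng_mult[OF that] by simp
  qed
qed

lemma generate_ring_minimal:
  assumes "subring_set (B :: 'k::comm_ring_1 set)" "H \<subseteq> B"
  shows "generate_ring (ring_of UNIV) H \<subseteq> B"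
proof
  interpret subring_set B by fact
  have neg: "\<ominus>\<^bsub>ring_of UNIV\<^esub> f = - f" for f :: 'k
    by (rule subring_set.a_inv_ring_of) (unfold_locales, auto)
  fix f assume "f \<in> generate_ring (ring_of UNIV) H"
  then show "f \<in> B"
    by induction (use assms(2) neg A_1 A_neg A_add A_mult in auto)
qed

definition blow_up_chart :: "'k::field set \<Rightarrow> 'k set \<Rightarrow> 'k \<Rightarrow> 'k set" where
  "blow_up_chart A F f = generate_ring (ring_of UNIV) (A \<union> (\<lambda>g. g / f) ` F)"

lemma subring_blow_up_chart: "subring_set (blow_up_chart A F f)"
  unfolding blow_up_chart_def by (rule subring_generate_ring)

lemma generators_in_blow_up_chart: "A \<subseteq> blow_up_chart A F f" "g \<in> F \<Longrightarrow> g / f \<in> blow_up_chart A F f"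
  unfolding blow_up_chart_def by (auto intro: generate_ring.incl)

lemma blow_up_chart_minimal:
  "\<lbrakk>subring_set B; A \<subseteq> B; \<And>g. g \<in> F \<Longrightarrow> g / f \<in> B\<rbrakk> \<Longrightarrow> blow_up_chart A F f \<subseteq> B"
  unfolding blow_up_chart_def by (rule generate_ring_minimal) auto

lemma blow_up_iff:
  "R \<in> blow_up A F \<longleftrightarrow> (\<exists>f\<in>F - {0}. \<exists>P. prime_of_subring (blow_up_chart A F f) P \<and>
     R = localization (blow_up_chart A F f) P)"
  by (auto simp: blow_up_def Spec_def image_iff blow_up_chart_def[symmetric]
      primeideal_iff[OF subring_blow_up_chart])

context discrete_valuation
begin

lemma subring_val_ring: "subring_set val_ring"
  by unfold_locales (auto simp: val_ring_closed)

lemma max_ideal_val_ring_UNIV: "max_ideal val_ring = {f. f = 0 \<or> 0 < \<nu> f}"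
  by (auto simp: max_ideal_iff valuation_ring_def val_inverse)

text \<open>This is how valuation rings are recognised as points of a chart: the centre of the valuation
  has the valuation ring as local ring once every element has a denominator of order zero.\<close>

lemma val_ring_eq_localization:
  assumes "subring_set B" "B \<subseteq> val_ring"
    and "\<And>f. f \<in> val_ring \<Longrightarrow> \<exists>a\<in>B. \<exists>s\<in>B. s \<noteq> 0 \<and> \<nu> s = 0 \<and> f = a / s"
  shows "prime_of_subring B {f \<in> B. f = 0 \<or> 0 < \<nu> f}"
    and "val_ring = localization B {f \<in> B. f = 0 \<or> 0 < \<nu> f}"
proof -
  interpret subring_set B by fact
  let ?P = "{f \<in> B. f = 0 \<or> 0 < \<nu> f}"
  interpret prime_of_subring B ?P
  proof
    fix f g assume f: "f \<in> ?P" and g: "g \<in> ?P"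
    then show "f + g \<in> ?P"
      using val_add[of f g 1] A_add[of f g] by (cases "f = 0 \<or> g = 0 \<or> f + g = 0") auto
  next
    fix f g assume f: "f \<in> B" and g: "g \<in> ?P"
    then have "f = 0 \<or> 0 \<le> \<nu> f" using assms(2) by (auto simp: valuation_ring_def)
    then show "f * g \<in> ?P" using f g A_mult[of f g] by (cases "f = 0 \<or> g = 0") (auto simp: val_mult)
  next
    fix f g assume fg: "f \<in> B" "g \<in> B" "f * g \<in> ?P"
    then have "f = 0 \<or> 0 \<le> \<nu> f" "g = 0 \<or> 0 \<le> \<nu> g" using assms(2) by (auto simp: valuation_ring_def)
    then show "f \<in> ?P \<or> g \<in> ?P" using fg by (cases "f = 0 \<or> g = 0") (auto simp: val_mult)
  qed (auto simp: A_0)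
  show "prime_of_subring B ?P" by unfold_locales
  show "val_ring = localization B ?P"
  proof
    show "val_ring \<subseteq> localization B ?P"
      using assms(3) unfolding localization_def by fastforce
    show "localization B ?P \<subseteq> val_ring"
    proof (rule localization_subset)
      fix s assume s: "s \<in> B - ?P"
      then have "0 \<le> \<nu> s" "s \<noteq> 0" using assms(2) A_0 by (auto simp: valuation_ring_def)
      then show "inverse s \<in> val_ring" using s by (auto simp: valuation_ring_def val_inverse)
    qed (use assms(2) val_ring_closed in auto)
  qed
qed

text \<open>A valuation ring is dominated by no other local ring of its fraction field, so a strict
  transform whose generic point has a valuation ring on the blow-up keeps its local ring.\<close>

lemma strict_transform_val_ring:
  assumes "val_ring \<in> Y"
  shows "strict_transform Y val_ring = val_ring"
  unfolding strict_transform_def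
proof (rule the_equality)
  show "val_ring \<in> Y \<and> dominates val_ring val_ring"
    using assms by (auto simp: dominates_def max_ideal_iff)
next
  fix R assume R: "R \<in> Y \<and> dominates R val_ring"
  have "f \<in> val_ring" if f: "f \<in> R" for f
  proof (rule ccontr)
    assume neg: "f \<notin> val_ring"
    then have "inverse f \<in> max_ideal val_ring"
      unfolding max_ideal_val_ring_UNIV by (auto simp: valuation_ring_def val_inverse)
    then have "inverse f \<in> max_ideal R" using R by (auto simp: dominates_def)
    then show False using f neg by (auto simp: max_ideal_iff valuation_ring_def)
  qed
  then show "R = val_ring" using R by (auto simp: dominates_def)
qed

end

section \<open>Substitutions in the polynomial ring of the plane\<close>

type_synonym bipoly = "complex poly poly"

definition const2 :: "complex \<Rightarrow> bipoly" where "const2 c = [:[:c:]:]"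
definition X_u :: bipoly where "X_u = [:[:0, 1:]:]"
definition X_v :: bipoly where "X_v = [:0, 1:]"

lemma const2_hom [simp]:
  "const2 0 = 0" "const2 1 = 1" "const2 (a + b) = const2 a + const2 b"
  "const2 (a * b) = const2 a * const2 b" "const2 a = 0 \<longleftrightarrow> a = 0"
  by (simp_all add: const2_def one_pCons)

lemma const2_power: "const2 (a ^ n) = const2 a ^ n"
  by (induction n) auto

lemma plane_generators:
  "plane_const c = to_fract (const2 c)" "plane_u = to_fract X_u" "plane_v = to_fract X_v"
  by (simp_all add: plane_const_def plane_u_def plane_v_def to_fract_def const2_def X_u_def X_v_def)

lemma plane_eq: "plane = range to_fract"
  by (simp add: plane_def to_fract_def)

lemma inner_pCons: "[:pCons a c:] = const2 a + X_u * [:c:]"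
  by (simp add: const2_def X_u_def)

lemma outer_pCons: "pCons c H = [:c:] + X_v * H"
  by (simp add: X_v_def)

lemma bipoly_hom_ext:
  fixes \<phi> \<psi> :: "bipoly \<Rightarrow> 'r::comm_ring_1"
  assumes "\<And>a b. \<phi> (a + b) = \<phi> a + \<phi> b" "\<And>a b. \<phi> (a * b) = \<phi> a * \<phi> b"
    and "\<And>a b. \<psi> (a + b) = \<psi> a + \<psi> b" "\<And>a b. \<psi> (a * b) = \<psi> a * \<psi> b"
    and "\<And>c. \<phi> (const2 c) = \<psi> (const2 c)" "\<phi> X_u = \<psi> X_u" "\<phi> X_v = \<psi> X_v"
  shows "\<phi> H = \<psi> H"
proof -
  have "\<phi> 0 = \<psi> 0" using assms(5)[of 0] by simp
  moreover have inner: "\<phi> [:c:] = \<psi> [:c:]" for c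
  proof (induction c)
    case 0
    then show ?case using \<open>\<phi> 0 = \<psi> 0\<close> by simp
  next
    case (pCons a c)
    then show ?case by (simp only: inner_pCons assms)
  qed
  ultimately show ?thesis
  proof (induction H)
    case (pCons c H)
    then show ?case by (simp only: outer_pCons[of c H] assms inner)
  qed simp
qed

text \<open>Evaluation at a pair of polynomials; the coefficients of the inner variable are substituted
  first.\<close>

definition subst_inner :: "bipoly \<Rightarrow> complex poly \<Rightarrow> bipoly" where
  "subst_inner U c = poly (map_poly const2 c) U"

definition subst :: "bipoly \<Rightarrow> bipoly \<Rightarrow> bipoly \<Rightarrow> bipoly" where
  "subst U W H = poly (map_poly (subst_inner U) H) W"

lemma subst_inner_pCons [simp]:
  "subst_inner U 0 = 0" "subst_inner U (pCons a c) = const2 a + U * subst_inner U c"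
  by (simp_all add: subst_inner_def map_poly_pCons)

lemma subst_pCons [simp]:
  "subst U W 0 = 0" "subst U W (pCons c H) = subst_inner U c + W * subst U W H"
  by (simp_all add: subst_def map_poly_pCons)

lemma subst_inner_add: "subst_inner U (a + b) = subst_inner U a + subst_inner U b"
proof (induction a arbitrary: b)
  case (pCons x a)
  then show ?case by (cases b) (simp add: algebra_simps)
qed simp

lemma subst_inner_mult: "subst_inner U (a * b) = subst_inner U a * subst_inner U b"
proof (induction a)
  case (pCons x a)
  have "subst_inner U (Polynomial.smult x b) = const2 x * subst_inner U b"
    by (induction b) (simp_all add: algebra_simps)
  then show ?case using pCons by (simp add: subst_inner_add algebra_simps)
qed simp

lemma subst_add: "subst U W (a + b) = subst U W a + subst U W b"
proof (induction a arbitrary: b)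
  case (pCons x a)
  then show ?case by (cases b) (simp add: algebra_simps subst_inner_add)
qed simp

lemma subst_mult: "subst U W (a * b) = subst U W a * subst U W b"
proof (induction a)
  case (pCons x a)
  have "subst U W (Polynomial.smult x b) = subst_inner U x * subst U W b"
    by (induction b) (simp_all add: algebra_simps subst_inner_mult)
  then show ?case using pCons by (simp add: subst_add algebra_simps)
qed simp

lemma subst_inner_1 [simp]: "subst_inner U 1 = 1"
  using subst_inner_pCons(2)[of U 1 0] by (simp add: pCons_one del: subst_inner_pCons(2))

lemma subst_1 [simp]: "subst U W 1 = 1"
  using subst_pCons(2)[of U W 1 0] by (simp add: pCons_one del: subst_pCons(2))

lemma subst_const [simp]: "subst U W (const2 c) = const2 c"
  and subst_X_u [simp]: "subst U W X_u = U" and subst_X_v [simp]: "subst U W X_v = W"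
  by (simp_all add: const2_def[of c] X_u_def X_v_def pCons_one)

lemma subst_power: "subst U W (a ^ n) = subst U W a ^ n"
  by (induction n) (simp_all add: subst_mult)

lemma subst_subst: "subst U W (subst U' W' H) = subst (subst U W U') (subst U W W') H"
  by (rule bipoly_hom_ext[where \<phi> = "\<lambda>H. subst U W (subst U' W' H)"])
    (simp_all add: subst_add subst_mult)

lemma subst_id: "subst X_u X_v H = H"
  by (rule bipoly_hom_ext[where \<psi> = "\<lambda>H. H"]) (simp_all add: subst_add subst_mult)

definition bicoeff :: "bipoly \<Rightarrow> nat \<Rightarrow> nat \<Rightarrow> complex" where
  "bicoeff H p q = poly.coeff (poly.coeff H q) p"

lemma bicoeff_eqI: "(\<And>p q. bicoeff H p q = bicoeff G p q) \<Longrightarrow> H = G"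
  by (simp add: bicoeff_def poly_eq_iff)

lemma bicoeff_simps [simp]:
  "bicoeff 0 p q = 0" "bicoeff (H + G) p q = bicoeff H p q + bicoeff G p q"
  "bicoeff (H - G) p q = bicoeff H p q - bicoeff G p q"
  "bicoeff (const2 c * H) p q = c * bicoeff H p q"
  "bicoeff [:e:] p q = (if q = 0 then poly.coeff e p else 0)"
  "bicoeff (pCons e H) p q = (case q of 0 \<Rightarrow> poly.coeff e p | Suc q' \<Rightarrow> bicoeff H p q')"
  "bicoeff (const2 c) p q = (if p = 0 \<and> q = 0 then c else 0)"
  "bicoeff 1 p q = (if p = 0 \<and> q = 0 then 1 else 0)"
  by (auto simp: bicoeff_def const2_def coeff_pCons split: nat.splits)

lemma bicoeff_X_u_mult: "bicoeff (X_u * H) p q = (case p of 0 \<Rightarrow> 0 | Suc p' \<Rightarrow> bicoeff H p' q)"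
  by (auto simp: bicoeff_def X_u_def coeff_pCons split: nat.splits)

lemma X_v_power: "X_v ^ n = Polynomial.monom 1 n"
  by (simp add: X_v_def monom_altdef)

lemma bicoeff_X_v_power_mult: "bicoeff (X_v ^ n * H) p q = (if n \<le> q then bicoeff H p (q - n) else 0)"
  by (simp add: bicoeff_def X_v_power coeff_monom_mult)

lemma bicoeff_X_v_mult: "bicoeff (X_v * H) p q = (case q of 0 \<Rightarrow> 0 | Suc q' \<Rightarrow> bicoeff H p q')"
  using bicoeff_X_v_power_mult[of 1 H] by (auto split: nat.splits)

lemma bicoeff_X_v_power: "bicoeff (X_v ^ n) p q = (if p = 0 \<and> q = n then 1 else 0)"
  using bicoeff_X_v_power_mult[of n "const2 1" p q] by auto

lemma bicoeff_X_u: "bicoeff X_u p q = (if p = 1 \<and> q = 0 then 1 else 0)"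
  using bicoeff_X_u_mult[of "const2 1" p q] by (auto split: nat.splits)

section \<open>The two monomial substitutions\<close>

definition root_act :: "nat \<Rightarrow> complex \<Rightarrow> bipoly \<Rightarrow> bipoly" where
  "root_act d \<xi> = subst (const2 (\<xi> ^ d) * X_u) (const2 \<xi> * X_v)"

text \<open>With \<open>u' = w v'\<^sup>d\<close> this is the inclusion of the plane into the chart of the blow-up with
  coordinates \<open>w, v'\<close>, in which the exceptional divisor is \<open>{v' = 0}\<close>.\<close>

definition to_chart :: "nat \<Rightarrow> bipoly \<Rightarrow> bipoly" where
  "to_chart d = subst (X_u * X_v ^ d) X_v"

lemma bicoeff_root_act: "bicoeff (root_act d \<xi> H) p q = \<xi> ^ (d * p + q) * bicoeff H p q"
proof -
  have inner: "bicoeff (subst_inner (const2 (\<xi> ^ d) * X_u) c) p q =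
      (if q = 0 then \<xi> ^ (d * p) * poly.coeff c p else 0)" for c p q
    by (induction c arbitrary: p)
      (auto simp: mult.assoc bicoeff_X_u_mult power_add coeff_pCons split: nat.splits)
  show ?thesis unfolding root_act_def
    by (induction H arbitrary: q)
      (auto simp: inner mult.assoc bicoeff_X_v_mult split: nat.splits)
qed

lemma bicoeff_to_chart:
  "bicoeff (to_chart d H) p k = (if d * p \<le> k then bicoeff H p (k - d * p) else 0)"
proof -
  have inner: "bicoeff (subst_inner (X_u * X_v ^ d) c) p k = (if k = d * p then poly.coeff c p else 0)"
    for c p k
    by (induction c arbitrary: p k)
      (auto simp: mult.assoc bicoeff_X_u_mult bicoeff_X_v_power_mult coeff_pCons split: nat.splits)
  show ?thesis unfolding to_chart_def
    by (induction H arbitrary: k)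
      (auto simp: inner bicoeff_X_v_mult Suc_diff_le le_Suc_eq split: nat.splits,
        simp_all add: diff_Suc)
qed

lemma root_act_hom:
  "root_act d \<xi> (a + b) = root_act d \<xi> a + root_act d \<xi> b" "root_act d \<xi> (a * b) = root_act d \<xi> a * root_act d \<xi> b"
  "root_act d \<xi> 0 = 0" "root_act d \<xi> 1 = 1" "root_act d \<xi> (const2 c) = const2 c"
  "root_act d \<xi> X_u = const2 (\<xi> ^ d) * X_u" "root_act d \<xi> X_v = const2 \<xi> * X_v"
  "root_act d \<xi> (a ^ n) = root_act d \<xi> a ^ n"
  by (simp_all add: root_act_def subst_add subst_mult subst_power)

lemma to_chart_hom:
  "to_chart d (a + b) = to_chart d a + to_chart d b" "to_chart d (a * b) = to_chart d a * to_chart d b"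
  "to_chart d 0 = 0" "to_chart d 1 = 1" "to_chart d (const2 c) = const2 c"
  "to_chart d X_u = X_u * X_v ^ d" "to_chart d X_v = X_v"
  "to_chart d (a ^ n) = to_chart d a ^ n"
  by (simp_all add: to_chart_def subst_add subst_mult subst_power)

lemma root_act_root_act: "root_act d \<xi> (root_act d \<zeta> H) = root_act d (\<xi> * \<zeta>) H"
  by (rule bicoeff_eqI) (simp add: bicoeff_root_act power_mult_distrib mult.assoc)

lemma root_act_1 [simp]: "root_act d 1 H = H"
  by (rule bicoeff_eqI) (simp add: bicoeff_root_act)

lemma root_act_eq_0_iff: "\<xi> \<noteq> 0 \<Longrightarrow> root_act d \<xi> H = 0 \<longleftrightarrow> H = 0"
  using root_act_root_act[of d "inverse \<xi>" \<xi> H] root_act_hom(3) by (metis root_act_1 left_inverse)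

lemma to_chart_eq_0_iff: "to_chart d H = 0 \<longleftrightarrow> H = 0"
proof
  assume "to_chart d H = 0"
  then have "bicoeff H p q = 0" for p q
    using bicoeff_to_chart[of d H p "d * p + q"] by simp
  then show "H = 0" by (intro bicoeff_eqI) simp
qed (simp add: to_chart_hom)

section \<open>Prime elements and valuations of the function field\<close>

text \<open>Divisibility by \<open>X + a\<close> is vanishing at \<open>- a\<close>, a condition with values in a domain.\<close>

lemma prime_elem_linear: "prime_elem [:a, 1:]" for a :: "'a::idom_divide"
proof -
  have dvd: "[:a, 1:] dvd p \<longleftrightarrow> poly p (- a) = 0" for p
    using poly_eq_0_iff_dvd[of p "- a"] by simp
  show ?thesis
  proof (rule prime_elemI)
    show "\<not> is_unit [:a, 1:]" by (subst dvd) simp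
  qed (auto simp: dvd)
qed

lemma prime_X_v: "prime_elem X_v" unfolding X_v_def by (rule prime_elem_linear)

lemma prime_X_u: "prime_elem X_u"
  unfolding X_u_def by (intro lift_prime_elem_poly prime_elem_linear)

text \<open>The equation of \<open>D\<^sub>2\<close>; the automorphism \<open>u' \<mapsto> u' + v'\<^sup>d\<close> of the plane shows that the curve
  is isomorphic to the graph \<open>v' = - u'\<^sup>l\<close>.\<close>

definition curve_eq :: "nat \<Rightarrow> nat \<Rightarrow> bipoly" where
  "curve_eq d l = X_v + (X_u + X_v ^ d) ^ l"

lemma prime_curve_eq: "prime_elem (curve_eq d l)"
proof -
  define \<phi> where "\<phi> = subst (X_u - X_v ^ d) X_v"
  define \<psi> where "\<psi> = subst (X_u + X_v ^ d) X_v"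
  have diff: "subst U W (a - b) = subst U W a - subst U W b" for U W a b
    using subst_add[of U W "a - b" b] by simp
  have inv: "\<psi> (\<phi> H) = H" "\<phi> (\<psi> H) = H" for H
    by (simp_all add: \<phi>_def \<psi>_def subst_subst diff subst_add subst_power subst_id)
  have mult: "\<phi> (a * b) = \<phi> a * \<phi> b" "\<psi> (a * b) = \<psi> a * \<psi> b" for a b
    by (simp_all add: \<phi>_def \<psi>_def subst_mult)
  have "\<phi> (curve_eq d l) = X_v + X_u ^ l"
    by (simp add: \<phi>_def curve_eq_def subst_add subst_power diff)
  also have "\<dots> = [:[:0, 1:] ^ l, 1:]"
    by (simp add: X_u_def X_v_def poly_const_pow)
  finally have prime: "prime_elem (\<phi> (curve_eq d l))" using prime_elem_linear by simp
  have dvd: "\<phi> a dvd \<phi> b \<longleftrightarrow> a dvd b" for a b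
    unfolding dvd_def using inv mult by metis
  show ?thesis
  proof (rule prime_elemI)
    show "curve_eq d l \<noteq> 0" using prime by (auto simp: \<phi>_def)
    have "\<phi> 1 = 1" by (simp add: \<phi>_def)
    then show "\<not> is_unit (curve_eq d l)" using prime dvd[of "curve_eq d l" 1] by auto
    show "curve_eq d l dvd a \<or> curve_eq d l dvd b" if "curve_eq d l dvd a * b" for a b
      using that prime_elem_dvd_multD[OF prime, of "\<phi> a" "\<phi> b"] dvd mult by metis
  qed
qed

text \<open>A weight that is additive on products of polynomials extends to the fraction field; the reduced
  fraction is merely one choice of representative.\<close>

definition fract_val :: "(bipoly \<Rightarrow> nat) \<Rightarrow> plane_field \<Rightarrow> int" where
  "fract_val w f = int (w (fst (quot_of_fract f))) - int (w (snd (quot_of_fract f)))"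

lemma quot_of_fract_quotient:
  "to_fract (fst (quot_of_fract f)) / to_fract (snd (quot_of_fract f)) = (f :: plane_field)"
  by (metis Fract_quot_of_fract Fract_conv_to_fract)

lemma fract_cases:
  obtains a b where "(f :: plane_field) = to_fract a / to_fract b" "b \<noteq> 0" "coprime a b"
proof (rule that[of "fst (quot_of_fract f)" "snd (quot_of_fract f)"])
  show "f = to_fract (fst (quot_of_fract f)) / to_fract (snd (quot_of_fract f))"
    by (simp add: quot_of_fract_quotient)
  show "coprime (fst (quot_of_fract f)) (snd (quot_of_fract f))" by (rule coprime_quot_of_fract)
qed simp

lemma quotient_eq_iff:
  "\<lbrakk>b \<noteq> 0; c \<noteq> 0\<rbrakk> \<Longrightarrow> to_fract a / to_fract b = to_fract x / to_fract c \<longleftrightarrow> a * c = x * (b::bipoly)"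
  by (simp add: field_simps flip: to_fract_mult)

context
  fixes w :: "bipoly \<Rightarrow> nat"
  assumes w_mult: "\<And>a b. \<lbrakk>a \<noteq> 0; b \<noteq> 0\<rbrakk> \<Longrightarrow> w (a * b) = w a + w b"
begin

lemma fract_val_quotient:
  assumes "a \<noteq> 0" "b \<noteq> 0"
  shows "fract_val w (to_fract a / to_fract b) = int (w a) - int (w b)"
proof -
  let ?f = "to_fract a / to_fract b"
  define x y where "x = fst (quot_of_fract ?f)" and "y = snd (quot_of_fract ?f)"
  have "?f = to_fract x / to_fract y"
    by (simp only: x_def y_def quot_of_fract_quotient)
  moreover have "x \<noteq> 0" "y \<noteq> 0" using assms by (simp_all add: x_def y_def)
  ultimately have "w a + w y = w x + w b"
    using assms w_mult[of a y] w_mult[of x b] by (simp add: quotient_eq_iff)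
  then show ?thesis by (simp add: fract_val_def flip: x_def y_def)
qed

lemma fract_val_to_fract: "a \<noteq> 0 \<Longrightarrow> fract_val w (to_fract a) = int (w a)"
  using fract_val_quotient[of a 1] w_mult[of 1 1] by simp

lemma discrete_valuation_fract_val:
  assumes w_add: "\<And>a b k. \<lbrakk>a \<noteq> 0; b \<noteq> 0; a + b \<noteq> 0; k \<le> w a; k \<le> w b\<rbrakk> \<Longrightarrow> k \<le> w (a + b)"
  shows "discrete_valuation (fract_val w)"
proof
  fix f g :: plane_field assume fg: "f \<noteq> 0" "g \<noteq> 0"
  obtain a b where f: "f = to_fract a / to_fract b" "b \<noteq> 0" by (rule fract_cases)
  obtain x y where g: "g = to_fract x / to_fract y" "y \<noteq> 0" by (rule fract_cases)
  have nz: "a \<noteq> 0" "x \<noteq> 0" using fg f g by auto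
  have "f * g = to_fract (a * x) / to_fract (b * y)" using f g by simp
  then show "fract_val w (f * g) = fract_val w f + fract_val w g"
    using fract_val_quotient[of "a * x" "b * y"] f g nz by (simp add: fract_val_quotient w_mult)
next
  fix f g :: plane_field and k assume fg: "f \<noteq> 0" "g \<noteq> 0" "f + g \<noteq> 0"
    "k \<le> fract_val w f" "k \<le> fract_val w g"
  obtain a b where f: "f = to_fract a / to_fract b" "b \<noteq> 0" by (rule fract_cases)
  obtain x y where g: "g = to_fract x / to_fract y" "y \<noteq> 0" by (rule fract_cases)
  have nz: "a \<noteq> 0" "x \<noteq> 0" using fg f g by auto
  have sum: "f + g = to_fract (a * y + x * b) / to_fract (b * y)" using f g by (simp add: field_simps)
  then have nz': "a * y + x * b \<noteq> 0" using fg(3) by (metis div_0 to_fract_0)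
  have "k \<le> int (w a) - int (w b)" "k \<le> int (w x) - int (w y)"
    using fg f g nz by (simp_all add: fract_val_quotient)
  then have "nat (k + int (w b) + int (w y)) \<le> w (a * y + x * b)"
    using f g nz nz' by (intro w_add) (auto simp: w_mult)
  then show "k \<le> fract_val w (f + g)"
    unfolding sum by (subst fract_val_quotient) (use f g nz nz' in \<open>auto simp: w_mult\<close>)
qed

end

definition curve_val :: "bipoly \<Rightarrow> plane_field \<Rightarrow> int" where
  "curve_val q = fract_val (multiplicity q)"

text \<open>The least \<open>dp + q\<close> over the monomials \<open>u'\<^sup>p v'\<^sup>q\<close>. Computing it as an order along \<open>{v' = 0}\<close> in the
  chart makes it a valuation at once.\<close>

definition exc_weight :: "nat \<Rightarrow> bipoly \<Rightarrow> nat" where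
  "exc_weight d H = multiplicity X_v (to_chart d H)"

definition exc_val :: "nat \<Rightarrow> plane_field \<Rightarrow> int" where
  "exc_val d = fract_val (exc_weight d)"

lemma multiplicity_add:
  fixes q :: bipoly
  assumes "prime_elem q" "a + b \<noteq> 0" "k \<le> multiplicity q a" "k \<le> multiplicity q b"
  shows "k \<le> multiplicity q (a + b)"
proof (rule multiplicity_geI)
  show "q ^ k dvd a + b" using assms(3,4) by (intro dvd_add multiplicity_dvd')
qed (use assms in auto)

lemma exc_weight_mult: "\<lbrakk>a \<noteq> 0; b \<noteq> 0\<rbrakk> \<Longrightarrow> exc_weight d (a * b) = exc_weight d a + exc_weight d b"
  by (simp add: exc_weight_def to_chart_hom prime_elem_multiplicity_mult_distrib prime_X_v
      to_chart_eq_0_iff)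

lemma discrete_valuation_curve: "prime_elem q \<Longrightarrow> discrete_valuation (curve_val q)"
  unfolding curve_val_def
  by (rule discrete_valuation_fract_val) (auto simp: prime_elem_multiplicity_mult_distrib multiplicity_add)

lemma discrete_valuation_exc: "discrete_valuation (exc_val d)"
  unfolding exc_val_def
proof (rule discrete_valuation_fract_val[OF exc_weight_mult])
  fix a b :: bipoly and k
  assume "a + b \<noteq> 0" "k \<le> exc_weight d a" "k \<le> exc_weight d b"
  then show "k \<le> exc_weight d (a + b)"
    unfolding exc_weight_def to_chart_hom
    by (intro multiplicity_add prime_X_v) (auto simp: to_chart_eq_0_iff simp flip: to_chart_hom)
qed

lemma curve_val_to_fract: "\<lbrakk>prime_elem q; a \<noteq> 0\<rbrakk> \<Longrightarrow> curve_val q (to_fract a) = int (multiplicity q a)"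
  unfolding curve_val_def by (rule fract_val_to_fract) (auto simp: prime_elem_multiplicity_mult_distrib)

lemma curve_val_0_iff: "\<lbrakk>prime_elem q; a \<noteq> 0\<rbrakk> \<Longrightarrow> curve_val q (to_fract a) = 0 \<longleftrightarrow> \<not> q dvd a"
  by (simp add: curve_val_to_fract prime_elem_multiplicity_eq_zero_iff)

lemma exc_val_to_fract: "a \<noteq> 0 \<Longrightarrow> exc_val d (to_fract a) = int (exc_weight d a)"
  unfolding exc_val_def by (rule fract_val_to_fract) (auto simp: exc_weight_mult)

lemma exc_weight_ge_iff:
  assumes "H \<noteq> 0"
  shows "k \<le> exc_weight d H \<longleftrightarrow> (\<forall>p q. bicoeff H p q \<noteq> 0 \<longrightarrow> k \<le> d * p + q)"
proof -
  have "k \<le> exc_weight d H \<longleftrightarrow> X_v ^ k dvd to_chart d H"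
    unfolding exc_weight_def using assms prime_X_v
    by (intro power_dvd_iff_le_multiplicity[symmetric]) (auto simp: to_chart_eq_0_iff prime_elem_def)
  also have "\<dots> \<longleftrightarrow> (\<forall>i<k. poly.coeff (to_chart d H) i = 0)"
    by (simp add: X_v_power monom_1_dvd_iff')
  also have "\<dots> \<longleftrightarrow> (\<forall>p i. i < k \<longrightarrow> bicoeff (to_chart d H) p i = 0)"
    by (auto simp: bicoeff_def poly_eq_iff)
  also have "\<dots> \<longleftrightarrow> (\<forall>p q. bicoeff H p q \<noteq> 0 \<longrightarrow> k \<le> d * p + q)"
  proof safe
    fix p q assume "\<forall>p i. i < k \<longrightarrow> bicoeff (to_chart d H) p i = 0" "bicoeff H p q \<noteq> 0"
    then show "k \<le> d * p + q"
      using bicoeff_to_chart[of d H p "d * p + q"] by (metis diff_add_inverse le_add1 not_le)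
  next
    fix p i assume *: "\<forall>p q. bicoeff H p q \<noteq> 0 \<longrightarrow> k \<le> d * p + q" "i < k"
    show "bicoeff (to_chart d H) p i = 0"
      using *(1)[rule_format, of p "i - d * p"] *(2) by (force simp: bicoeff_to_chart)
  qed
  finally show ?thesis .
qed

lemma exc_weight_eqI:
  assumes "bicoeff H p q \<noteq> 0" "k = d * p + q"
    "\<And>p q. bicoeff H p q \<noteq> 0 \<Longrightarrow> k \<le> d * p + q"
  shows "exc_weight d H = k"
proof -
  have "H \<noteq> 0" using assms(1) by auto
  then show ?thesis
    using exc_weight_ge_iff[of H k d] exc_weight_ge_iff[of H "exc_weight d H" d] assms
    by (metis le_antisym order_refl)
qed

lemma exc_weight_X_u: "exc_weight d X_u = d"
  by (rule exc_weight_eqI[of _ 1 0]) (auto simp: bicoeff_X_u split: if_splits)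

lemma exc_weight_X_v: "exc_weight d X_v = 1"
  using bicoeff_X_v_power[of 1] by (intro exc_weight_eqI[of _ 0 1]) (auto split: if_splits)

lemma exc_weight_0_if: "bicoeff H 0 0 \<noteq> 0 \<Longrightarrow> exc_weight d H = 0"
  by (rule exc_weight_eqI[of _ 0 0]) auto

text \<open>In the chart the equation of \<open>D\<^sub>2\<close> is \<open>v' (1 + v'\<^sup>d\<^sup>l\<^sup>-\<^sup>1 (w + 1)\<^sup>l)\<close>.\<close>

lemma exc_weight_curve_eq:
  assumes "2 \<le> d" "1 \<le> l"
  shows "exc_weight d (curve_eq d l) = 1"
proof -
  have "d * l = Suc (d * l - 1)" using assms by simp
  have "to_chart d (curve_eq d l) = X_v + (X_v ^ d * (X_u + 1)) ^ l"
    by (simp add: curve_eq_def to_chart_hom algebra_simps)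
  also have "(X_v ^ d * (X_u + 1)) ^ l = X_v * (X_v ^ (d * l - 1) * (X_u + 1) ^ l)"
    by (subst power_mult_distrib, subst power_mult[symmetric], subst \<open>d * l = _\<close>) (simp add: mult.assoc)
  finally have eq: "to_chart d (curve_eq d l) = X_v * (1 + X_v ^ (d * l - 1) * (X_u + 1) ^ l)"
    by (simp add: algebra_simps)
  have "0 < d * l - 1" using assms by (metis One_nat_def Suc_1 Suc_le_eq dual_order.strict_trans1 mult_le_mono nat_mult_1_right zero_less_diff lessI)
  then have "\<not> X_v dvd 1 + X_v ^ (d * l - 1) * (X_u + 1) ^ l"
    using prime_X_v by (metis dvd_add_left_iff dvd_mult2 dvd_power prime_elem_not_unit)
  then show ?thesis
    unfolding exc_weight_def eq using prime_X_v
    by (subst multiplicity_times_same) (auto simp: not_dvd_imp_multiplicity_0)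
qed

section \<open>Points of the blown-up plane\<close>

definition monomials :: "bipoly \<Rightarrow> (nat \<times> nat) set" where
  "monomials H = {(p, q). bicoeff H p q \<noteq> 0}"

lemma finite_monomials: "finite (monomials H)"
proof (rule finite_subset)
  show "monomials H \<subseteq> (\<Union>q\<in>{..degree H}. (\<lambda>p. (p, q)) ` {..degree (poly.coeff H q)})"
    by (force simp: monomials_def bicoeff_def intro: le_degree)
qed auto

lemma bicoeff_sum: "bicoeff (sum f A) p q = (\<Sum>x\<in>A. bicoeff (f x) p q)"
  by (induction A rule: infinite_finite_induct) auto

lemma bicoeff_monomial:
  "bicoeff (const2 c * X_u ^ i * X_v ^ j) p q = (if p = i \<and> q = j then c else 0)"
proof -
  have u: "bicoeff (X_u ^ i * H) p q = (if i \<le> p then bicoeff H (p - i) q else 0)" for H p q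
    by (induction i arbitrary: p) (auto simp: mult.assoc bicoeff_X_u_mult split: nat.splits)
  show ?thesis unfolding mult.assoc bicoeff_simps u by (auto simp: bicoeff_X_v_power)
qed

lemma sum_monomials: "H = (\<Sum>(p, q)\<in>monomials H. const2 (bicoeff H p q) * X_u ^ p * X_v ^ q)"
proof (rule bicoeff_eqI)
  fix i j
  have "(\<Sum>x\<in>monomials H. bicoeff (case x of (p, q) \<Rightarrow> const2 (bicoeff H p q) * X_u ^ p * X_v ^ q) i j)
      = (\<Sum>x\<in>monomials H. if (i, j) = x then bicoeff H i j else 0)"
    by (intro sum.cong) (auto simp: bicoeff_monomial split: if_splits)
  also have "\<dots> = bicoeff H i j"
    by (subst sum.delta'[OF finite_monomials]) (auto simp: monomials_def)
  finally show "bicoeff H i j = bicoeff (\<Sum>(p, q)\<in>monomials H. const2 (bicoeff H p q) * X_u ^ p * X_v ^ q) i j"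
    by (simp add: bicoeff_sum)
qed

lemma to_fract_sum: "to_fract (sum f A) = (\<Sum>x\<in>A. to_fract (f x :: bipoly))"
  by (induction A rule: infinite_finite_induct) auto

lemma to_fract_power: "to_fract (a ^ n) = to_fract a ^ n"
  by (induction n) auto

lemma to_fract_monomials:
  "to_fract H = (\<Sum>(p, q)\<in>monomials H. plane_const (bicoeff H p q) * plane_u ^ p * plane_v ^ q)"
  by (subst sum_monomials)
    (simp add: to_fract_sum case_prod_unfold plane_generators to_fract_power)

lemma subring_plane: "subring_set plane"
proof
  show "1 \<in> plane" unfolding plane_eq using to_fract_1 by (metis rangeI)
qed (auto simp: plane_eq simp flip: to_fract_uminus to_fract_add to_fract_mult)

lemma to_fract_in_plane [simp]: "to_fract H \<in> plane" and plane_const_in_plane: "plane_const c \<in> plane"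
  and plane_u_in_plane: "plane_u \<in> plane" and plane_v_in_plane: "plane_v \<in> plane"
  by (simp_all add: plane_eq plane_generators)

lemma plane_uv_nonzero [simp]: "plane_u \<noteq> 0" "plane_v \<noteq> 0"
  by (simp_all add: plane_generators X_u_def X_v_def)

lemma curve_val_plane: "\<lbrakk>prime_elem q; f \<in> plane; f \<noteq> 0\<rbrakk> \<Longrightarrow> 0 \<le> curve_val q f"
  by (auto simp: plane_eq curve_val_to_fract)

lemma exc_val_plane: "\<lbrakk>f \<in> plane; f \<noteq> 0\<rbrakk> \<Longrightarrow> 0 \<le> exc_val d f"
  by (auto simp: plane_eq exc_val_to_fract)

lemma exc_val_uv: "exc_val d plane_u = int d" "exc_val d plane_v = 1"
  by (simp_all add: plane_generators exc_val_to_fract exc_weight_X_u exc_weight_X_v prime_X_u prime_X_v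
      prime_elem_not_zeroI)

lemma not_X_v_dvd_X_u: "\<not> X_v dvd X_u" and not_X_u_dvd_X_v: "\<not> X_u dvd X_v"
proof -
  have "bicoeff (X_v * H) 1 0 = 0" "bicoeff (X_u * H) 0 1 = 0" for H
    by (auto simp: bicoeff_X_v_mult bicoeff_X_u_mult)
  moreover have "bicoeff X_u 1 0 = 1" "bicoeff X_v 0 1 = 1"
    using bicoeff_X_u[of 1 0] bicoeff_X_v_power[of 1 0 1] by auto
  ultimately show "\<not> X_v dvd X_u" "\<not> X_u dvd X_v" unfolding dvd_def by (metis zero_neq_one)+
qed

lemma prime_elem_dvd_prime_elem:
  "\<lbrakk>prime_elem p; prime_elem (q :: bipoly); p dvd q\<rbrakk> \<Longrightarrow> q dvd p"
  using irreducibleD'[OF prime_elem_imp_irreducible, of q p] by auto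

lemma plane_ideal_iff: "to_fract H \<in> PIdl\<^bsub>ring_of plane\<^esub> (to_fract q) \<longleftrightarrow> q dvd H"
proof -
  have "to_fract H \<in> PIdl\<^bsub>ring_of plane\<^esub> (to_fract q) \<longleftrightarrow> (\<exists>K. to_fract H = to_fract K * to_fract q)"
    by (auto simp: cgenideal_def plane_eq)
  also have "\<dots> \<longleftrightarrow> q dvd H"
    by (auto simp: dvd_def mult.commute simp flip: to_fract_mult)
  finally show ?thesis .
qed

lemma plane_curve_iff:
  "f \<in> plane_curve (to_fract q) \<longleftrightarrow> (\<exists>a s. f = to_fract a / to_fract s \<and> \<not> q dvd s)"
proof -
  define I where "I = PIdl\<^bsub>ring_of plane\<^esub> (to_fract q)"
  have "to_fract H \<in> I \<longleftrightarrow> q dvd H" for H by (simp add: I_def plane_ideal_iff)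
  then have "(s \<in> plane \<and> s \<notin> I) \<longleftrightarrow> (\<exists>H. s = to_fract H \<and> \<not> q dvd H)" for s
    by (auto simp: plane_eq)
  then show ?thesis
    unfolding plane_curve_def localization_def I_def[symmetric] by (auto simp: plane_eq)
qed

text \<open>Unique factorisation: in a reduced fraction of nonnegative order \<open>q\<close> cannot divide the
  denominator.\<close>

lemma curve_ring_eq_localization:
  assumes q: "prime_elem q"
  shows "plane_curve (to_fract q) = valuation_ring (curve_val q)"
proof -
  interpret discrete_valuation "curve_val q" by (rule discrete_valuation_curve[OF q])
  show ?thesis
  proof
    show "plane_curve (to_fract q) \<subseteq> val_ring"
    proof
      fix f assume "f \<in> plane_curve (to_fract q)"
      then obtain a s where f: "f = to_fract a / to_fract s" "\<not> q dvd s"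
        unfolding plane_curve_iff by auto
      then have "s \<noteq> 0" by auto
      then show "f \<in> val_ring"
        using f q by (cases "a = 0") (auto simp: valuation_ring_def val_divide curve_val_to_fract
            not_dvd_imp_multiplicity_0)
    qed
    show "val_ring \<subseteq> plane_curve (to_fract q)"
    proof
      fix f assume f: "f \<in> val_ring"
      obtain a s where as: "f = to_fract a / to_fract s" "s \<noteq> 0" "coprime a s" by (rule fract_cases)
      have "\<not> q dvd s"
      proof
        assume qs: "q dvd s"
        then have qa: "\<not> q dvd a" using as(3) q by (meson coprime_common_divisor prime_elem_not_unit)
        then have "a \<noteq> 0" by auto
        then have "curve_val q f < 0"
          using as qs qa q prime_multiplicity_gt_zero_iff[of q s]
          by (simp add: val_divide curve_val_to_fract not_dvd_imp_multiplicity_0)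
        then show False using f as \<open>a \<noteq> 0\<close> by (auto simp: valuation_ring_def)
      qed
      then show "f \<in> plane_curve (to_fract q)"
        unfolding plane_curve_iff using as(1) by auto
    qed
  qed
qed

text \<open>Away from the divisor \<open>{f = 0}\<close> a chart of the blow-up coincides with the original scheme.\<close>

lemma blow_up_chart_denominators:
  assumes "subring_set A" "F \<subseteq> A" "f \<in> A" "f \<noteq> 0" "g \<in> blow_up_chart A F (f :: 'k::field)"
  shows "\<exists>N. g * f ^ N \<in> A"
proof -
  interpret subring_set A by fact
  let ?B = "{g. \<exists>N. g * f ^ N \<in> A}"
  have "subring_set ?B"
  proof
    show "1 \<in> ?B" using A_1 by (auto intro: exI[of _ 0])
    show "- g \<in> ?B" if "g \<in> ?B" for g using that A_neg by fastforce
    fix g h assume "g \<in> ?B" "h \<in> ?B"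
    then obtain M N where MN: "g * f ^ M \<in> A" "h * f ^ N \<in> A" by auto
    have "(g + h) * f ^ (M + N) = g * f ^ M * f ^ N + h * f ^ N * f ^ M"
      "(g * h) * f ^ (M + N) = (g * f ^ M) * (h * f ^ N)"
      by (simp_all add: power_add algebra_simps)
    then show "g + h \<in> ?B" "g * h \<in> ?B"
      using MN A_add A_mult A_power assms(3) by (metis (mono_tags, lifting) mem_Collect_eq)+
  qed
  moreover have "A \<subseteq> ?B" by (auto intro: exI[of _ 0])
  moreover have "g / f \<in> ?B" if "g \<in> F" for g
    using that assms(2,4) by (auto intro!: exI[of _ 1])
  ultimately show ?thesis using blow_up_chart_minimal[of ?B A F f] assms(5) by blast
qed

locale plane_blow_up =
  fixes d :: nat
  assumes d_pos: "0 < d"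
begin

sublocale exc: discrete_valuation "exc_val d" by (rule discrete_valuation_exc)

abbreviation "exc_ring \<equiv> valuation_ring (exc_val d)"

definition "centre = {plane_u, plane_v ^ d}"

abbreviation "chart \<equiv> blow_up_chart plane centre"

lemma blown_up_plane_iff:
  "R \<in> blown_up_plane d \<longleftrightarrow>
    (\<exists>f\<in>centre. \<exists>P. prime_of_subring (chart f) P \<and> R = localization (chart f) P)"
proof -
  have "centre - {0} = centre" by (auto simp: centre_def)
  then show ?thesis unfolding blown_up_plane_def blow_up_iff centre_def[symmetric] by simp
qed

lemma centre_plane: "centre \<subseteq> plane" "f \<in> centre \<Longrightarrow> f \<noteq> 0" "f \<in> centre \<Longrightarrow> exc_val d f = int d"
  using subring_set.A_power[OF subring_plane plane_v_in_plane, of d]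
  by (auto simp: centre_def plane_u_in_plane exc_val_uv exc.val_power)

lemma chart_superset: "plane \<subseteq> chart f"
  and chart_quotient: "plane_u / f \<in> chart f" "plane_v ^ d / f \<in> chart f"
  by (auto intro: generators_in_blow_up_chart(1)[THEN subsetD] generators_in_blow_up_chart(2)
      simp: centre_def)

lemma chart_exc_ring: "f \<in> centre \<Longrightarrow> chart f \<subseteq> exc_ring"
proof (rule blow_up_chart_minimal[OF exc.subring_val_ring])
  show "plane \<subseteq> exc_ring" using exc_val_plane by (force simp: valuation_ring_def)
  show "g / f \<in> exc_ring" if "f \<in> centre" "g \<in> centre" for g
    using that centre_plane by (auto simp: valuation_ring_def exc.val_divide)
qed

lemma blown_up_plane_closed:
  assumes "R \<in> blown_up_plane d"
  shows "plane \<subseteq> R" "\<lbrakk>f \<in> R; g \<in> R\<rbrakk> \<Longrightarrow> f * g \<in> R"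
proof -
  obtain f0 P where "prime_of_subring (chart f0) P" and R: "R = localization (chart f0) P"
    using assms blown_up_plane_iff by blast
  then interpret prime_of_subring "chart f0" P by simp
  show "plane \<subseteq> R" using localization_superset chart_superset R by blast
  show "f * g \<in> R" if "f \<in> R" "g \<in> R" using that localization_mult R by blast
qed

text \<open>In the chart with \<open>u'/v'\<^sup>d\<close> a monomial \<open>u'\<^sup>p v'\<^sup>q\<close> is divisible exactly by the power
  \<open>dp + q\<close> of the equation \<open>v'\<close> of the exceptional divisor.\<close>

lemma divide_power_in_chart:
  assumes "\<And>p q. bicoeff H p q \<noteq> 0 \<Longrightarrow> k \<le> d * p + q"
  shows "to_fract H / plane_v ^ k \<in> chart (plane_v ^ d)"
proof -
  interpret subring_set "chart (plane_v ^ d)" by (rule subring_blow_up_chart)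
  have "to_fract H / plane_v ^ k =
      (\<Sum>(p, q)\<in>monomials H. plane_const (bicoeff H p q) * (plane_u / plane_v ^ d) ^ p * plane_v ^ (d * p + q - k))"
    unfolding to_fract_monomials sum_divide_distrib
  proof (intro sum.cong refl, clarify)
    fix p q assume "(p, q) \<in> monomials H"
    then have "k \<le> d * p + q" using assms by (auto simp: monomials_def)
    then show "plane_const (bicoeff H p q) * plane_u ^ p * plane_v ^ q / plane_v ^ k =
        plane_const (bicoeff H p q) * (plane_u / plane_v ^ d) ^ p * plane_v ^ (d * p + q - k)"
      by (simp add: power_diff power_divide power_add power_mult)
  qed
  moreover have "sum f A \<in> chart (plane_v ^ d)" if "\<And>x. x \<in> A \<Longrightarrow> f x \<in> chart (plane_v ^ d)" for f and A :: "(nat \<times> nat) set"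
    using that by (induction A rule: infinite_finite_induct) (auto simp: A_0 A_add)
  moreover have "plane_const c \<in> chart (plane_v ^ d)" "plane_v \<in> chart (plane_v ^ d)" for c
    using chart_superset plane_const_in_plane plane_v_in_plane by blast+
  ultimately show ?thesis
    using chart_quotient(1) A_mult A_power by (simp add: case_prod_unfold)
qed

text \<open>Dividing numerator and denominator of a fraction by the power \<open>v'\<^sup>k\<close>, where \<open>k\<close> is the weight of
  the denominator, puts both into the chart and makes the denominator a unit along \<open>E\<close>.\<close>

lemma exc_ring_in_blown_up_plane: "exc_ring \<in> blown_up_plane d"
proof -
  let ?B = "chart (plane_v ^ d)"
  have c: "plane_v ^ d \<in> centre" by (simp add: centre_def)
  have "\<exists>a\<in>?B. \<exists>s\<in>?B. s \<noteq> 0 \<and> exc_val d s = 0 \<and> f = a / s" if f: "f \<in> exc_ring" for f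
  proof -
    obtain a s where as: "f = to_fract a / to_fract s" "s \<noteq> 0" by (rule fract_cases)
    define k where "k = exc_weight d s"
    have k_a: "k \<le> d * p + q" if "bicoeff a p q \<noteq> 0" for p q
    proof -
      have "a \<noteq> 0" using that by auto
      then have "k \<le> exc_weight d a"
        using f as by (auto simp: valuation_ring_def exc.val_divide exc_val_to_fract k_def)
      then show ?thesis using exc_weight_ge_iff[OF \<open>a \<noteq> 0\<close>] that by blast
    qed
    have k_s: "k \<le> d * p + q" if "bicoeff s p q \<noteq> 0" for p q
      using exc_weight_ge_iff[OF as(2), of k d] that by (auto simp: k_def)
    have "f = (to_fract a / plane_v ^ k) / (to_fract s / plane_v ^ k)" using as by simp
    moreover have "exc_val d (to_fract s / plane_v ^ k) = 0"
      using as by (simp add: exc.val_divide exc.val_power exc_val_to_fract exc_val_uv k_def)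
    ultimately show ?thesis
      using divide_power_in_chart[of a k, OF k_a] divide_power_in_chart[of s k, OF k_s] as
      by (intro bexI[of _ "to_fract a / plane_v ^ k"] bexI[of _ "to_fract s / plane_v ^ k"]) auto
  qed
  from exc.val_ring_eq_localization[OF subring_blow_up_chart chart_exc_ring[OF c] this]
  show ?thesis using c blown_up_plane_iff by blast
qed

lemma curve_val_centre:
  assumes q: "prime_elem q" and f: "f \<in> centre" "curve_val q f = 0"
  shows "chart f \<subseteq> valuation_ring (curve_val q)"
proof -
  interpret discrete_valuation "curve_val q" by (rule discrete_valuation_curve[OF q])
  show ?thesis
  proof (rule blow_up_chart_minimal[OF subring_val_ring])
    show "plane \<subseteq> val_ring" using curve_val_plane[OF q] by (auto simp: valuation_ring_def)
    show "g / f \<in> val_ring" if "g \<in> centre" for g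
      using that f centre_plane curve_val_plane[OF q, of g] by (auto simp: valuation_ring_def val_divide)
  qed
qed

text \<open>A prime \<open>q\<close> cannot divide both \<open>u'\<close> and \<open>v'\<close>, so the generic point of its curve lies in one of the
  two charts.\<close>

lemma curve_ring_in_blown_up_plane:
  assumes q: "prime_elem q"
  shows "valuation_ring (curve_val q) \<in> blown_up_plane d"
proof -
  interpret discrete_valuation "curve_val q" by (rule discrete_valuation_curve[OF q])
  have "\<not> q dvd X_u \<or> \<not> q dvd X_v"
    using prime_elem_dvd_prime_elem[OF q prime_X_v] not_X_v_dvd_X_u by (metis dvd_trans)
  then have "curve_val q plane_u = 0 \<or> curve_val q plane_v = 0"
    using curve_val_0_iff[OF q] prime_X_u prime_X_v by (auto simp: plane_generators)
  then have "curve_val q plane_u = 0 \<or> curve_val q (plane_v ^ d) = 0" by (auto simp: val_power)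
  then obtain f where f: "f \<in> centre" "curve_val q f = 0" by (auto simp: centre_def)
  have "\<exists>a\<in>chart f. \<exists>s\<in>chart f. s \<noteq> 0 \<and> curve_val q s = 0 \<and> g = a / s" if "g \<in> val_ring" for g
  proof -
    have "g \<in> plane_curve (to_fract q)" using that curve_ring_eq_localization[OF q] by simp
    then obtain a s where as: "g = to_fract a / to_fract s" "\<not> q dvd s"
      unfolding plane_curve_iff by auto
    then have "s \<noteq> 0" by auto
    then have "curve_val q (to_fract s) = 0" using curve_val_0_iff[OF q] as(2) by blast
    then show ?thesis using as \<open>s \<noteq> 0\<close> chart_superset by (metis subsetD to_fract_eq_0_iff to_fract_in_plane)
  qed
  from val_ring_eq_localization[OF subring_blow_up_chart curve_val_centre[OF q f] this]
  show ?thesis using f blown_up_plane_iff by blast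
qed

text \<open>A point of the blow-up that lies over the origin is a specialisation of the generic point
  of the exceptional divisor, since a function vanishing along that divisor lies in the ideal
  \<open>(u', v')\<close> of its chart.\<close>

lemma subset_exc_ring:
  assumes "R \<in> blown_up_plane d" and uv: "plane_u \<in> max_ideal R" "plane_v \<in> max_ideal R"
  shows "R \<subseteq> exc_ring"
proof -
  obtain f P where f: "f \<in> centre" and "prime_of_subring (chart f) P" and R: "R = localization (chart f) P"
    using assms(1) blown_up_plane_iff by blast
  then interpret prime_of_subring "chart f" P by simp
  have P_uv: "plane_u \<in> P" "plane_v \<in> P"
    using uv max_ideal_localization chart_superset plane_u_in_plane plane_v_in_plane R by auto
  have P_sum: "sum g A \<in> P" if "\<And>x. x \<in> A \<Longrightarrow> g x \<in> P" for g and A :: "(nat \<times> nat) set"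
    using that by (induction A rule: infinite_finite_induct) (auto simp: P_0 P_add)
  \<comment> \<open>Every monomial of positive weight is a multiple of \<open>u'\<close> or \<open>v'\<close> in the chart.\<close>
  have in_P: "s \<in> P" if s: "s \<in> chart f" "s = 0 \<or> 0 < exc_val d s" for s
  proof -
    obtain N where "s * f ^ N \<in> plane"
      using blow_up_chart_denominators[OF subring_plane centre_plane(1) _ _ s(1)] f centre_plane by blast
    then obtain H where H: "s * f ^ N = to_fract H" by (auto simp: plane_eq)
    have wt: "d * N < d * p + q" if "bicoeff H p q \<noteq> 0" for p q
    proof -
      have "H \<noteq> 0" using that by auto
      then have "s \<noteq> 0" using H by auto
      then have "exc_val d (to_fract H) = exc_val d s + int (d * N)"
        using f centre_plane by (simp add: H[symmetric] exc.val_mult exc.val_power)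
      then have "int (exc_weight d H) = exc_val d s + int (d * N)"
        using \<open>H \<noteq> 0\<close> exc_val_to_fract by metis
      then have "Suc (d * N) \<le> exc_weight d H"
        using s(2) \<open>s \<noteq> 0\<close> by linarith
      then show ?thesis using exc_weight_ge_iff[OF \<open>H \<noteq> 0\<close>] that by (metis Suc_le_eq)
    qed
    have "s = to_fract H / f ^ N" using H centre_plane(2)[OF f] by (simp add: field_simps)
    also have "\<dots> = (\<Sum>(p, q)\<in>monomials H. plane_const (bicoeff H p q) * (plane_u ^ p * plane_v ^ q / f ^ N))"
      by (simp add: to_fract_monomials sum_divide_distrib case_prod_unfold mult.assoc)
    also have "\<dots> \<in> P"
    proof (intro P_sum, clarify)
      fix p q assume "(p, q) \<in> monomials H"
      then have w: "d * N < d * p + q" using wt by (auto simp: monomials_def)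
      have A_uv: "plane_u \<in> chart f" "plane_v \<in> chart f" using P_uv P_sub by auto
      have "plane_u ^ p * plane_v ^ q / f ^ N \<in> P"
      proof (cases "f = plane_u")
        case False
        then have fv: "f = plane_v ^ d" using f by (auto simp: centre_def)
        obtain e where e: "d * p + q = Suc (d * N) + e" using w by (metis Suc_leI le_iff_add)
        have "plane_v ^ q * plane_v ^ (d * p) = plane_v ^ e * plane_v * plane_v ^ (d * N)"
          using arg_cong[OF e, of "\<lambda>n. plane_v ^ n"] by (simp add: power_add mult_ac)
        then have "plane_u ^ p * plane_v ^ q / f ^ N = (plane_u / f) ^ p * plane_v ^ e * plane_v"
          by (simp add: fv power_divide divide_eq_eq eq_divide_eq mult_ac flip: power_mult)
        then show ?thesis using P_mult[OF _ P_uv(2)] A_mult A_power A_uv chart_quotient(1) by simp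
      next
        case fu: True
        show ?thesis
        proof (cases "N < p")
          case True
          then have "plane_u ^ p * plane_v ^ q / f ^ N = plane_u ^ (p - Suc N) * plane_v ^ q * plane_u"
            by (simp add: fu field_simps flip: power_add power_Suc)
          then show ?thesis using P_mult[OF _ P_uv(1)] A_mult A_power A_uv by simp
        next
          case False
          then have wq: "d * (N - p) < q" using w False mult_le_mono2[of p N d]
            unfolding diff_mult_distrib2 by linarith
          have "plane_u ^ p * plane_v ^ q / f ^ N = (plane_v ^ d / f) ^ (N - p) * plane_v ^ (q - Suc (d * (N - p))) * plane_v"
            using False wq by (simp add: fu field_simps flip: power_mult power_add power_Suc)
          then show ?thesis using P_mult[OF _ P_uv(2)] A_mult A_power A_uv chart_quotient(2) by simp
        qed
      qed
      then show "plane_const (bicoeff H p q) * (plane_u ^ p * plane_v ^ q / f ^ N) \<in> P"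
        using P_mult chart_superset plane_const_in_plane by blast
    qed
    finally show ?thesis .
  qed
  show ?thesis unfolding R
  proof (rule localization_subset[OF chart_exc_ring[OF f]])
    show "inverse s \<in> exc_ring" if "s \<in> chart f - P" for s
    proof -
      have "\<not> (s = 0 \<or> 0 < exc_val d s)" using that in_P[of s] by auto
      then show ?thesis by (auto simp: valuation_ring_def exc.val_inverse)
    qed
  qed (rule exc.val_ring_closed)
qed

text \<open>Away from the exceptional divisor the blow-up is the plane, so a point on the curve
  \<open>{q = 0}\<close> is a specialisation of its generic point.\<close>

lemma subset_curve_ring:
  assumes "R \<in> blown_up_plane d" and q: "prime_elem q" "to_fract q \<in> max_ideal R"
    and not_exc: "plane_u \<notin> max_ideal R \<or> plane_v \<notin> max_ideal R"
  shows "R \<subseteq> valuation_ring (curve_val q)"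
proof -
  interpret V: discrete_valuation "curve_val q" by (rule discrete_valuation_curve[OF q(1)])
  obtain f P where f: "f \<in> centre" and "prime_of_subring (chart f) P" and R: "R = localization (chart f) P"
    using assms(1) blown_up_plane_iff by blast
  then interpret prime_of_subring "chart f" P by simp
  have max: "g \<in> max_ideal R \<longleftrightarrow> g \<in> P" if "g \<in> plane" for g
    using that max_ideal_localization chart_superset R by auto
  have P_power: "g \<in> P" if "g ^ n \<in> P" "g \<in> chart f" for g n
    using that P_1 P_prime[OF _ A_power, of g g] by (induction n) auto
  have qP: "to_fract q * to_fract h \<in> P" for h
    using P_mult[OF subsetD[OF chart_superset to_fract_in_plane], of "to_fract q" h] max q
    by (auto simp: mult.commute)
  have fP: "f \<notin> P"
  proof
    assume fP: "f \<in> P"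
    have "plane_u / f * f \<in> P" "plane_v ^ d / f * f \<in> P"
      by (intro P_mult chart_quotient fP)+
    then have "plane_u \<in> P" "plane_v ^ d \<in> P" using centre_plane(2)[OF f] by simp_all
    then show False
      using not_exc max P_power chart_superset plane_u_in_plane plane_v_in_plane by blast
  qed
  have f_plane: "f \<in> plane" using f centre_plane by blast
  then obtain fH where fH: "f = to_fract fH" by (auto simp: plane_eq)
  have "\<not> q dvd fH" using qP fP fH by (auto simp: dvd_def)
  then have f0: "curve_val q f = 0" using curve_val_0_iff[OF q(1), of fH] fH by auto
  show ?thesis unfolding R
  proof (rule localization_subset[OF curve_val_centre[OF q(1) f f0]])
    fix s assume s: "s \<in> chart f - P"
    obtain N where "s * f ^ N \<in> plane"
      using blow_up_chart_denominators[OF subring_plane centre_plane(1) f_plane centre_plane(2)[OF f]] s by blast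
    then obtain H where H: "s * f ^ N = to_fract H" by (auto simp: plane_eq)
    have "f ^ N \<notin> P" "f ^ N \<in> chart f" using P_power fP A_power f_plane chart_superset by blast+
    then have "\<not> q dvd H" using s P_prime[of s "f ^ N"] H qP by (auto simp: dvd_def)
    moreover have "s \<noteq> 0" using s P_0 by auto
    moreover have "H \<noteq> 0" using calculation by auto
    ultimately have "curve_val q (s * f ^ N) = 0" using curve_val_0_iff[OF q(1)] H by simp
    then have "curve_val q s = 0"
      using \<open>s \<noteq> 0\<close> f0 centre_plane(2)[OF f] by (simp add: V.val_mult V.val_power)
    then show "inverse s \<in> V.val_ring" using \<open>s \<noteq> 0\<close> by (auto simp: valuation_ring_def V.val_inverse)
  qed (rule V.val_ring_closed)
qed

end

section \<open>Quotients of the blown-up plane\<close>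

lemma max_ideal_Int:
  "(\<And>f. f \<in> L \<Longrightarrow> inverse f \<in> L) \<Longrightarrow> max_ideal (R \<inter> L) = max_ideal R \<inter> (L :: 'k::field set)"
  by (auto simp: max_ideal_iff)

lemma max_ideal_power:
  assumes R: "\<And>f g. \<lbrakk>f \<in> R; g \<in> R\<rbrakk> \<Longrightarrow> f * g \<in> R" and f: "f \<in> R" "f ^ n \<in> max_ideal R" "0 < n"
  shows "f \<in> max_ideal (R :: 'k::field set)"
proof (rule ccontr)
  assume "f \<notin> max_ideal R"
  then have "f \<noteq> 0" "inverse f \<in> R" using f by (auto simp: max_ideal_iff)
  moreover have "inverse f ^ Suc k \<in> R" for k
    using calculation by (induction k) (auto intro: R)
  ultimately have "inverse f ^ n \<in> R" using f(3) by (metis gr0_implies_Suc)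
  then show False using f \<open>f \<noteq> 0\<close> by (auto simp: max_ideal_iff power_inverse)
qed

lemma max_ideal_mult:
  assumes R: "\<And>f g. \<lbrakk>f \<in> R; g \<in> R\<rbrakk> \<Longrightarrow> f * g \<in> R" and f: "f \<in> max_ideal R" and g: "g \<in> R"
  shows "f * g \<in> max_ideal (R :: 'k::field set)"
proof -
  have "inverse f \<in> R" if "f * g \<noteq> 0" "inverse (f * g) \<in> R"
  proof -
    have "g * inverse (f * g) = inverse f" using that(1) by (simp add: field_simps)
    then show ?thesis using R[OF g that(2)] by (simp only:)
  qed
  then show ?thesis using R f g by (auto simp: max_ideal_iff)
qed

text \<open>Let \<open>L\<close> be the field of invariants of a finite group. Its elements are quotients of
  invariant polynomials because every polynomial divides an invariant one, namely its norm. The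
  trivial group gives the whole function field, so that results on the quotient specialise to the
  blow-up itself.\<close>

locale invariant_subfield = plane_blow_up d for d +
  fixes L :: "plane_field set"
  assumes L_1: "1 \<in> L" and L_mult: "\<lbrakk>f \<in> L; g \<in> L\<rbrakk> \<Longrightarrow> f * g \<in> L"
    and L_inverse: "f \<in> L \<Longrightarrow> inverse f \<in> L"
    and L_norm: "H \<noteq> 0 \<Longrightarrow> \<exists>N. N \<noteq> 0 \<and> H dvd N \<and> to_fract N \<in> L"
begin

lemma L_divide: "\<lbrakk>f \<in> L; g \<in> L\<rbrakk> \<Longrightarrow> f / g \<in> L"
  by (simp add: divide_inverse L_mult L_inverse)

lemma invariant_fraction:
  assumes "f \<in> L"
  obtains a b where "f = to_fract a / to_fract b" "b \<noteq> 0" "to_fract a \<in> L" "to_fract b \<in> L"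
proof -
  obtain a b where f: "f = to_fract a / to_fract b" "b \<noteq> 0" by (rule fract_cases)
  obtain N c where N: "N \<noteq> 0" "N = b * c" "to_fract N \<in> L" using L_norm[OF f(2)] by (auto simp: dvd_def)
  have "f * to_fract N = to_fract (a * c)" using f N by simp
  then have "to_fract (a * c) \<in> L" "f = to_fract (a * c) / to_fract N"
    using L_mult[OF assms N(3)] N(1) by (auto simp: field_simps)
  then show ?thesis using that N by blast
qed

lemma fraction_field_point:
  assumes "R \<in> blown_up_plane d" "f \<in> L"
  shows "f \<in> fraction_field_of (R \<inter> L)"
proof -
  obtain a b where f: "f = to_fract a / to_fract b" "b \<noteq> 0" "to_fract a \<in> L" "to_fract b \<in> L"
    using invariant_fraction[OF assms(2)] .
  have "to_fract c \<in> R" for c using blown_up_plane_closed(1)[OF assms(1)] by auto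
  then have "to_fract a \<in> R \<inter> L" "to_fract b \<in> R \<inter> L - {0}" using f by auto
  then show ?thesis using f(1) unfolding fraction_field_of_def by blast
qed

lemma function_field_quotient: "function_field ((\<lambda>R. R \<inter> L) ` blown_up_plane d) = L"
proof
  show "L \<subseteq> function_field ((\<lambda>R. R \<inter> L) ` blown_up_plane d)"
    unfolding function_field_def using fraction_field_point exc_ring_in_blown_up_plane by blast
  show "function_field ((\<lambda>R. R \<inter> L) ` blown_up_plane d) \<subseteq> L"
    unfolding function_field_def fraction_field_of_def using L_divide by blast
qed

lemma exc_norm: "\<exists>g\<in>L. g \<noteq> 0 \<and> 0 < exc_val d g"
proof -
  obtain N where N: "N \<noteq> 0" "X_v dvd N" "to_fract N \<in> L"
    using L_norm[of X_v] prime_X_v by auto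
  then obtain c where c: "N = X_v * c" by auto
  then have "exc_weight d N = exc_weight d X_v + exc_weight d c"
    using N(1) by (auto simp: exc_weight_mult)
  then show ?thesis
    using N by (intro bexI[of _ "to_fract N"]) (auto simp: exc_val_to_fract exc_weight_X_v)
qed

lemma curve_norm: "prime_elem q \<Longrightarrow> \<exists>g\<in>L. g \<noteq> 0 \<and> 0 < curve_val q g"
  using L_norm[of q] curve_val_0_iff[of q] curve_val_to_fract[of q]
  by (metis less_le of_nat_0_le_iff prime_elem_def to_fract_eq_0_iff)

lemma exc_restricted: "\<exists>e. restricted_valuation (exc_val d) L e"
  using exc_norm by (auto intro!: exc.restricted_valuation_exists L_1 L_mult L_inverse)

lemma curve_restricted: "prime_elem q \<Longrightarrow> \<exists>e. restricted_valuation (curve_val q) L e"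
  using curve_norm[of q]
  by (auto intro!: discrete_valuation.restricted_valuation_exists discrete_valuation_curve
      L_1 L_mult L_inverse)

text \<open>The common argument of the next two lemmas. An invariant of positive order shows that the
  restricted valuation ring is not all of \<open>L\<close>, so \<open>dvr_maximal\<close> applies.\<close>

lemma prime_divisor_eq:
  assumes R: "R \<in> blown_up_plane d" "uniformizer (R \<inter> L) p" and \<nu>: "discrete_valuation \<nu>"
    and sub: "R \<subseteq> valuation_ring \<nu>" and g: "g \<in> L" "g \<noteq> 0" "0 < \<nu> g"
  shows "R \<inter> L = valuation_ring \<nu> \<inter> L"
proof -
  interpret V: discrete_valuation \<nu> by fact
  have "f \<in> R \<inter> L" if f: "f \<in> V.val_ring \<inter> L" for f
  proof (rule dvr_maximal[OF R(2), of "V.val_ring \<inter> L" f "inverse g"])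
    show "inverse g \<notin> V.val_ring \<inter> L" using g by (auto simp: valuation_ring_def V.val_inverse)
  qed (use f g R sub L_mult L_inverse blown_up_plane_closed fraction_field_point V.val_ring_closed in auto)
  then show ?thesis using sub by auto
qed

lemma exc_unique:
  assumes "R \<in> blown_up_plane d" "uniformizer (R \<inter> L) p"
    "plane_u \<in> max_ideal R" "plane_v \<in> max_ideal R"
  shows "R \<inter> L = exc_ring \<inter> L"
  using exc_norm prime_divisor_eq[OF assms(1,2) exc.discrete_valuation_axioms subset_exc_ring[OF assms(1,3,4)]]
  by blast

lemma curve_unique:
  assumes "R \<in> blown_up_plane d" "uniformizer (R \<inter> L) p" "prime_elem q" "to_fract q \<in> max_ideal R"
    "plane_u \<notin> max_ideal R \<or> plane_v \<notin> max_ideal R"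
  shows "R \<inter> L = valuation_ring (curve_val q) \<inter> L"
  using curve_norm[OF assms(3)] prime_divisor_eq[OF assms(1,2) discrete_valuation_curve[OF assms(3)]
      subset_curve_ring[OF assms(1,3-5)]]
  by blast

lemma exc_prime_divisor: "exc_ring \<inter> L \<in> prime_divisors ((\<lambda>R. R \<inter> L) ` blown_up_plane d)"
  using exc_ring_in_blown_up_plane exc_restricted restricted_valuation.has_uniformizer
  unfolding prime_divisors_def by blast

lemma curve_prime_divisor:
  "prime_elem q \<Longrightarrow> valuation_ring (curve_val q) \<inter> L \<in> prime_divisors ((\<lambda>R. R \<inter> L) ` blown_up_plane d)"
  using curve_ring_in_blown_up_plane curve_restricted restricted_valuation.has_uniformizer
  unfolding prime_divisors_def by blast

end

text \<open>Every nonconstant monomial is a multiple of \<open>u'\<close> or \<open>v'\<close>.\<close>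

lemma origin_ideal_iff:
  "to_fract H \<in> Idl\<^bsub>ring_of plane\<^esub> {plane_u, plane_v} \<longleftrightarrow> bicoeff H 0 0 = 0"
proof -
  interpret subring_set plane by (rule subring_plane)
  have mult0: "bicoeff (G * H) 0 0 = bicoeff G 0 0 * bicoeff H 0 0" for G H
    by (simp add: bicoeff_def coeff_mult_0)
  define I0 where "I0 = to_fract ` {H. bicoeff H 0 0 = 0}"
  have I0: "to_fract H \<in> I0 \<longleftrightarrow> bicoeff H 0 0 = 0" for H by (auto simp: I0_def)
  have "ideal I0 (ring_of plane)"
    unfolding ideal_iff
  proof (intro conjI ballI)
    show "0 \<in> I0" using I0[of 0] by simp
    fix f g assume "f \<in> plane" "g \<in> I0"
    then show "f * g \<in> I0" by (auto simp: plane_eq I0_def mult0 simp flip: to_fract_mult)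
  next
    fix f g assume "f \<in> I0" "g \<in> I0"
    then show "f + g \<in> I0" by (auto simp: I0_def simp flip: to_fract_add)
  qed (auto simp: I0_def)
  moreover have "{plane_u, plane_v} \<subseteq> I0"
    using bicoeff_X_u[of 0 0] bicoeff_X_v_power[of 1 0 0] by (auto simp: plane_generators I0)
  moreover have "to_fract H \<in> I"
    if I: "ideal I (ring_of plane)" "{plane_u, plane_v} \<subseteq> I" and H: "bicoeff H 0 0 = 0" for I H
  proof -
    have id: "0 \<in> I" "\<And>f g. f \<in> I \<Longrightarrow> g \<in> I \<Longrightarrow> f + g \<in> I" "\<And>f g. f \<in> plane \<Longrightarrow> g \<in> I \<Longrightarrow> f * g \<in> I"
      using I(1) unfolding ideal_iff by blast+
    have sumI: "sum g A \<in> I" if "\<And>x. x \<in> A \<Longrightarrow> g x \<in> I" for g and A :: "(nat \<times> nat) set"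
      using that by (induction A rule: infinite_finite_induct) (auto simp: id)
    show ?thesis unfolding to_fract_monomials
    proof (rule sumI, clarify)
      fix p q assume "(p, q) \<in> monomials H"
      then consider p' where "p = Suc p'" | q' where "q = Suc q'"
        using H by (cases p; cases q) (auto simp: monomials_def)
      then show "plane_const (bicoeff H p q) * plane_u ^ p * plane_v ^ q \<in> I"
      proof cases
        case 1
        have "plane_const (bicoeff H p q) * plane_u ^ p' * plane_v ^ q * plane_u \<in> I"
          using I(2) by (intro id A_mult A_power plane_const_in_plane plane_u_in_plane plane_v_in_plane) auto
        then show ?thesis using 1 by (simp add: mult_ac)
      next
        case 2
        have "plane_const (bicoeff H p q) * plane_u ^ p * plane_v ^ q' * plane_v \<in> I"
          using I(2) by (intro id A_mult A_power plane_const_in_plane plane_u_in_plane plane_v_in_plane) auto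
        then show ?thesis using 2 by (simp add: mult_ac)
      qed
    qed
  qed
  ultimately show ?thesis unfolding genideal_def using I0 by blast
qed

lemma plane_origin_iff:
  "f \<in> plane_origin \<longleftrightarrow> (\<exists>a s. f = to_fract a / to_fract s \<and> bicoeff s 0 0 \<noteq> 0)"
proof -
  define I where "I = Idl\<^bsub>ring_of plane\<^esub> {plane_u, plane_v}"
  have "to_fract H \<in> I \<longleftrightarrow> bicoeff H 0 0 = 0" for H by (simp add: I_def origin_ideal_iff)
  then have "(s \<in> plane \<and> s \<notin> I) \<longleftrightarrow> (\<exists>H. s = to_fract H \<and> bicoeff H 0 0 \<noteq> 0)" for s
    by (auto simp: plane_eq)
  then show ?thesis
    unfolding plane_origin_def localization_def I_def[symmetric] by (auto simp: plane_eq)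
qed

lemma max_ideal_origin:
  assumes H: "bicoeff H 0 0 = 0" "H \<noteq> 0"
  shows "to_fract H \<in> max_ideal plane_origin"
proof -
  have "to_fract H \<in> plane_origin"
    unfolding plane_origin_iff by (intro exI[of _ H] exI[of _ 1]) simp
  moreover have "inverse (to_fract H) \<notin> plane_origin"
  proof
    assume "inverse (to_fract H) \<in> plane_origin"
    then obtain a s where as: "inverse (to_fract H) = to_fract a / to_fract s" "bicoeff s 0 0 \<noteq> 0"
      unfolding plane_origin_iff by blast
    then have "s \<noteq> 0" by auto
    then have "to_fract s = to_fract (a * H)" using as H by (simp add: field_simps)
    then have "s = a * H" by (simp only: to_fract_eq_iff)
    then show False using as H by (simp add: bicoeff_def coeff_mult_0)
  qed
  ultimately show ?thesis by (auto simp: max_ideal_iff)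
qed

lemma uv_power_in_max_ideal_origin:
  assumes "0 < n"
  shows "plane_u ^ n \<in> max_ideal plane_origin" "plane_v ^ n \<in> max_ideal plane_origin"
proof -
  have "bicoeff (X_u ^ n) 0 0 = 0" "bicoeff (X_v ^ n) 0 0 = 0"
    using assms bicoeff_monomial[of 1 n 0 0 0] bicoeff_X_v_power[of n 0 0] by auto
  moreover have "X_u ^ n \<noteq> 0" "X_v ^ n \<noteq> 0" using prime_X_u prime_X_v by auto
  ultimately show "plane_u ^ n \<in> max_ideal plane_origin" "plane_v ^ n \<in> max_ideal plane_origin"
    unfolding plane_generators to_fract_power[symmetric] using max_ideal_origin by blast+
qed

context plane_blow_up
begin

lemma exc_weight_eq_0_iff: "H \<noteq> 0 \<Longrightarrow> exc_weight d H = 0 \<longleftrightarrow> bicoeff H 0 0 \<noteq> 0"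
  using exc_weight_ge_iff[of H 1 d] exc_weight_0_if[of H d] d_pos
  by (metis One_nat_def add_is_0 less_one mult_eq_0_iff not_less not_less_zero)

text \<open>A polynomial has weight zero exactly when its constant term does not vanish.\<close>

lemma exc_ring_dominates_origin: "dominates exc_ring plane_origin"
proof -
  have val: "0 \<le> exc_val d f" "exc_val d f = 0 \<Longrightarrow> inverse f \<in> plane_origin" if "f \<in> plane_origin" "f \<noteq> 0" for f
  proof -
    obtain a s where f: "f = to_fract a / to_fract s" "bicoeff s 0 0 \<noteq> 0"
      using \<open>f \<in> plane_origin\<close> unfolding plane_origin_iff by blast
    then have nz: "s \<noteq> 0" "a \<noteq> 0" using \<open>f \<noteq> 0\<close> by auto
    then have v: "exc_val d f = int (exc_weight d a)"
      using f by (simp add: exc.val_divide exc_val_to_fract exc_weight_0_if)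
    then show "0 \<le> exc_val d f" by simp
    assume "exc_val d f = 0"
    then have "bicoeff a 0 0 \<noteq> 0" using v exc_weight_eq_0_iff[OF nz(2)] by simp
    then show "inverse f \<in> plane_origin" unfolding plane_origin_iff using f by auto
  qed
  have sub: "plane_origin \<subseteq> exc_ring" using val(1) by (auto simp: valuation_ring_def)
  have "f \<in> max_ideal exc_ring \<longleftrightarrow> f \<in> max_ideal plane_origin" if f: "f \<in> plane_origin" for f
  proof (cases "f = 0")
    case False
    have "f \<in> max_ideal exc_ring \<longleftrightarrow> exc_val d f \<noteq> 0"
      using val(1)[OF f False] False by (auto simp: exc.max_ideal_val_ring_UNIV)
    also have "\<dots> \<longleftrightarrow> inverse f \<notin> plane_origin"
      using val(2)[OF f False] val(1)[of "inverse f"] val(1)[OF f False] False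
      by (auto simp: exc.val_inverse)
    finally show ?thesis using f False by (simp add: max_ideal_iff)
  qed (use f sub in \<open>auto simp: max_ideal_iff\<close>)
  moreover have "max_ideal plane_origin \<subseteq> plane_origin" by (auto simp: max_ideal_iff)
  ultimately show ?thesis using sub unfolding dominates_def by blast
qed

end

context invariant_subfield
begin

text \<open>Powers of \<open>u'\<close> and \<open>v'\<close> are invariant, which carries the condition of lying over the origin from
  the quotient back to the blow-up.\<close>

lemma exceptional_divisor_quotient:
  assumes n: "0 < n" "plane_u ^ n \<in> L" "plane_v ^ n \<in> L"
  shows "exceptional_divisor ((\<lambda>R. R \<inter> L) ` blown_up_plane d) (plane_origin \<inter> L) = exc_ring \<inter> L"
  unfolding exceptional_divisor_def
proof (rule the_equality)
  have "dominates (exc_ring \<inter> L) (plane_origin \<inter> L)"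
    using exc_ring_dominates_origin unfolding dominates_def
    by (subst (1 2) max_ideal_Int) (auto simp: L_inverse)
  then show "exc_ring \<inter> L \<in> prime_divisors ((\<lambda>R. R \<inter> L) ` blown_up_plane d) \<and>
      dominates (exc_ring \<inter> L) (plane_origin \<inter> L)"
    using exc_prime_divisor by simp
next
  fix E assume E: "E \<in> prime_divisors ((\<lambda>R. R \<inter> L) ` blown_up_plane d) \<and> dominates E (plane_origin \<inter> L)"
  then obtain R p where R: "R \<in> blown_up_plane d" "E = R \<inter> L" "uniformizer (R \<inter> L) p"
    by (auto simp: prime_divisors_def)
  have "plane_u ^ n \<in> max_ideal (plane_origin \<inter> L)" "plane_v ^ n \<in> max_ideal (plane_origin \<inter> L)"
    using n uv_power_in_max_ideal_origin L_inverse by (simp_all add: max_ideal_Int)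
  then have "plane_u ^ n \<in> max_ideal (R \<inter> L)" "plane_v ^ n \<in> max_ideal (R \<inter> L)"
    using E R(2) unfolding dominates_def by auto
  then have "plane_u ^ n \<in> max_ideal R" "plane_v ^ n \<in> max_ideal R"
    using L_inverse by (simp_all add: max_ideal_Int)
  then have "plane_u \<in> max_ideal R" "plane_v \<in> max_ideal R"
    using max_ideal_power[of R _ n] blown_up_plane_closed[OF R(1)] plane_u_in_plane plane_v_in_plane n(1)
    by blast+
  then show "E = exc_ring \<inter> L" using exc_unique R by simp
qed

text \<open>A point over \<open>E'\<close> lies over the origin because powers of \<open>u'\<close> and \<open>v'\<close> are invariant; a point over
  the image of a curve \<open>{q = 0}\<close> lies on the curve itself if some \<open>q/v'\<^sup>k\<close> is invariant.\<close>

lemma exc_fibre: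
  assumes n: "0 < n" "plane_u ^ n \<in> L" "plane_v ^ n \<in> L"
    and R: "R \<in> blown_up_plane d" "R \<inter> L = exc_ring \<inter> L"
  shows "plane_u \<in> max_ideal R" "plane_v \<in> max_ideal R"
proof -
  have "plane_u ^ n \<in> max_ideal exc_ring" "plane_v ^ n \<in> max_ideal exc_ring"
    using n(1) d_pos by (auto simp: exc.max_ideal_val_ring_UNIV exc.val_power exc_val_uv)
  then have "plane_u ^ n \<in> max_ideal (R \<inter> L)" "plane_v ^ n \<in> max_ideal (R \<inter> L)"
    using n R(2) L_inverse by (simp_all add: max_ideal_Int)
  then have "plane_u ^ n \<in> max_ideal R" "plane_v ^ n \<in> max_ideal R"
    using L_inverse by (simp_all add: max_ideal_Int)
  then show "plane_u \<in> max_ideal R" "plane_v \<in> max_ideal R"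
    using max_ideal_power[of R _ n] blown_up_plane_closed[OF R(1)] plane_u_in_plane plane_v_in_plane n(1)
    by blast+
qed

lemma curve_fibre:
  assumes n: "0 < n" "plane_v ^ n \<in> L" and q: "prime_elem q" "\<not> q dvd X_v" "to_fract q / plane_v ^ k \<in> L"
    and R: "R \<in> blown_up_plane d" "R \<inter> L = valuation_ring (curve_val q) \<inter> L"
  shows "to_fract q \<in> max_ideal R" "plane_v \<notin> max_ideal R"
proof -
  interpret V: discrete_valuation "curve_val q" by (rule discrete_valuation_curve[OF q(1)])
  have R_mult: "f * g \<in> R" if "f \<in> R" "g \<in> R" for f g using that blown_up_plane_closed[OF R(1)] by blast
  have q0: "q \<noteq> 0" using q(1) by auto
  have v: "curve_val q plane_v = 0"
    using curve_val_0_iff[OF q(1), of X_v] q(2) prime_X_v by (auto simp: plane_generators)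
  have pow: "plane_v ^ j \<in> R" for j
    using blown_up_plane_closed(1)[OF R(1)] subring_set.A_power[OF subring_plane plane_v_in_plane] by blast
  have "inverse (plane_v ^ n) \<in> R \<inter> L"
    unfolding R(2) using v n L_inverse by (auto simp: valuation_ring_def V.val_inverse V.val_power)
  then have "plane_v * plane_v ^ (n - 1) \<notin> max_ideal R"
    using n(1) by (auto simp: max_ideal_iff simp flip: power_Suc)
  then show "plane_v \<notin> max_ideal R" using max_ideal_mult[OF R_mult _ pow] by blast
  have "to_fract q / plane_v ^ k \<in> max_ideal (R \<inter> L)"
    unfolding R(2) using q q0 v L_inverse
    by (simp add: max_ideal_Int V.max_ideal_val_ring_UNIV V.val_divide V.val_power curve_val_to_fract)
  then have "to_fract q / plane_v ^ k \<in> max_ideal R" using L_inverse by (simp add: max_ideal_Int)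
  from max_ideal_mult[OF R_mult this pow[of k]] show "to_fract q \<in> max_ideal R" by simp
qed

end

section \<open>The action of the roots of unity\<close>

text \<open>The extension of the action to rational functions, again through the reduced fraction.\<close>

definition root_act_field :: "nat \<Rightarrow> complex \<Rightarrow> plane_field \<Rightarrow> plane_field" where
  "root_act_field d \<xi> f =
     to_fract (root_act d \<xi> (fst (quot_of_fract f))) / to_fract (root_act d \<xi> (snd (quot_of_fract f)))"

lemma root_act_field_quotient:
  assumes "\<xi> \<noteq> 0" "b \<noteq> 0"
  shows "root_act_field d \<xi> (to_fract a / to_fract b) = to_fract (root_act d \<xi> a) / to_fract (root_act d \<xi> b)"
proof -
  let ?f = "to_fract a / to_fract b"
  define x y where "x = fst (quot_of_fract ?f)" and "y = snd (quot_of_fract ?f)"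
  have "?f = to_fract x / to_fract y"
    by (simp only: x_def y_def quot_of_fract_quotient)
  moreover have y: "y \<noteq> 0" by (simp add: y_def)
  ultimately have "a * y = x * b" using assms by (simp add: quotient_eq_iff)
  then have "root_act d \<xi> a * root_act d \<xi> y = root_act d \<xi> x * root_act d \<xi> b"
    by (metis root_act_hom(2))
  moreover have "root_act d \<xi> b \<noteq> 0" "root_act d \<xi> y \<noteq> 0"
    using assms y by (simp_all add: root_act_eq_0_iff)
  ultimately show ?thesis unfolding root_act_field_def x_def[symmetric] y_def[symmetric]
    by (simp add: quotient_eq_iff)
qed

lemma root_act_field_to_fract: "\<xi> \<noteq> 0 \<Longrightarrow> root_act_field d \<xi> (to_fract a) = to_fract (root_act d \<xi> a)"
  using root_act_field_quotient[of \<xi> 1 d a] by (simp add: root_act_hom)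

lemma root_act_field_hom:
  assumes "\<xi> \<noteq> 0"
  shows "root_act_field d \<xi> (f + g) = root_act_field d \<xi> f + root_act_field d \<xi> g"
    "root_act_field d \<xi> (f * g) = root_act_field d \<xi> f * root_act_field d \<xi> g"
    "root_act_field d \<xi> 1 = 1" "root_act_field d \<xi> 0 = 0"
    "root_act_field d \<xi> (inverse f) = inverse (root_act_field d \<xi> f)"
proof -
  obtain a b where f: "f = to_fract a / to_fract b" "b \<noteq> 0" by (rule fract_cases)
  obtain x y where g: "g = to_fract x / to_fract y" "y \<noteq> 0" by (rule fract_cases)
  have nz: "root_act d \<xi> b \<noteq> 0" "root_act d \<xi> y \<noteq> 0" using assms f g by (simp_all add: root_act_eq_0_iff)
  have "f + g = to_fract (a * y + x * b) / to_fract (b * y)" using f g by (simp add: field_simps)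
  then have "root_act_field d \<xi> (f + g) =
      to_fract (root_act d \<xi> (a * y + x * b)) / to_fract (root_act d \<xi> (b * y))"
    using f g assms by (simp only: root_act_field_quotient mult_eq_0_iff simp_thms)
  also have "\<dots> = to_fract (root_act d \<xi> a) / to_fract (root_act d \<xi> b) +
      to_fract (root_act d \<xi> x) / to_fract (root_act d \<xi> y)"
    using nz by (simp add: root_act_hom add_frac_eq)
  finally show "root_act_field d \<xi> (f + g) = root_act_field d \<xi> f + root_act_field d \<xi> g"
    using f g assms by (simp add: root_act_field_quotient)
  have "f * g = to_fract (a * x) / to_fract (b * y)" using f g by simp
  then show "root_act_field d \<xi> (f * g) = root_act_field d \<xi> f * root_act_field d \<xi> g"
    using f g assms nz root_act_field_quotient[of \<xi> "b * y" d "a * x"]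
    by (simp add: root_act_field_quotient root_act_hom del: to_fract_mult) simp
  show one: "root_act_field d \<xi> 1 = 1" "root_act_field d \<xi> 0 = 0"
    using root_act_field_to_fract[OF assms, of d 1] root_act_field_to_fract[OF assms, of d 0]
    by (simp_all add: root_act_hom)
  show "root_act_field d \<xi> (inverse f) = inverse (root_act_field d \<xi> f)"
  proof (cases "a = 0")
    case False
    have "inverse f = to_fract b / to_fract a" using f by simp
    then show ?thesis using False f assms by (simp add: root_act_field_quotient)
  qed (use f one in simp)
qed

lemma root_act_field_root_act_field:
  assumes "\<xi> \<noteq> 0" "\<zeta> \<noteq> 0"
  shows "root_act_field d \<xi> (root_act_field d \<zeta> f) = root_act_field d (\<xi> * \<zeta>) f"
proof -
  obtain a b where f: "f = to_fract a / to_fract b" "b \<noteq> 0" by (rule fract_cases)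
  then have "root_act d \<zeta> b \<noteq> 0" using assms by (simp add: root_act_eq_0_iff)
  then show ?thesis using f assms by (simp add: root_act_field_quotient root_act_root_act)
qed

lemma root_act_field_1 [simp]: "root_act_field d 1 f = f"
proof -
  obtain a b where "f = to_fract a / to_fract b" "b \<noteq> 0" by (rule fract_cases)
  then show ?thesis by (simp add: root_act_field_quotient)
qed

lemma root_of_unity_nonzero: "\<lbrakk>\<xi> ^ m = 1; 0 < m\<rbrakk> \<Longrightarrow> \<xi> \<noteq> (0::complex)"
  by (auto simp: power_0_left)

text \<open>An automorphism is determined by its values on constants and coordinates; conversely the action
  of \<open>\<xi>\<close> is inverted by that of \<open>1/\<xi>\<close>.\<close>

lemma root_group_iff:
  assumes "0 < m"
  shows "\<sigma> \<in> root_group d m \<longleftrightarrow> (\<exists>\<xi>. \<xi> ^ m = 1 \<and> \<sigma> = root_act_field d \<xi>)"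
proof
  assume \<sigma>: "\<sigma> \<in> root_group d m"
  then obtain \<xi> where \<xi>: "\<xi> ^ m = 1" "\<sigma> plane_u = plane_const (\<xi> ^ d) * plane_u"
    "\<sigma> plane_v = plane_const \<xi> * plane_v" and const: "\<And>c. \<sigma> (plane_const c) = plane_const c"
    by (auto simp: root_group_def)
  have nz: "\<xi> \<noteq> 0" using root_of_unity_nonzero \<xi>(1) assms by blast
  have hom: "\<sigma> (f + g) = \<sigma> f + \<sigma> g" "\<sigma> (f * g) = \<sigma> f * \<sigma> g" for f g
    using \<sigma> by (auto simp: root_group_def ring_iso_def ring_hom_def)
  have eq: "\<sigma> (to_fract H) = to_fract (root_act d \<xi> H)" for H
    by (rule bipoly_hom_ext[where \<phi> = "\<lambda>H. \<sigma> (to_fract H)" and \<psi> = "\<lambda>H. to_fract (root_act d \<xi> H)"])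
      (use const \<xi> in \<open>simp_all add: hom root_act_hom plane_generators\<close>)
  have "\<sigma> f = root_act_field d \<xi> f" for f
  proof -
    obtain a b where f: "f = to_fract a / to_fract b" "b \<noteq> 0" by (rule fract_cases)
    have "\<sigma> f * \<sigma> (to_fract b) = \<sigma> (to_fract a)" using f by (simp flip: hom(2))
    then have "\<sigma> f = to_fract (root_act d \<xi> a) / to_fract (root_act d \<xi> b)"
      using nz f(2) by (simp add: eq field_simps root_act_eq_0_iff)
    then show ?thesis using f nz by (simp add: root_act_field_quotient)
  qed
  then show "\<exists>\<xi>. \<xi> ^ m = 1 \<and> \<sigma> = root_act_field d \<xi>" using \<xi>(1) by blast
next
  assume "\<exists>\<xi>. \<xi> ^ m = 1 \<and> \<sigma> = root_act_field d \<xi>"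
  then obtain \<xi> where \<xi>: "\<xi> ^ m = 1" "\<sigma> = root_act_field d \<xi>" by blast
  have nz: "\<xi> \<noteq> 0" using root_of_unity_nonzero \<xi>(1) assms by blast
  have "bij \<sigma>"
    using nz by (intro o_bij[of "root_act_field d (inverse \<xi>)"])
      (auto simp: fun_eq_iff \<xi>(2) root_act_field_root_act_field)
  then have "\<sigma> \<in> ring_iso (ring_of UNIV) (ring_of UNIV)"
    by (auto simp: ring_iso_def ring_hom_def \<xi>(2) root_act_field_hom nz)
  then show "\<sigma> \<in> root_group d m"
    using \<xi>(1) nz unfolding root_group_def
    by (auto simp: \<xi>(2) plane_generators root_act_field_to_fract root_act_hom intro!: exI[of _ \<xi>])
qed

definition invariants :: "nat \<Rightarrow> nat \<Rightarrow> plane_field set" where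
  "invariants d m = {f. \<forall>\<xi>. \<xi> ^ m = 1 \<longrightarrow> root_act_field d \<xi> f = f}"

lemma quotient_map_root_group:
  assumes "0 < m"
  shows "quotient_map (root_group d m) = (\<lambda>R. R \<inter> invariants d m)"
proof -
  have "(\<forall>\<sigma>\<in>root_group d m. \<sigma> f = f) \<longleftrightarrow> f \<in> invariants d m" for f
    unfolding invariants_def Ball_def root_group_iff[OF assms] by blast
  then show ?thesis by (auto simp: fun_eq_iff quotient_map_def)
qed

lemma to_fract_invariant:
  "(\<And>\<xi>. \<xi> ^ m = 1 \<Longrightarrow> root_act d \<xi> H = H) \<Longrightarrow> 0 < m \<Longrightarrow> to_fract H \<in> invariants d m"
  by (auto simp: invariants_def root_act_field_to_fract root_of_unity_nonzero)

lemma primitive_root: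
  assumes "0 < m"
  shows "\<exists>\<zeta>::complex. \<zeta> ^ m = 1 \<and> (\<forall>k. \<zeta> ^ k = 1 \<longrightarrow> m dvd k)"
proof -
  define \<zeta> where "\<zeta> = cis (2 * pi * real 1 / real m)"
  have pow: "\<zeta> ^ k = cis (2 * pi * real k / real m)" for k
    by (simp add: \<zeta>_def DeMoivre mult_ac)
  have inj: "inj_on (\<lambda>k. \<zeta> ^ k) {..<m}" and one: "\<zeta> ^ m = 1"
    using bij_betw_roots_unity[OF assms] assms cis_multiple_2pi[of 1]
    unfolding pow bij_betw_def by auto
  have "m dvd k" if "\<zeta> ^ k = 1" for k
  proof -
    have "\<zeta> ^ k = \<zeta> ^ (m * (k div m) + k mod m)" by simp
    also have "\<dots> = \<zeta> ^ (k mod m)" by (simp only: power_add power_mult one power_one mult_1_left)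
    finally have "\<zeta> ^ (k mod m) = \<zeta> ^ 0" using that by simp
    then have "k mod m = 0" using inj assms by (auto simp: inj_on_def)
    then show ?thesis by auto
  qed
  then show ?thesis using one by blast
qed

lemma primitive_root_difference:
  assumes "0 < m"
  shows "\<exists>\<zeta>::complex. \<zeta> ^ m = 1 \<and> (\<forall>i j. \<zeta> ^ i = \<zeta> ^ j \<longrightarrow> int m dvd int i - int j)"
proof -
  obtain \<zeta> :: complex where \<zeta>: "\<zeta> ^ m = 1" "\<And>k. \<zeta> ^ k = 1 \<Longrightarrow> m dvd k"
    using primitive_root[OF assms] by blast
  have nz: "\<zeta> \<noteq> 0" using root_of_unity_nonzero \<zeta> assms by blast
  have *: "int m dvd int i - int j" if "\<zeta> ^ i = \<zeta> ^ j" "j \<le> i" for i j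
  proof -
    have "\<zeta> ^ (i - j) = 1" using that nz by (simp add: power_diff)
    then have "m dvd i - j" by (rule \<zeta>(2))
    then have "int m dvd int (i - j)" by simp
    then show ?thesis using that(2) by (simp add: of_nat_diff)
  qed
  have "int m dvd int i - int j" if "\<zeta> ^ i = \<zeta> ^ j" for i j
    using *[of i j] *[of j i] that by (cases "j \<le> i") (auto simp: dvd_diff_commute)
  then show ?thesis using \<zeta>(1) by blast
qed

lemma finite_roots: "0 < m \<Longrightarrow> finite {\<xi>::complex. \<xi> ^ m = 1}"
  by (rule finite_nth_roots)

text \<open>The norm of \<open>H\<close>, the product of its translates.\<close>

lemma invariant_norm:
  assumes "0 < m" "H \<noteq> 0"
  shows "\<exists>N. N \<noteq> 0 \<and> H dvd N \<and> to_fract N \<in> invariants d m"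
proof -
  let ?G = "{\<xi>::complex. \<xi> ^ m = 1}"
  define N where "N = (\<Prod>\<xi>\<in>?G. root_act d \<xi> H)"
  have fin: "finite ?G" using finite_roots assms by blast
  have prod: "root_act d \<zeta> (prod f A) = (\<Prod>x\<in>A. root_act d \<zeta> (f x))" for \<zeta> f and A :: "complex set"
    by (induction A rule: infinite_finite_induct) (auto simp: root_act_hom)
  have "N \<noteq> 0" using fin assms root_of_unity_nonzero by (auto simp: N_def root_act_eq_0_iff)
  moreover have "H dvd N"
    unfolding N_def using fin dvd_prodI[of ?G 1 "\<lambda>\<xi>. root_act d \<xi> H"] by auto
  moreover have "root_act d \<zeta> N = N" if \<zeta>: "\<zeta> ^ m = 1" for \<zeta>
  proof -
    have nz: "\<zeta> \<noteq> 0" using root_of_unity_nonzero \<zeta> assms by blast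
    have "root_act d \<zeta> N = (\<Prod>\<xi>\<in>?G. root_act d (\<zeta> * \<xi>) H)" by (simp add: N_def prod root_act_root_act)
    also have "\<dots> = N" unfolding N_def
      by (rule prod.reindex_bij_witness[of _ "\<lambda>\<xi>. \<xi> / \<zeta>" "\<lambda>\<xi>. \<zeta> * \<xi>"])
        (use nz \<zeta> in \<open>auto simp: power_mult_distrib power_divide\<close>)
    finally show ?thesis .
  qed
  ultimately show ?thesis using to_fract_invariant assms(1) by blast
qed

text \<open>Comparing lowest terms in the chart \<open>w, v'\<close>, where the group acts on \<open>v'\<close> alone, shows that
  an invariant function vanishes to an order divisible by \<open>m\<close>: the quotient map is ramified of
  index \<open>m\<close> along the exceptional divisor.\<close>

lemma exc_val_invariant:
  assumes "0 < m" "f \<in> invariants d m" "f \<noteq> 0"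
  shows "int m dvd exc_val d f"
proof -
  interpret discrete_valuation "exc_val d" by (rule discrete_valuation_exc)
  obtain \<zeta> :: complex where \<zeta>: "\<zeta> ^ m = 1" "\<And>i j. \<zeta> ^ i = \<zeta> ^ j \<Longrightarrow> int m dvd int i - int j"
    using primitive_root_difference[OF assms(1)] by blast
  have nz: "\<zeta> \<noteq> 0" using root_of_unity_nonzero \<zeta> assms by blast
  obtain a b where f: "f = to_fract a / to_fract b" "b \<noteq> 0" by (rule fract_cases)
  then have a0: "a \<noteq> 0" using assms by auto
  let ?i = "exc_weight d a" and ?j = "exc_weight d b"
  have "root_act_field d \<zeta> f = f" using assms(2) \<zeta>(1) by (auto simp: invariants_def)
  then have eq: "root_act d \<zeta> a * b = a * root_act d \<zeta> b"
    using f nz by (simp add: root_act_field_quotient quotient_eq_iff root_act_eq_0_iff)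
  have lowest: "poly.coeff (to_chart d x) (exc_weight d x) \<noteq> 0" "X_v ^ exc_weight d x dvd to_chart d x"
    if x: "x \<noteq> 0" for x
  proof -
    have ux: "to_chart d x \<noteq> 0" using x by (simp add: to_chart_eq_0_iff)
    show dvd: "X_v ^ exc_weight d x dvd to_chart d x"
      unfolding exc_weight_def by (rule multiplicity_dvd)
    obtain y where y: "to_chart d x = X_v ^ exc_weight d x * y" "\<not> X_v dvd y"
      unfolding exc_weight_def using ux prime_X_v by (metis multiplicity_decompose' prime_elem_not_unit)
    have "poly.coeff y 0 \<noteq> 0"
      using y(2) poly_eq_0_iff_dvd[of y 0] by (simp add: X_v_def poly_0_coeff_0)
    then show "poly.coeff (to_chart d x) (exc_weight d x) \<noteq> 0"
      by (simp add: y(1) X_v_power coeff_monom_mult)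
  qed
  have rot: "poly.coeff (to_chart d (root_act d \<zeta> x)) k = Polynomial.smult (\<zeta> ^ k) (poly.coeff (to_chart d x) k)"
    for x k
  proof (rule poly_eqI)
    fix p
    have "bicoeff (to_chart d (root_act d \<zeta> x)) p k = \<zeta> ^ k * bicoeff (to_chart d x) p k"
      by (auto simp: bicoeff_to_chart bicoeff_root_act)
    then show "poly.coeff (poly.coeff (to_chart d (root_act d \<zeta> x)) k) p =
        poly.coeff (Polynomial.smult (\<zeta> ^ k) (poly.coeff (to_chart d x) k)) p"
      by (simp add: bicoeff_def)
  qed
  have prod: "poly.coeff (x * y) (i + j) = poly.coeff x i * poly.coeff y j"
    if "X_v ^ i dvd x" "X_v ^ j dvd y" for x y :: bipoly and i j
  proof -
    from that obtain x' y' where xy: "x = X_v ^ i * x'" "y = X_v ^ j * y'" by (auto simp: dvd_def)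
    have "x * y = X_v ^ (i + j) * (x' * y')" by (simp add: xy power_add mult_ac)
    then have "poly.coeff (x * y) (i + j) = poly.coeff (x' * y') 0"
      unfolding X_v_power by (simp add: coeff_monom_mult)
    moreover have "poly.coeff x i = poly.coeff x' 0" "poly.coeff y j = poly.coeff y' 0"
      unfolding xy X_v_power by (simp_all add: coeff_monom_mult)
    ultimately show ?thesis by (simp add: coeff_mult_0)
  qed
  have rdvd: "X_v ^ exc_weight d x dvd to_chart d (root_act d \<zeta> x)" if "x \<noteq> 0" for x
    using lowest(2)[OF that] unfolding X_v_power monom_1_dvd_iff' by (simp add: rot)
  have "poly.coeff (to_chart d (root_act d \<zeta> a * b)) (?i + ?j) = poly.coeff (to_chart d (a * root_act d \<zeta> b)) (?i + ?j)"
    by (simp add: eq)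
  then have "Polynomial.smult (\<zeta> ^ ?i) (poly.coeff (to_chart d a) ?i * poly.coeff (to_chart d b) ?j) =
      Polynomial.smult (\<zeta> ^ ?j) (poly.coeff (to_chart d a) ?i * poly.coeff (to_chart d b) ?j)"
    using a0 f(2) by (simp add: to_chart_hom prod lowest rdvd rot)
  then have "Polynomial.smult (\<zeta> ^ ?i - \<zeta> ^ ?j) (poly.coeff (to_chart d a) ?i * poly.coeff (to_chart d b) ?j) = 0"
    by (simp add: smult_diff_left)
  then have pow: "\<zeta> ^ ?i = \<zeta> ^ ?j" using lowest(1) a0 f(2) by simp
  then have "int m dvd int ?i - int ?j" by (rule \<zeta>(2))
  then show ?thesis using f a0 by (simp add: val_divide exc_val_to_fract)
qed

lemma invariants_closed:
  assumes "0 < m"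
  shows "1 \<in> invariants d m" "f \<in> invariants d m \<Longrightarrow> g \<in> invariants d m \<Longrightarrow> f * g \<in> invariants d m"
    "f \<in> invariants d m \<Longrightarrow> g \<in> invariants d m \<Longrightarrow> f + g \<in> invariants d m"
    "f \<in> invariants d m \<Longrightarrow> inverse f \<in> invariants d m" "0 \<in> invariants d m"
    "plane_const c \<in> invariants d m" "f \<in> invariants d m \<Longrightarrow> f powi k \<in> invariants d m"
proof -
  have nz: "\<xi> \<noteq> 0" if "\<xi> ^ m = 1" for \<xi> :: complex using that assms root_of_unity_nonzero by blast
  show one: "1 \<in> invariants d m" and mult: "\<And>f g. f \<in> invariants d m \<Longrightarrow> g \<in> invariants d m \<Longrightarrow> f * g \<in> invariants d m"
    and "f \<in> invariants d m \<Longrightarrow> g \<in> invariants d m \<Longrightarrow> f + g \<in> invariants d m"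
    and inv: "\<And>f. f \<in> invariants d m \<Longrightarrow> inverse f \<in> invariants d m" and "0 \<in> invariants d m"
    "plane_const c \<in> invariants d m"
    by (simp_all add: invariants_def root_act_field_hom nz plane_generators root_act_field_to_fract root_act_hom)
  have pow: "f ^ n \<in> invariants d m" if "f \<in> invariants d m" for f n
    using that by (induction n) (auto simp: one mult)
  then show "f powi k \<in> invariants d m" if "f \<in> invariants d m"
    using that by (auto simp: power_int_def inv)
qed

section \<open>The prime divisors of the quotient and the sections of the polyhedral divisor\<close>

lemma set_of_least:
  "(LEAST m. m \<in> (\<lambda>v. of_int n * v) ` set_of I) =
     (if 0 \<le> n then of_int n * lower I else of_int n * (upper I :: rat))"
proof (rule Least_equality)
  show "(if 0 \<le> n then of_int n * lower I else of_int n * upper I) \<in> (\<lambda>v. of_int n * v) ` set_of I"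
    by (auto simp: set_of_eq)
qed (auto simp: set_of_eq mult_left_mono mult_left_mono_neg)

lemma lookup_pdiv_eval:
  "Poly_Mapping.lookup (pdiv_eval \<D> n) R =
     (if 0 \<le> n then of_int n * lower (Poly_Mapping.lookup \<D> R)
      else of_int n * upper (Poly_Mapping.lookup \<D> R))"
  unfolding pdiv_eval_def Poly_Mapping.map.rep_eq set_of_least by (auto simp: when_def)

lemma const2_uminus: "const2 (- c) = - const2 c"
  using const2_hom(3)[of c "- c"] by (simp add: eq_neg_iff_add_eq_0 add.commute)

text \<open>Here \<open>a\<close> is the integer \<open>a'\<close> of the theorem, that is, the coefficient \<open>a\<close> there divided by \<open>d\<close>; in
  this form the relation says that \<open>z\<^sup>a t\<^sup>b\<close> has weight one.\<close>

locale koras_russell_data =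
  fixes d l \<alpha>\<^sub>2 \<alpha>\<^sub>3 :: nat and a b :: int
  assumes d_ge: "2 \<le> d" and l_pos: "1 \<le> l" and \<alpha>_pos: "0 < \<alpha>\<^sub>2" "0 < \<alpha>\<^sub>3"
    and bezout: "int d * a * int \<alpha>\<^sub>3 + b * int \<alpha>\<^sub>2 = 1"
begin

definition m :: nat where "m = d * l - 1"

lemma m_pos: "0 < m" and dl_eq: "d * l = Suc m"
proof -
  have "2 * 1 \<le> d * l" using d_ge l_pos by (intro mult_le_mono)
  then show "0 < m" "d * l = Suc m" by (auto simp: m_def)
qed

abbreviation L :: "plane_field set" where "L \<equiv> invariants d m"

sublocale invariant_subfield d L
  using d_ge m_pos by unfold_locales (auto simp: invariants_closed invariant_norm)

abbreviation T :: bipoly where "T \<equiv> curve_eq d l"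

text \<open>On the threefold \<open>t\<^sup>\<alpha>\<^sup>3\<close> corresponds to minus the equation of the curve.\<close>

definition W :: plane_field where "W = - to_fract T"

sublocale val_u: discrete_valuation "curve_val X_u" by (rule discrete_valuation_curve[OF prime_X_u])
sublocale val_T: discrete_valuation "curve_val T" by (rule discrete_valuation_curve[OF prime_curve_eq])

lemma W_nonzero [simp]: "W \<noteq> 0"
  using prime_curve_eq[of d l] by (auto simp: W_def)

text \<open>The terms of \<open>T\<close> that decide about divisibility by \<open>v'\<close> and \<open>u'\<close>: the part without \<open>v'\<close> is \<open>u'\<^sup>l\<close>,
  and \<open>v'\<close> itself occurs with coefficient one.\<close>

lemma bicoeff_T: "bicoeff T p 0 = bicoeff (X_u ^ l) p 0" "bicoeff T 0 1 = 1"
proof -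
  obtain G where G: "(X_u + X_v ^ d) ^ l = X_u ^ l + X_v ^ d * G"
  proof -
    have "X_v ^ d dvd (X_u + X_v ^ d) ^ l - X_u ^ l"
      using power_diff_sumr2[of "X_u + X_v ^ d" l X_u] by simp
    then show ?thesis using that by (metis add.commute diff_add_cancel dvd_def)
  qed
  show "bicoeff T p 0 = bicoeff (X_u ^ l) p 0"
    using d_ge bicoeff_X_v_power[of 1 p 0] by (simp add: curve_eq_def G bicoeff_X_v_power_mult)
  obtain l' where "l = Suc l'" using l_pos by (cases l) auto
  then have "bicoeff (X_u ^ l) 0 1 = 0" by (simp add: bicoeff_X_u_mult)
  then show "bicoeff T 0 1 = 1"
    using d_ge bicoeff_X_v_power[of 1 0 1] by (simp add: curve_eq_def G bicoeff_X_v_power_mult)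
qed

lemma not_dvd: "\<not> X_v dvd T" "\<not> X_u dvd T" "\<not> T dvd X_v" "\<not> T dvd X_u"
proof -
  have "bicoeff (X_u ^ n) p 0 = (if p = n then 1 else 0)" for n p
    using bicoeff_monomial[of 1 n 0 p 0] by simp
  then have "bicoeff T l 0 = 1" using bicoeff_T(1)[of l] by simp
  then show v: "\<not> X_v dvd T" unfolding dvd_def by (auto simp: bicoeff_X_v_mult)
  show u: "\<not> X_u dvd T" using bicoeff_T(2) unfolding dvd_def by (auto simp: bicoeff_X_u_mult)
  show "\<not> T dvd X_v" using v prime_elem_dvd_prime_elem prime_X_v prime_curve_eq by blast
  show "\<not> T dvd X_u" using u prime_elem_dvd_prime_elem prime_X_u prime_curve_eq by blast
qed

lemma curve_val_values:
  "curve_val X_u plane_u = 1" "curve_val X_u plane_v = 0" "curve_val X_u W = 0"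
  "curve_val T plane_u = 0" "curve_val T plane_v = 0" "curve_val T W = 1" "exc_val d W = 1"
proof -
  have nz: "X_u \<noteq> 0" "X_v \<noteq> 0" "T \<noteq> 0" using prime_X_u prime_X_v prime_curve_eq[of d l] by auto
  show "curve_val X_u plane_u = 1" "curve_val X_u plane_v = 0" "curve_val X_u W = 0"
    "curve_val T plane_u = 0" "curve_val T plane_v = 0" "curve_val T W = 1" "exc_val d W = 1"
    using nz not_dvd not_X_u_dvd_X_v prime_X_u prime_curve_eq[of d l] exc_weight_curve_eq[OF d_ge l_pos]
    by (simp_all add: plane_generators W_def val_u.val_uminus val_T.val_uminus exc.val_uminus
        curve_val_to_fract exc_val_to_fract not_dvd_imp_multiplicity_0)
qed

text \<open>\<open>T\<close> has weight one because \<open>\<xi>\<^sup>d\<^sup>l = \<xi>\<close> for \<open>\<xi>\<^sup>d\<^sup>l\<^sup>-\<^sup>1 = 1\<close>.\<close>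

lemma root_act_T: "\<xi> ^ m = 1 \<Longrightarrow> root_act d \<xi> T = const2 \<xi> * T"
proof -
  assume "\<xi> ^ m = 1"
  then have "\<xi> ^ (d * l) = \<xi>" by (simp add: dl_eq)
  then have "const2 (\<xi> ^ d) ^ l = const2 \<xi>"
    by (simp only: const2_power[symmetric] power_mult[symmetric])
  moreover have "root_act d \<xi> (X_u + X_v ^ d) = const2 (\<xi> ^ d) * (X_u + X_v ^ d)"
    by (simp add: root_act_hom power_mult_distrib const2_power distrib_left)
  then have "root_act d \<xi> T = const2 \<xi> * X_v + (const2 (\<xi> ^ d) * (X_u + X_v ^ d)) ^ l"
    unfolding curve_eq_def root_act_hom(1)[of d \<xi> X_v] root_act_hom(8) by (simp only: root_act_hom(7))
  ultimately show ?thesis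
    unfolding power_mult_distrib by (simp only: curve_eq_def distrib_left)
qed

lemma root_act_field_values:
  assumes "\<xi> ^ m = 1"
  shows "root_act_field d \<xi> plane_u = plane_const (\<xi> ^ d) * plane_u"
    "root_act_field d \<xi> plane_v = plane_const \<xi> * plane_v" "root_act_field d \<xi> W = plane_const \<xi> * W"
proof -
  have nz: "\<xi> \<noteq> 0" using root_of_unity_nonzero assms m_pos by blast
  have W: "W = to_fract (const2 (-1) * T)" unfolding W_def const2_uminus by simp
  have "root_act_field d \<xi> W = to_fract (const2 (-1) * (const2 \<xi> * T))"
    unfolding W root_act_field_to_fract[OF nz] root_act_hom(2) root_act_T[OF assms] by (simp add: root_act_hom)
  also have "\<dots> = plane_const \<xi> * W" by (simp add: W plane_generators)
  finally have "root_act_field d \<xi> W = plane_const \<xi> * W" .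
  then show "root_act_field d \<xi> plane_u = plane_const (\<xi> ^ d) * plane_u"
    "root_act_field d \<xi> plane_v = plane_const \<xi> * plane_v" "root_act_field d \<xi> W = plane_const \<xi> * W"
    using nz by (simp_all add: plane_generators root_act_field_to_fract root_act_hom)
qed

lemma invariant_functions:
  "plane_u / plane_v ^ d \<in> L" "W / plane_v \<in> L" "plane_u ^ m \<in> L" "plane_v ^ m \<in> L"
proof -
  have c: "plane_const (x * y) = plane_const x * plane_const y" "plane_const (x ^ n) = plane_const x ^ n"
    "plane_const 1 = 1" for x y n
    by (simp_all add: plane_generators const2_power to_fract_power)
  have pow: "root_act_field d \<xi> (f ^ n) = root_act_field d \<xi> f ^ n" if "\<xi> ^ m = 1" for \<xi> f n
    using that m_pos root_of_unity_nonzero by (induction n) (auto simp: root_act_field_hom)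
  have nz: "\<xi> \<noteq> 0" "plane_const \<xi> \<noteq> 0" if "\<xi> ^ m = 1" for \<xi>
    using root_of_unity_nonzero[OF that m_pos] by (simp_all add: plane_generators)
  have one: "plane_const \<xi> ^ m = 1" if "\<xi> ^ m = 1" for \<xi>
    using that c(2)[of \<xi> m] c(3) by simp
  have "(plane_const \<xi> ^ d) ^ m = 1" if "\<xi> ^ m = 1" for \<xi>
    using one[OF that] by (metis mult.commute power_mult power_one)
  then show "plane_u / plane_v ^ d \<in> L" "W / plane_v \<in> L" "plane_u ^ m \<in> L" "plane_v ^ m \<in> L"
    by (simp_all add: invariants_def divide_inverse root_act_field_hom pow root_act_field_values nz c one
        power_mult_distrib)
qed

text \<open>Among these functions those of weight divisible by \<open>m\<close> are invariant, and the coordinate functions of the threefold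
  correspond to such elements.\<close>

definition laurent :: "int \<Rightarrow> int \<Rightarrow> nat \<Rightarrow> plane_field" where
  "laurent i j k = plane_u powi i * W powi j * plane_v ^ k"

lemma laurent_nonzero [simp]: "laurent i j k \<noteq> 0"
  by (simp add: laurent_def)

lemma laurent_values:
  "curve_val X_u (laurent i j k) = i" "curve_val T (laurent i j k) = j"
  "exc_val d (laurent i j k) = int d * i + j + int k"
  by (simp_all add: laurent_def val_u.val_mult val_u.val_powi val_u.val_power val_T.val_mult
      val_T.val_powi val_T.val_power exc.val_mult exc.val_powi exc.val_power curve_val_values exc_val_uv)

lemma curve_val_other:
  assumes "prime_elem q" "\<not> q dvd X_u" "\<not> q dvd T"
  shows "curve_val q plane_u = 0" "curve_val q W = 0" "0 \<le> curve_val q (laurent i j k)"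
proof -
  interpret V: discrete_valuation "curve_val q" by (rule discrete_valuation_curve[OF assms(1)])
  have nz: "X_u \<noteq> 0" "T \<noteq> 0" using prime_X_u prime_curve_eq[of d l] by auto
  show uW: "curve_val q plane_u = 0" "curve_val q W = 0"
    using nz assms curve_val_0_iff[OF assms(1)] prime_curve_eq[of d l]
    by (auto simp: plane_generators W_def V.val_uminus)
  have "0 \<le> curve_val q plane_v" using curve_val_plane[OF assms(1) plane_v_in_plane] by simp
  then show "0 \<le> curve_val q (laurent i j k)"
    by (simp add: laurent_def V.val_mult V.val_powi V.val_power uW)
qed

lemma laurent_invariant:
  assumes "int d * i + j + int k = int m * r"
  shows "laurent i j k \<in> L"
proof -
  have "laurent i j k = (plane_u / plane_v ^ d) powi i * (W / plane_v) powi j * (plane_v ^ m) powi r"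
  proof -
    have pow: "(plane_v ^ n) powi s = plane_v powi (int n * s)" for n s
      by (simp add: power_int_mult)
    have "plane_v powi (int m * r) = plane_v powi (int d * i) * plane_v powi j * plane_v ^ k"
      by (simp add: power_int_add flip: assms)
    then show ?thesis
      by (simp add: laurent_def power_int_divide_distrib pow)
  qed
  then show ?thesis
    using L_mult[OF L_mult[OF invariants_closed(7)[OF m_pos invariant_functions(1)]
        invariants_closed(7)[OF m_pos invariant_functions(2)]]
        invariants_closed(7)[OF m_pos invariant_functions(4)]] by metis
qed

text \<open>The invariants \<open>u'/v'\<^sup>d\<close>, \<open>T/v'\<close> and \<open>v'\<^sup>m\<close> realise the ramification indices \<open>1\<close>, \<open>1\<close> and \<open>m\<close>.\<close>

lemma curve_u_restricted: "restricted_valuation (curve_val X_u) L 1"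
  and curve_T_restricted: "restricted_valuation (curve_val T) L 1"
  and exc_restricted_m: "restricted_valuation (exc_val d) L (int m)"
proof -
  have "\<exists>p\<in>L. p \<noteq> 0 \<and> curve_val X_u p = 1"
    using invariant_functions(1)
    by (intro bexI[of _ "plane_u / plane_v ^ d"]) (auto simp: val_u.val_divide val_u.val_power curve_val_values)
  then show "restricted_valuation (curve_val X_u) L 1"
    by (intro restricted_valuation.intro restricted_valuation_axioms.intro
        val_u.discrete_valuation_axioms L_1 L_mult L_inverse) auto
  have "\<exists>p\<in>L. p \<noteq> 0 \<and> curve_val T p = 1"
    using invariant_functions(2)
    by (intro bexI[of _ "W / plane_v"]) (auto simp: val_T.val_divide curve_val_values)
  then show "restricted_valuation (curve_val T) L 1"
    by (intro restricted_valuation.intro restricted_valuation_axioms.intro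
        val_T.discrete_valuation_axioms L_1 L_mult L_inverse) auto
  have "\<exists>p\<in>L. p \<noteq> 0 \<and> exc_val d p = int m"
    using invariant_functions(4)
    by (intro bexI[of _ "plane_v ^ m"]) (auto simp: exc.val_power exc_val_uv)
  then show "restricted_valuation (exc_val d) L (int m)"
    using m_pos
    by (intro restricted_valuation.intro restricted_valuation_axioms.intro
        exc.discrete_valuation_axioms L_1 L_mult L_inverse exc_val_invariant[OF m_pos]) auto
qed

abbreviation "Y \<equiv> blown_up_plane d"
abbreviation "Y' \<equiv> (\<lambda>R. R \<inter> L) ` Y"
abbreviation "D3 \<equiv> valuation_ring (curve_val X_u)"
abbreviation "D2 \<equiv> valuation_ring (curve_val T)"

text \<open>A point over the image of \<open>D\<^sub>3\<close>, \<open>D\<^sub>2\<close> or \<open>E\<close> lies on that curve itself, since each of them is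
  stable under the group.\<close>

lemma D3_fibre:
  assumes "R \<in> Y" "R \<inter> L = D3 \<inter> L"
  shows "plane_u \<in> max_ideal R" "plane_v \<notin> max_ideal R"
proof -
  have "to_fract X_u / plane_v ^ d \<in> L" using invariant_functions(1) by (simp only: plane_generators(2))
  from curve_fibre[OF m_pos invariant_functions(4) prime_X_u not_X_u_dvd_X_v this assms]
  show "plane_u \<in> max_ideal R" "plane_v \<notin> max_ideal R" by (simp_all add: plane_generators(2))
qed

lemma D2_fibre:
  assumes "R \<in> Y" "R \<inter> L = D2 \<inter> L"
  shows "to_fract T \<in> max_ideal R" "plane_v \<notin> max_ideal R"
proof -
  have "plane_const (-1) * (W / plane_v) \<in> L"
    by (rule L_mult[OF invariants_closed(6)[OF m_pos] invariant_functions(2)])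
  moreover have "plane_const (-1) * (W / plane_v) = to_fract T / plane_v ^ 1"
    by (simp add: W_def plane_generators(1) const2_uminus)
  ultimately have "to_fract T / plane_v ^ 1 \<in> L" by simp
  from curve_fibre[OF m_pos invariant_functions(4) prime_curve_eq not_dvd(3) this assms]
  show "to_fract T \<in> max_ideal R" "plane_v \<notin> max_ideal R" .
qed

lemma E_fibre:
  assumes "R \<in> Y" "R \<inter> L = exc_ring \<inter> L"
  shows "plane_u \<in> max_ideal R" "plane_v \<in> max_ideal R"
  by (rule exc_fibre[OF m_pos invariant_functions(3,4) assms])+

lemma curve_max_ideal:
  assumes "prime_elem q" "H \<noteq> 0"
  shows "to_fract H \<in> max_ideal (valuation_ring (curve_val q)) \<longleftrightarrow> q dvd H"
proof -
  interpret V: discrete_valuation "curve_val q" by (rule discrete_valuation_curve[OF assms(1)])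
  show ?thesis
    using assms prime_multiplicity_gt_zero_iff[of q H]
    by (simp add: V.max_ideal_val_ring_UNIV curve_val_to_fract)
qed

lemma divisors_distinct:
  "D3 \<inter> L \<noteq> D2 \<inter> L" "D3 \<inter> L \<noteq> exc_ring \<inter> L" "D2 \<inter> L \<noteq> exc_ring \<inter> L"
  and other_divisor: "\<lbrakk>prime_elem q; \<not> q dvd X_u; \<not> q dvd T\<rbrakk> \<Longrightarrow>
    valuation_ring (curve_val q) \<inter> L \<notin> {D3 \<inter> L, D2 \<inter> L, exc_ring \<inter> L}"
proof -
  have nz: "X_u \<noteq> 0" "X_v \<noteq> 0" "T \<noteq> 0" using prime_X_u prime_X_v prime_curve_eq[of d l] by auto
  note mem = curve_ring_in_blown_up_plane
  show "D3 \<inter> L \<noteq> D2 \<inter> L"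
    using D2_fibre(1)[OF mem[OF prime_X_u]] curve_max_ideal[OF prime_X_u, of T] not_dvd nz by auto
  show "D3 \<inter> L \<noteq> exc_ring \<inter> L"
    using E_fibre(2)[OF mem[OF prime_X_u]] curve_max_ideal[OF prime_X_u, of X_v] not_X_u_dvd_X_v nz
    by (auto simp: plane_generators)
  show "D2 \<inter> L \<noteq> exc_ring \<inter> L"
    using E_fibre(2)[OF mem[OF prime_curve_eq]] curve_max_ideal[OF prime_curve_eq, of X_v d l] not_dvd nz
    by (auto simp: plane_generators)
  assume q: "prime_elem q" "\<not> q dvd X_u" "\<not> q dvd T"
  then show "valuation_ring (curve_val q) \<inter> L \<notin> {D3 \<inter> L, D2 \<inter> L, exc_ring \<inter> L}"
    using D3_fibre(1)[OF mem[OF q(1)]] D2_fibre(1)[OF mem[OF q(1)]] E_fibre(1)[OF mem[OF q(1)]]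
      curve_max_ideal[OF q(1)] nz by (auto simp: plane_generators)
qed

text \<open>A uniformizer is a quotient of polynomials whose numerator is a nonunit, hence has a prime factor
  that is one; the point then lies on the exceptional divisor or on the curve of that factor.\<close>

lemma prime_divisor_cases:
  assumes "P \<in> prime_divisors Y'"
  obtains "P = exc_ring \<inter> L" | "P = D3 \<inter> L" | "P = D2 \<inter> L"
  | q where "prime_elem q" "\<not> q dvd X_u" "\<not> q dvd T" "P = valuation_ring (curve_val q) \<inter> L"
proof -
  obtain R p where R: "R \<in> Y" "P = R \<inter> L" "uniformizer (R \<inter> L) p"
    using assms by (auto simp: prime_divisors_def)
  have R_plane: "to_fract H \<in> R" for H using blown_up_plane_closed(1)[OF R(1)] by auto
  have R_mult: "f \<in> R \<Longrightarrow> g \<in> R \<Longrightarrow> f * g \<in> R" for f g using blown_up_plane_closed(2)[OF R(1)] .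
  have p: "p \<in> R" "p \<noteq> 0" "inverse p \<notin> R"
    using R(3) L_inverse by (auto simp: uniformizer_def max_ideal_iff)
  have nonunit: "\<exists>q. prime_elem q \<and> to_fract q \<in> max_ideal R" if "H \<noteq> 0" "inverse (to_fract H) \<notin> R" for H
    using that
  proof (induction H rule: prime_divisors_induct)
    case (unit x)
    then obtain y where "x * y = 1" by (auto elim: dvdE)
    then have "to_fract x * to_fract y = 1" by (metis to_fract_1 to_fract_mult)
    then have "inverse (to_fract x) = to_fract y" by (rule inverse_unique)
    then show ?case using unit R_plane by simp
  next
    case (factor q x)
    show ?case
    proof (cases "inverse (to_fract q) \<in> R")
      case True
      then have "inverse (to_fract x) \<notin> R" using factor.prems R_mult by auto
      then show ?thesis using factor by auto
    next
      case False
      then show ?thesis using factor.hyps R_plane by (intro exI[of _ q]) (auto simp: max_ideal_iff)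
    qed
  qed simp
  obtain x y where xy: "p = to_fract x / to_fract y" "y \<noteq> 0" by (rule fract_cases)
  then have "inverse p = to_fract y * inverse (to_fract x)" by (simp add: divide_inverse mult.commute)
  then have "inverse (to_fract x) \<notin> R" using p(3) R_mult[OF R_plane[of y]] by metis
  moreover have "x \<noteq> 0" using xy p by auto
  ultimately obtain q where q: "prime_elem q" "to_fract q \<in> max_ideal R" using nonunit by blast
  show ?thesis
  proof (cases "plane_u \<in> max_ideal R \<and> plane_v \<in> max_ideal R")
    case True
    then show ?thesis using that(1) exc_unique[OF R(1,3)] R(2) by blast
  next
    case False
    then have eq: "P = valuation_ring (curve_val q') \<inter> L"
      if "prime_elem q'" "q dvd q'" for q'
    proof -
      have "to_fract q' \<in> max_ideal R"
      proof -
        obtain c where "q' = q * c" using \<open>q dvd q'\<close> by auto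
        then show ?thesis using max_ideal_mult[OF R_mult q(2) R_plane[of c]] by simp
      qed
      then show ?thesis using curve_unique[OF R(1,3) \<open>prime_elem q'\<close>] False R(2) by blast
    qed
    show ?thesis
      using that eq[OF prime_X_u] eq[OF prime_curve_eq, of d l] eq[OF q(1) dvd_refl] q(1) by blast
  qed
qed

text \<open>The sections of degree \<open>n\<close>. The condition at \<open>E\<close> is stated in the form that it has for \<open>n \<ge> 0\<close>:
  for negative \<open>n\<close> the stronger bound follows from the other conditions.\<close>

definition piece :: "int \<Rightarrow> plane_field set" where
  "piece n = {g \<in> L. g \<noteq> 0 \<longrightarrow>
     0 \<le> int \<alpha>\<^sub>2 * curve_val X_u g + a * n \<and> 0 \<le> int \<alpha>\<^sub>3 * curve_val T g + b * n \<and> 0 \<le> exc_val d g \<and>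
     (\<forall>q. prime_elem q \<longrightarrow> \<not> q dvd X_u \<longrightarrow> \<not> q dvd T \<longrightarrow> 0 \<le> curve_val q g)}"

text \<open>Once the powers of \<open>u'\<close> and \<open>T\<close> are split off, no prime is left that could divide the denominator
  of the reduced fraction.\<close>

lemma decomposition:
  assumes g: "g \<noteq> 0" and nonneg: "\<And>q. \<lbrakk>prime_elem q; \<not> q dvd X_u; \<not> q dvd T\<rbrakk> \<Longrightarrow> 0 \<le> curve_val q g"
  shows "\<exists>h. h \<noteq> 0 \<and> g = plane_u powi curve_val X_u g * W powi curve_val T g * to_fract h"
proof -
  define c where "c = plane_u powi curve_val X_u g * W powi curve_val T g"
  have c0: "c \<noteq> 0" by (simp add: c_def)
  obtain x y where xy: "g / c = to_fract x / to_fract y" "y \<noteq> 0" "coprime x y" by (rule fract_cases)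
  have x0: "x \<noteq> 0" using xy c0 g by auto
  have "is_unit y"
  proof (rule ccontr)
    assume "\<not> is_unit y"
    then obtain q0 where "q0 dvd y" "prime q0" using prime_divisor_exists[OF xy(2)] by blast
    then have q0: "prime_elem q0" "q0 dvd y" by auto
    have neg: "curve_val q (g / c) < 0" if q: "prime_elem q" "q dvd y" for q
    proof -
      interpret V: discrete_valuation "curve_val q" by (rule discrete_valuation_curve[OF q(1)])
      have "\<not> q dvd x" using xy(3) q by (meson coprime_common_divisor prime_elem_not_unit)
      then show ?thesis unfolding xy(1)
        using x0 xy(2) q prime_multiplicity_gt_zero_iff[of q y]
        by (simp add: V.val_divide curve_val_to_fract not_dvd_imp_multiplicity_0)
    qed
    consider "q0 dvd X_u" | "q0 dvd T" | "\<not> q0 dvd X_u" "\<not> q0 dvd T" by blast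
    then show False
    proof cases
      case 1
      then have "X_u dvd y" using prime_elem_dvd_prime_elem[OF q0(1) prime_X_u] q0(2) dvd_trans by blast
      moreover have "curve_val X_u (g / c) = 0"
        using g by (simp add: c_def val_u.val_divide val_u.val_mult val_u.val_powi curve_val_values)
      ultimately show False using neg[OF prime_X_u] by simp
    next
      case 2
      then have "T dvd y" using prime_elem_dvd_prime_elem[OF q0(1) prime_curve_eq] q0(2) dvd_trans by blast
      moreover have "curve_val T (g / c) = 0"
        using g by (simp add: c_def val_T.val_divide val_T.val_mult val_T.val_powi curve_val_values)
      ultimately show False using neg[OF prime_curve_eq, of d l] by simp
    next
      case 3
      interpret V: discrete_valuation "curve_val q0" by (rule discrete_valuation_curve[OF q0(1)])
      have "curve_val q0 (g / c) = curve_val q0 g"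
        using g curve_val_other[OF q0(1) 3] by (simp add: c_def V.val_divide V.val_mult V.val_powi)
      then show False using neg[OF q0] nonneg[OF q0(1) 3] by simp
    qed
  qed
  then obtain z where z: "y * z = 1" by (auto elim: dvdE)
  then have yz: "to_fract y * to_fract z = 1" by (metis to_fract_1 to_fract_mult)
  then have "g / c = to_fract x * to_fract z" using xy(1) inverse_unique[OF yz] by (simp add: divide_inverse)
  then have "g = c * to_fract (x * z)" using c0 by (simp add: field_simps)
  moreover have "x * z \<noteq> 0" using x0 z by auto
  ultimately show ?thesis unfolding c_def by blast
qed

text \<open>With \<open>g = u'\<^sup>i T\<^sup>j h\<close> the order along \<open>E\<close> is at least \<open>d i + j\<close>; insert the bounds for \<open>i\<close> and \<open>j\<close>
  and use \<open>a d \<alpha>\<^sub>3 + b \<alpha>\<^sub>2 = 1\<close>.\<close>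

lemma piece_exc_val:
  assumes g: "g \<in> piece n" "g \<noteq> 0"
  shows "0 \<le> int \<alpha>\<^sub>2 * int \<alpha>\<^sub>3 * exc_val d g + n"
proof -
  let ?i = "curve_val X_u g" and ?j = "curve_val T g"
  obtain h where h: "h \<noteq> 0" "g = plane_u powi ?i * W powi ?j * to_fract h"
    using decomposition[OF g(2)] g by (auto simp: piece_def)
  have "exc_val d g = int d * ?i + ?j + int (exc_weight d h)"
    by (subst h(2)) (use h(1) in \<open>simp add: exc.val_mult exc.val_powi exc_val_uv curve_val_values exc_val_to_fract\<close>)
  then have "int \<alpha>\<^sub>2 * int \<alpha>\<^sub>3 * exc_val d g + n = int d * int \<alpha>\<^sub>3 * (int \<alpha>\<^sub>2 * ?i + a * n)
      + int \<alpha>\<^sub>2 * (int \<alpha>\<^sub>3 * ?j + b * n) + int \<alpha>\<^sub>2 * int \<alpha>\<^sub>3 * int (exc_weight d h)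
      + n * (1 - (int d * a * int \<alpha>\<^sub>3 + b * int \<alpha>\<^sub>2))"
    by (simp add: algebra_simps)
  then show ?thesis using g bezout by (auto simp: piece_def)
qed

text \<open>Rounding causes no loss: an order \<open>k\<close> satisfies \<open>k + \<lfloor>x/y\<rfloor> \<ge> 0\<close> exactly when \<open>y k + x \<ge> 0\<close>. At \<open>E'\<close> the
  order is the one along \<open>E\<close> divided by \<open>m\<close>, which matches the factor \<open>m\<close> in the denominator of the
  coefficient.\<close>

lemma sections_eq_piece:
  assumes \<D>: "\<D> = Poly_Mapping.single (D3 \<inter> L) (interval_of (of_int a / of_nat \<alpha>\<^sub>2))
      + Poly_Mapping.single (D2 \<inter> L) (interval_of (of_int b / of_nat \<alpha>\<^sub>3))
      + Poly_Mapping.single (exc_ring \<inter> L) (Interval (0, 1 / of_nat (m * \<alpha>\<^sub>2 * \<alpha>\<^sub>3)))"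
  shows "sections Y' (pdiv_eval \<D> n) = piece n"
proof -
  have Int: "lower (Interval (0, c)) = 0" "upper (Interval (0, c)) = c" if "0 \<le> c" for c :: rat
    using that by (simp_all add: lower.rep_eq upper.rep_eq Interval_inverse)
  have c_pos: "0 \<le> (1::rat) / of_nat (m * \<alpha>\<^sub>2 * \<alpha>\<^sub>3)" by simp
  let ?D = "Poly_Mapping.lookup (pdiv_eval \<D> n)"
  have lookups: "?D (D3 \<inter> L) = of_int (a * n) / of_int (int \<alpha>\<^sub>2)" "?D (D2 \<inter> L) = of_int (b * n) / of_int (int \<alpha>\<^sub>3)"
    "?D (exc_ring \<inter> L) = (if 0 \<le> n then 0 else of_int n / of_int (int (m * \<alpha>\<^sub>2 * \<alpha>\<^sub>3)))"
    "P \<notin> {D3 \<inter> L, D2 \<inter> L, exc_ring \<inter> L} \<Longrightarrow> ?D P = 0" for P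
    using divisors_distinct divisors_distinct[symmetric] Int[OF c_pos]
    by (auto simp: lookup_pdiv_eval \<D> lookup_add lookup_single when_def)
  have floor_cond: "0 \<le> k + \<lfloor>of_int x / (of_int y :: rat)\<rfloor> \<longleftrightarrow> 0 \<le> y * k + x" if "0 < y" for k x y :: int
  proof -
    have "0 \<le> k + \<lfloor>of_int x / (of_int y :: rat)\<rfloor> \<longleftrightarrow> of_int (- k) \<le> of_int x / (of_int y :: rat)"
      by (subst le_floor_iff[symmetric]) auto
    also have "\<dots> \<longleftrightarrow> of_int (- k * y) \<le> (of_int x :: rat)" using that by (simp add: field_simps)
    also have "\<dots> \<longleftrightarrow> 0 \<le> y * k + x" unfolding of_int_le_iff
      by (simp only: mult.commute[of y k] minus_mult_left[symmetric]) linarith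
    finally show ?thesis .
  qed
  have E_cond: "0 \<le> ord_at (exc_ring \<inter> L) g + \<lfloor>?D (exc_ring \<inter> L)\<rfloor> \<longleftrightarrow>
      0 \<le> exc_val d g \<and> 0 \<le> int \<alpha>\<^sub>2 * int \<alpha>\<^sub>3 * exc_val d g + n"
    if g: "g \<in> L" "g \<noteq> 0" for g
  proof -
    obtain k where k: "exc_val d g = int m * k"
      using exc_val_invariant[OF m_pos g] by (auto simp: dvd_def)
    have ord: "ord_at (exc_ring \<inter> L) g = k"
      using restricted_valuation.ord_at_val_ring[OF exc_restricted_m g] k m_pos by simp
    have sgn: "0 \<le> exc_val d g \<longleftrightarrow> 0 \<le> k" using k m_pos by (simp add: zero_le_mult_iff)
    show ?thesis
    proof (cases "0 \<le> n")
      case True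
      then show ?thesis using ord sgn by (auto simp: lookups(3))
    next
      case False
      have "0 < int (m * \<alpha>\<^sub>2 * \<alpha>\<^sub>3)" using m_pos \<alpha>_pos by simp
      then have "0 \<le> ord_at (exc_ring \<inter> L) g + \<lfloor>?D (exc_ring \<inter> L)\<rfloor> \<longleftrightarrow>
          0 \<le> int (m * \<alpha>\<^sub>2 * \<alpha>\<^sub>3) * k + n"
        using False floor_cond[of "int (m * \<alpha>\<^sub>2 * \<alpha>\<^sub>3)" k n] ord by (simp add: lookups(3))
      also have "\<dots> \<longleftrightarrow> 0 \<le> int \<alpha>\<^sub>2 * int \<alpha>\<^sub>3 * exc_val d g + n" by (simp add: k mult_ac)
      finally have eq: "0 \<le> ord_at (exc_ring \<inter> L) g + \<lfloor>?D (exc_ring \<inter> L)\<rfloor> \<longleftrightarrow>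
          0 \<le> int \<alpha>\<^sub>2 * int \<alpha>\<^sub>3 * exc_val d g + n" .
      have "0 \<le> exc_val d g" if "0 \<le> int \<alpha>\<^sub>2 * int \<alpha>\<^sub>3 * exc_val d g + n"
      proof -
        have "0 < int \<alpha>\<^sub>2 * int \<alpha>\<^sub>3 * exc_val d g" using that False by linarith
        moreover have "0 < int \<alpha>\<^sub>2 * int \<alpha>\<^sub>3" using \<alpha>_pos by simp
        ultimately show ?thesis by (metis less_imp_le zero_less_mult_pos)
      qed
      then show ?thesis using eq by blast
    qed
  qed
  have u_cond: "0 \<le> ord_at (D3 \<inter> L) g + \<lfloor>?D (D3 \<inter> L)\<rfloor> \<longleftrightarrow> 0 \<le> int \<alpha>\<^sub>2 * curve_val X_u g + a * n"
    and T_cond: "0 \<le> ord_at (D2 \<inter> L) g + \<lfloor>?D (D2 \<inter> L)\<rfloor> \<longleftrightarrow> 0 \<le> int \<alpha>\<^sub>3 * curve_val T g + b * n"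
    if g: "g \<in> L" "g \<noteq> 0" for g
    unfolding lookups restricted_valuation.ord_at_val_ring[OF curve_u_restricted g]
      restricted_valuation.ord_at_val_ring[OF curve_T_restricted g]
    using floor_cond[of "int \<alpha>\<^sub>2" "curve_val X_u g" "a * n"]
      floor_cond[of "int \<alpha>\<^sub>3" "curve_val T g" "b * n"] \<alpha>_pos by simp_all
  have q_cond: "0 \<le> ord_at (valuation_ring (curve_val q) \<inter> L) g + \<lfloor>?D (valuation_ring (curve_val q) \<inter> L)\<rfloor> \<longleftrightarrow>
      0 \<le> curve_val q g"
    if g: "g \<in> L" "g \<noteq> 0" and q: "prime_elem q" "\<not> q dvd X_u" "\<not> q dvd T" for g q
  proof -
    obtain e where e: "restricted_valuation (curve_val q) L e" using curve_restricted[OF q(1)] by blast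
    then interpret V: restricted_valuation "curve_val q" L e .
    have "0 \<le> curve_val q g div e \<longleftrightarrow> 0 \<le> curve_val q g"
      using V.e_pos by (simp add: pos_imp_zdiv_nonneg_iff)
    then show ?thesis using lookups(4)[OF other_divisor[OF q]] V.ord_at_val_ring[OF g] by simp
  qed
  note prime_divisors = exc_prime_divisor curve_prime_divisor[OF prime_X_u]
    curve_prime_divisor[OF prime_curve_eq] curve_prime_divisor
  show ?thesis
  proof (intro equalityI subsetI)
    fix g assume g: "g \<in> sections Y' (pdiv_eval \<D> n)"
    then have gL: "g \<in> L" by (auto simp: sections_def function_field_quotient)
    show "g \<in> piece n"
    proof (cases "g = 0")
      case False
      then have "0 \<le> ord_at P g + \<lfloor>?D P\<rfloor>" if "P \<in> prime_divisors Y'" for P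
        using g that by (auto simp: sections_def)
      then show ?thesis
        using prime_divisors u_cond[OF gL False] T_cond[OF gL False] E_cond[OF gL False] q_cond[OF gL False] gL
        unfolding piece_def by blast
    qed (use gL in \<open>simp add: piece_def\<close>)
  next
    fix g assume g: "g \<in> piece n"
    then have gL: "g \<in> L" by (auto simp: piece_def)
    have "0 \<le> ord_at P g + \<lfloor>?D P\<rfloor>" if nz: "g \<noteq> 0" and P: "P \<in> prime_divisors Y'" for P
      using P
    proof (cases rule: prime_divisor_cases)
      case 1
      then show ?thesis using E_cond[OF gL nz] piece_exc_val[OF g nz] g nz by (auto simp: piece_def)
    next
      case 2
      then show ?thesis using u_cond[OF gL nz] g nz by (auto simp: piece_def)
    next
      case 3
      then show ?thesis using T_cond[OF gL nz] g nz by (auto simp: piece_def)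
    next
      case (4 q)
      then show ?thesis using q_cond[OF gL nz] g nz by (auto simp: piece_def)
    qed
    then show "g \<in> sections Y' (pdiv_eval \<D> n)"
      using gL by (auto simp: sections_def function_field_quotient)
  qed
qed

end

section \<open>Values of rational functions\<close>

definition bieval :: "bipoly \<Rightarrow> complex \<Rightarrow> complex \<Rightarrow> complex" where
  "bieval H u v = poly (poly H [:v:]) u"

lemma bieval_simps [simp]:
  "bieval 0 u v = 0" "bieval 1 u v = 1" "bieval (F + G) u v = bieval F u v + bieval G u v"
  "bieval (F * G) u v = bieval F u v * bieval G u v" "bieval (- F) u v = - bieval F u v"
  "bieval (F ^ n) u v = bieval F u v ^ n" "bieval (const2 c) u v = c" "bieval X_u u v = u" "bieval X_v u v = v"
  by (simp_all add: bieval_def const2_def X_u_def X_v_def poly_power)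

lemma bieval_sum: "bieval (sum f A) u v = (\<Sum>x\<in>A. bieval (f x) u v)"
  by (induction A rule: infinite_finite_induct) auto

lemma bieval_eq_0_imp:
  assumes "\<And>u v. bieval H u v = 0"
  shows "H = 0"
proof -
  have "poly H [:v:] = 0" for v
    using assms[of _ v] poly_all_0_iff_0[of "poly H [:v:]"] by (simp add: bieval_def)
  then have "range (\<lambda>v::complex. [:v:]) \<subseteq> {x. poly H x = 0}" by auto
  moreover have "infinite (range (\<lambda>v::complex. [:v:]))"
    using finite_imageD[of "\<lambda>v::complex. [:v:]" UNIV] infinite_UNIV_char_0 by (auto simp: inj_on_def)
  ultimately show ?thesis using poly_roots_finite[of H] finite_subset by blast
qed

definition field_eval :: "complex \<Rightarrow> complex \<Rightarrow> plane_field \<Rightarrow> complex" where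
  "field_eval u v f = bieval (fst (quot_of_fract f)) u v / bieval (snd (quot_of_fract f)) u v"

definition regular_at :: "complex \<Rightarrow> complex \<Rightarrow> plane_field \<Rightarrow> bool" where
  "regular_at u v f \<longleftrightarrow> (\<exists>a b. f = to_fract a / to_fract b \<and> bieval b u v \<noteq> 0)"

text \<open>The reduced denominator divides every other one, so it does not vanish where the function
  is regular.\<close>

lemma field_eval_quotient:
  assumes b: "bieval b u v \<noteq> 0"
  shows "field_eval u v (to_fract a / to_fract b) = bieval a u v / bieval b u v"
proof -
  let ?f = "to_fract a / to_fract b"
  define x y where "x = fst (quot_of_fract ?f)" and "y = snd (quot_of_fract ?f)"
  have "?f = to_fract x / to_fract y"
    by (simp only: x_def y_def quot_of_fract_quotient)
  moreover have "y \<noteq> 0" "b \<noteq> 0" using b by (auto simp: y_def)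
  ultimately have eq: "a * y = x * b" by (simp add: quotient_eq_iff)
  have "coprime x y" unfolding x_def y_def by (rule coprime_quot_of_fract)
  moreover have "y dvd x * b" using eq by (metis dvd_triv_right)
  ultimately have "y dvd b" by (metis coprime_commute coprime_dvd_mult_right_iff)
  then have "bieval y u v \<noteq> 0" using b by (auto simp: dvd_def)
  moreover have "bieval a u v * bieval y u v = bieval x u v * bieval b u v"
    using arg_cong[OF eq, of "\<lambda>F. bieval F u v"] by simp
  ultimately show ?thesis
    using b unfolding field_eval_def x_def[symmetric] y_def[symmetric] by (simp add: field_simps)
qed

lemma regular_quotient: "bieval b u v \<noteq> 0 \<Longrightarrow> regular_at u v (to_fract a / to_fract b)"
  unfolding regular_at_def by auto

lemma field_eval_to_fract [simp]: "field_eval u v (to_fract a) = bieval a u v"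
  using field_eval_quotient[of 1 u v a] by simp

lemma regular_to_fract [simp]: "regular_at u v (to_fract a)"
  using regular_quotient[of 1 u v a] by simp

lemma field_eval_consts [simp]:
  "field_eval u v 0 = 0" "field_eval u v 1 = 1" "field_eval u v (plane_const c) = c"
  "field_eval u v plane_u = u" "field_eval u v plane_v = v"
  "regular_at u v 0" "regular_at u v 1" "regular_at u v (plane_const c)"
  "regular_at u v plane_u" "regular_at u v plane_v"
  using field_eval_to_fract[of u v 0] field_eval_to_fract[of u v 1]
    regular_to_fract[of u v 0] regular_to_fract[of u v 1]
  by (simp_all add: plane_generators del: field_eval_to_fract regular_to_fract)
    (simp_all add: plane_generators)

lemma regular_hom:
  assumes "regular_at u v f" "regular_at u v g"
  shows "regular_at u v (f + g)" "regular_at u v (f * g)"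
    "field_eval u v (f + g) = field_eval u v f + field_eval u v g"
    "field_eval u v (f * g) = field_eval u v f * field_eval u v g"
proof -
  obtain a b where f: "f = to_fract a / to_fract b" and b: "bieval b u v \<noteq> 0"
    using assms(1) by (auto simp: regular_at_def)
  obtain x y where g: "g = to_fract x / to_fract y" and y: "bieval y u v \<noteq> 0"
    using assms(2) by (auto simp: regular_at_def)
  have nz: "b \<noteq> 0" "y \<noteq> 0" and yb: "bieval (b * y) u v \<noteq> 0" using b y by auto
  have sum: "f + g = to_fract (a * y + x * b) / to_fract (b * y)"
    and prod: "f * g = to_fract (a * x) / to_fract (b * y)"
    using f g nz by (simp_all add: field_simps)
  show "regular_at u v (f + g)" "regular_at u v (f * g)"
    unfolding sum prod by (rule regular_quotient[OF yb])+
  have fg: "field_eval u v f = bieval a u v / bieval b u v" "field_eval u v g = bieval x u v / bieval y u v"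
    by (simp_all only: f g field_eval_quotient[OF b] field_eval_quotient[OF y])
  have "field_eval u v (f + g) = bieval (a * y + x * b) u v / bieval (b * y) u v"
    unfolding sum by (rule field_eval_quotient[OF yb])
  then show "field_eval u v (f + g) = field_eval u v f + field_eval u v g"
    unfolding fg add_frac_eq[OF b y] bieval_simps .
  have "field_eval u v (f * g) = bieval (a * x) u v / bieval (b * y) u v"
    unfolding prod by (rule field_eval_quotient[OF yb])
  then show "field_eval u v (f * g) = field_eval u v f * field_eval u v g"
    unfolding fg times_divide_times_eq bieval_simps .
qed

lemma regular_inverse:
  assumes "regular_at u v f" "field_eval u v f \<noteq> 0"
  shows "regular_at u v (inverse f)" "field_eval u v (inverse f) = inverse (field_eval u v f)"
proof -
  obtain a b where f: "f = to_fract a / to_fract b" and b: "bieval b u v \<noteq> 0"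
    using assms(1) by (auto simp: regular_at_def)
  then have a: "bieval a u v \<noteq> 0" using assms(2) by (simp add: field_eval_quotient)
  have inv: "inverse f = to_fract b / to_fract a" using f by simp
  show "regular_at u v (inverse f)" unfolding inv by (rule regular_quotient[OF a])
  show "field_eval u v (inverse f) = inverse (field_eval u v f)"
    using field_eval_quotient[OF a, of b] field_eval_quotient[OF b, of a] by (simp add: inv f)
qed

lemma regular_powi:
  assumes "regular_at u v f" "field_eval u v f \<noteq> 0"
  shows "regular_at u v (f powi k)" "field_eval u v (f powi k) = field_eval u v f powi k"
proof -
  have pow: "regular_at u v (g ^ n) \<and> field_eval u v (g ^ n) = field_eval u v g ^ n" if "regular_at u v g" for g n
    using that by (induction n) (auto simp: regular_hom)
  show "regular_at u v (f powi k)" "field_eval u v (f powi k) = field_eval u v f powi k"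
    using pow[OF assms(1)] pow[OF regular_inverse(1)[OF assms]] regular_inverse(2)[OF assms]
    by (auto simp: power_int_def)
qed

section \<open>Polynomial functions on the threefold\<close>

lemma polyfun_power: "f \<in> polynomial_functions4 \<Longrightarrow> (\<lambda>p. f p ^ n) \<in> polynomial_functions4"
  using polynomial_functions4.const[of 1] polynomial_functions4.mult[of f]
  by (induction n) auto

lemma polyfun_monomial: "(\<lambda>(x, y, z, t). c * x ^ i * y ^ j * z ^ k * t ^ n) \<in> polynomial_functions4"
proof -
  have "(\<lambda>p. (\<lambda>p. (\<lambda>p. (\<lambda>p. (\<lambda>_. c) p * (\<lambda>(x, y, z, t). x) p ^ i) p * (\<lambda>(x, y, z, t). y) p ^ j) p
      * (\<lambda>(x, y, z, t). z) p ^ k) p * (\<lambda>(x, y, z, t). t) p ^ n) \<in> polynomial_functions4"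
    by (intro polynomial_functions4.mult polyfun_power polynomial_functions4.const
        polynomial_functions4.coord_x polynomial_functions4.coord_y
        polynomial_functions4.coord_z polynomial_functions4.coord_t)
  then show ?thesis by (simp add: case_prod_unfold)
qed

lemma polyfun_sum:
  "(\<And>i. i \<in> A \<Longrightarrow> f i \<in> polynomial_functions4) \<Longrightarrow> (\<lambda>p. \<Sum>i\<in>A. f i p) \<in> polynomial_functions4"
proof (induction A rule: infinite_finite_induct)
  case (insert i A)
  then have "(\<lambda>p. f i p + (\<lambda>p. \<Sum>i\<in>A. f i p) p) \<in> polynomial_functions4"
    by (intro polynomial_functions4.add) auto
  then show ?case using insert by simp
qed (use polynomial_functions4.const[of 0] in auto)

lemma polyfun_tendsto:
  assumes "f \<in> polynomial_functions4" and "xs \<longlonglongrightarrow> x" "ys \<longlonglongrightarrow> y" "zs \<longlonglongrightarrow> z" "ts \<longlonglongrightarrow> t"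
  shows "(\<lambda>n::nat. f (xs n, ys n, zs n, ts n)) \<longlonglongrightarrow> f (x, y, z, t)"
  using assms(1) by induction (auto intro!: tendsto_intros assms(2-))

text \<open>The \<open>k\<close>-th root of \<open>q\<close> closest to \<open>t\<^sub>0\<close>: the distances from \<open>t\<^sub>0\<close> to the \<open>k\<close> roots multiply
  to \<open>\<bar>t\<^sub>0\<^sup>k - q\<bar>\<close>.\<close>

lemma nearest_root:
  fixes q t0 :: complex
  assumes "0 < k"
  shows "\<exists>t. t ^ k = q \<and> norm (t - t0) ^ k \<le> norm (t0 ^ k - q)"
proof -
  define p where "p = Polynomial.monom 1 k + [:- q:]"
  have "degree p = k" unfolding p_def using assms
    by (subst degree_add_eq_left) (auto simp: Polynomial.degree_monom_eq)
  moreover have "poly.coeff p k = 1" using assms by (simp add: p_def coeff_pCons split: nat.splits)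
  ultimately obtain A where A: "size A = k" "p = (\<Prod>x\<in>#A. [:-x, 1:])"
    using alg_closed_imp_factorization[of p] assms by fastforce
  have poly_p: "poly p t = t ^ k - q" for t by (simp add: p_def poly_monom)
  have prod: "poly p t = (\<Prod>x\<in>#A. t - x)" for t
    unfolding A(2) by (induction A) (auto simp: algebra_simps)
  have "A \<noteq> {#}" using A(1) assms by auto
  define t where "t = arg_min_on (\<lambda>x. norm (t0 - x)) (set_mset A)"
  have t: "t \<in># A" "\<And>x. x \<in># A \<Longrightarrow> norm (t0 - t) \<le> norm (t0 - x)"
    unfolding t_def using \<open>A \<noteq> {#}\<close> arg_min_least[of "set_mset A" _ "\<lambda>x. norm (t0 - x)"]
    by (auto intro!: arg_min_if_finite(1))
  have "r ^ size B \<le> norm (\<Prod>x\<in>#B. t0 - x)"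
    if "0 \<le> r" "\<And>x. x \<in># B \<Longrightarrow> r \<le> norm (t0 - x)" for r B
    using that by (induction B) (auto simp: norm_mult intro!: mult_mono)
  from this[of "norm (t0 - t)" A] have "norm (t0 - t) ^ k \<le> norm (t0 ^ k - q)"
    using t A(1) prod[of t0] poly_p by simp
  moreover have "poly p t = 0" unfolding prod using t(1) by (auto simp: prod_mset_zero_iff)
  ultimately show ?thesis using poly_p[of t] by (auto simp: norm_minus_commute)
qed

lemma root_exists: "0 < k \<Longrightarrow> \<exists>t::complex. t ^ k = q"
  using nearest_root[of k q 0] by blast

section \<open>Graded pieces\<close>

lemma (in discrete_valuation) val_add_linear:
  "\<lbrakk>f \<noteq> 0; g \<noteq> 0; f + g \<noteq> 0; 0 \<le> c; 0 \<le> c * \<nu> f + e; 0 \<le> c * \<nu> g + e\<rbrakk> \<Longrightarrow> 0 \<le> c * \<nu> (f + g) + e"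
proof -
  assume *: "f \<noteq> 0" "g \<noteq> 0" "f + g \<noteq> 0" "0 \<le> c" "0 \<le> c * \<nu> f + e" "0 \<le> c * \<nu> g + e"
  have "min (\<nu> f) (\<nu> g) \<le> \<nu> (f + g)" using * by (intro val_add) auto
  then have "c * min (\<nu> f) (\<nu> g) \<le> c * \<nu> (f + g)" using * by (intro mult_left_mono)
  then show ?thesis using * by (auto simp: min_def split: if_splits)
qed

context koras_russell_data
begin

lemma piece_L: "g \<in> piece n \<Longrightarrow> g \<in> L"
  by (simp add: piece_def)

lemma piece_0: "0 \<in> piece n"
  using invariants_closed(5)[OF m_pos] by (simp add: piece_def)

lemma piece_add:
  assumes "f \<in> piece n" "g \<in> piece n"
  shows "f + g \<in> piece n"
proof (cases "f = 0 \<or> g = 0 \<or> f + g = 0")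
  case False
  then have nz: "f \<noteq> 0" "g \<noteq> 0" "f + g \<noteq> 0" by auto
  have "f + g \<in> L" using invariants_closed(3)[OF m_pos piece_L[OF assms(1)] piece_L[OF assms(2)]] .
  moreover have "0 \<le> curve_val q (f + g)" if q: "prime_elem q" "\<not> q dvd X_u" "\<not> q dvd T" for q
  proof -
    interpret V: discrete_valuation "curve_val q" by (rule discrete_valuation_curve[OF q(1)])
    show ?thesis using V.val_add_linear[OF nz, of 1 0] assms nz q by (auto simp: piece_def)
  qed
  ultimately show ?thesis
    using val_u.val_add_linear[OF nz, of "int \<alpha>\<^sub>2" "a * n"] val_T.val_add_linear[OF nz, of "int \<alpha>\<^sub>3" "b * n"]
      exc.val_add_linear[OF nz, of 1 0] assms nz by (simp add: piece_def)
qed (use assms piece_0 in auto)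

lemma piece_mult:
  assumes "f \<in> piece n" "g \<in> piece k"
  shows "f * g \<in> piece (n + k)"
proof (cases "f = 0 \<or> g = 0")
  case False
  then have nz: "f \<noteq> 0" "g \<noteq> 0" by auto
  have "f * g \<in> L" by (rule L_mult[OF piece_L[OF assms(1)] piece_L[OF assms(2)]])
  moreover have "0 \<le> curve_val q (f * g)" if q: "prime_elem q" "\<not> q dvd X_u" "\<not> q dvd T" for q
  proof -
    interpret V: discrete_valuation "curve_val q" by (rule discrete_valuation_curve[OF q(1)])
    show ?thesis using V.val_mult[OF nz] assms nz q by (auto simp: piece_def)
  qed
  moreover have "0 \<le> int \<alpha>\<^sub>2 * curve_val X_u (f * g) + a * (n + k)"
    using assms nz by (simp add: piece_def val_u.val_mult algebra_simps)
  moreover have "0 \<le> int \<alpha>\<^sub>3 * curve_val T (f * g) + b * (n + k)"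
    using assms nz by (simp add: piece_def val_T.val_mult algebra_simps)
  ultimately show ?thesis
    using assms nz by (simp add: piece_def exc.val_mult)
qed (auto simp: piece_0)

lemma piece_const: "plane_const c \<in> piece 0"
proof (cases "c = 0")
  case False
  then have "const2 c * const2 (inverse c) = 1" by (simp flip: const2_hom(4))
  then have unit: "is_unit (const2 c)" and nz: "const2 c \<noteq> 0" by (auto simp: dvd_def)
  then have "curve_val q (plane_const c) = 0" if "prime_elem q" for q
    using that by (simp add: plane_generators curve_val_to_fract multiplicity_unit_right)
  moreover have "exc_val d (plane_const c) = 0"
    using nz False by (simp add: plane_generators exc_val_to_fract exc_weight_0_if)
  ultimately show ?thesis
    using invariants_closed(6)[OF m_pos] prime_X_u prime_curve_eq by (simp add: piece_def)
next
  case True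
  then have "plane_const c = 0" by (simp add: plane_generators)
  then show ?thesis by (simp add: piece_0)
qed

lemma piece_smult: "f \<in> piece n \<Longrightarrow> plane_const c * f \<in> piece n"
  using piece_mult[OF piece_const] by simp

lemma piece_diff: "\<lbrakk>f \<in> piece n; g \<in> piece n\<rbrakk> \<Longrightarrow> f - g \<in> piece n"
  using piece_add[OF _ piece_smult[of g n "-1"], of f]
  by (simp add: plane_generators const2_uminus)

lemma laurent_in_piece:
  assumes "int d * i + j + int k = int m * r" "0 \<le> r" "0 \<le> int \<alpha>\<^sub>2 * i + a * n" "0 \<le> int \<alpha>\<^sub>3 * j + b * n"
  shows "laurent i j k \<in> piece n"
  using assms laurent_invariant[OF assms(1)] curve_val_other(3) by (simp add: piece_def laurent_values)

lemma bieval_W: "field_eval u v W = - bieval T u v" "regular_at u v W"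
proof -
  show "field_eval u v W = - bieval T u v" "regular_at u v W"
    using regular_to_fract[of u v "- T"] field_eval_to_fract[of u v "- T"] by (simp_all add: W_def)
qed

lemma piece_form:
  assumes "g \<in> piece n" "g \<noteq> 0"
  obtains i j h where "h \<noteq> 0" "g = laurent i j 0 * to_fract h"
    "0 \<le> int \<alpha>\<^sub>2 * i + a * n" "0 \<le> int \<alpha>\<^sub>3 * j + b * n" "0 \<le> int d * i + j + int (exc_weight d h)"
proof -
  obtain h where h: "h \<noteq> 0" "g = laurent (curve_val X_u g) (curve_val T g) 0 * to_fract h"
    using decomposition[OF assms(2)] assms by (auto simp: piece_def laurent_def)
  have "exc_val d g = int d * curve_val X_u g + curve_val T g + int (exc_weight d h)"
    by (subst h(2)) (use h(1) in \<open>simp add: exc.val_mult laurent_values exc_val_to_fract\<close>)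
  then show ?thesis using that[OF h] assms by (auto simp: piece_def)
qed

lemma laurent_eval:
  assumes "u \<noteq> 0" "bieval T u v \<noteq> 0"
  shows "regular_at u v (laurent i j k)"
    "field_eval u v (laurent i j k) = u powi i * (- bieval T u v) powi j * v ^ k"
proof -
  have v: "regular_at u v (plane_v ^ k)" "field_eval u v (plane_v ^ k) = v ^ k"
    by (induction k) (auto simp: regular_hom)
  have "field_eval u v plane_u \<noteq> 0" "field_eval u v W \<noteq> 0"
    using assms by (simp_all add: bieval_W(1))
  note u = regular_powi[OF field_eval_consts(9) this(1), of i] and W = regular_powi[OF bieval_W(2) this(2), of j]
  note uW = regular_hom[OF u(1) W(1)]
  show "regular_at u v (laurent i j k)"
    "field_eval u v (laurent i j k) = u powi i * (- bieval T u v) powi j * v ^ k"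
    unfolding laurent_def regular_hom(4)[OF uW(2) v(1)] uW(4) u(2) W(2) v(2) bieval_W(1) field_eval_consts
    by (rule regular_hom(2)[OF uW(2) v(1)], rule refl)
qed

lemma piece_regular:
  assumes "u \<noteq> 0" "bieval T u v \<noteq> 0" "g \<in> piece n"
  shows "regular_at u v g"
proof (cases "g = 0")
  case False
  obtain i j h where "g = laurent i j 0 * to_fract h"
    by (rule piece_form[OF assms(3) False])
  then show ?thesis using laurent_eval(1)[OF assms(1,2)] by (simp add: regular_hom)
qed simp

lemma piece_eval_0_imp:
  assumes g: "g \<in> piece n" and zero: "\<And>u v. \<lbrakk>u \<noteq> 0; bieval T u v \<noteq> 0\<rbrakk> \<Longrightarrow> field_eval u v g = 0"
  shows "g = 0"
proof (rule ccontr)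
  assume "g \<noteq> 0"
  then obtain i j h where h: "h \<noteq> 0" "g = laurent i j 0 * to_fract h"
    by (rule piece_form[OF g])
  have "bieval (h * X_u * T) u v = 0" for u v
  proof (cases "u = 0 \<or> bieval T u v = 0")
    case False
    then have "field_eval u v g = u powi i * (- bieval T u v) powi j * bieval h u v"
      unfolding h(2) by (subst regular_hom) (auto simp: laurent_eval)
    then show ?thesis using zero[of u v] False by auto
  qed auto
  then have "h * X_u * T = 0" by (rule bieval_eq_0_imp)
  then show False using h(1) prime_X_u prime_curve_eq[of d l] by auto
qed

section \<open>Comparing functions on the threefold with sections\<close>

definition section_ring :: "(int \<Rightarrow>\<^sub>0 plane_field) set" where
  "section_ring = {F. \<forall>n. Poly_Mapping.lookup F n \<in> piece n}"

definition laurent_value :: "(int \<Rightarrow>\<^sub>0 plane_field) \<Rightarrow> complex \<Rightarrow> complex \<Rightarrow> complex \<Rightarrow> complex" where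
  "laurent_value F u v s = (\<Sum>n\<in>Poly_Mapping.keys F. field_eval u v (Poly_Mapping.lookup F n) * s powi n)"

lemma laurent_value_superset:
  "\<lbrakk>finite A; Poly_Mapping.keys F \<subseteq> A\<rbrakk> \<Longrightarrow>
    laurent_value F u v s = (\<Sum>n\<in>A. field_eval u v (Poly_Mapping.lookup F n) * s powi n)"
  unfolding laurent_value_def by (rule sum.mono_neutral_left) (auto simp: in_keys_iff)

lemma laurent_value_single [simp]:
  "laurent_value (Poly_Mapping.single n g) u v s = field_eval u v g * s powi n"
  by (subst laurent_value_superset[of "{n}"]) auto

lemma laurent_value_0 [simp]: "laurent_value 0 u v s = 0"
  by (simp add: laurent_value_def)

lemma section_ring_0: "0 \<in> section_ring"
  by (simp add: section_ring_def piece_0)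

lemma section_ring_single: "g \<in> piece n \<Longrightarrow> Poly_Mapping.single n g \<in> section_ring"
  by (auto simp: section_ring_def lookup_single when_def piece_0)

lemma section_ring_add: "\<lbrakk>F \<in> section_ring; G \<in> section_ring\<rbrakk> \<Longrightarrow> F + G \<in> section_ring"
  by (simp add: section_ring_def lookup_add piece_add)

lemma section_ring_diff: "\<lbrakk>F \<in> section_ring; G \<in> section_ring\<rbrakk> \<Longrightarrow> F - G \<in> section_ring"
  by (simp add: section_ring_def lookup_minus piece_diff)

lemma section_ring_sum: "(\<And>i. i \<in> A \<Longrightarrow> F i \<in> section_ring) \<Longrightarrow> sum F A \<in> section_ring"
  by (induction A rule: infinite_finite_induct) (auto simp: section_ring_0 section_ring_add)

lemma laurent_value_add:
  assumes uv: "u \<noteq> 0" "bieval T u v \<noteq> 0" and "F \<in> section_ring" "G \<in> section_ring"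
  shows "laurent_value (F + G) u v s = laurent_value F u v s + laurent_value G u v s"
proof -
  let ?A = "Poly_Mapping.keys F \<union> Poly_Mapping.keys G"
  have "Poly_Mapping.keys (F + G) \<subseteq> ?A" by (rule keys_add)
  moreover have "regular_at u v (Poly_Mapping.lookup F n)" "regular_at u v (Poly_Mapping.lookup G n)" for n
    using assms piece_regular[OF uv] by (auto simp: section_ring_def)
  ultimately show ?thesis
    by (simp add: laurent_value_superset[of ?A] lookup_add regular_hom distrib_right sum.distrib)
qed

lemma laurent_value_sum:
  assumes uv: "u \<noteq> 0" "bieval T u v \<noteq> 0" and "\<And>i. i \<in> A \<Longrightarrow> F i \<in> section_ring"
  shows "laurent_value (sum F A) u v s = (\<Sum>i\<in>A. laurent_value (F i) u v s)"
  using assms(3)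
  by (induction A rule: infinite_finite_induct)
    (auto simp: laurent_value_add[OF uv] section_ring_sum)

lemma sum_singles:
  fixes F :: "int \<Rightarrow>\<^sub>0 plane_field"
  shows "(\<Sum>n\<in>Poly_Mapping.keys F. Poly_Mapping.single n (Poly_Mapping.lookup F n)) = F"
proof (rule poly_mapping_eqI)
  fix k
  show "Poly_Mapping.lookup (\<Sum>n\<in>Poly_Mapping.keys F. Poly_Mapping.single n (Poly_Mapping.lookup F n)) k
      = Poly_Mapping.lookup F k"
    by (simp add: lookup_sum lookup_single when_def in_keys_iff)
qed

lemma mult_sum_singles:
  fixes F G :: "int \<Rightarrow>\<^sub>0 plane_field"
  shows "F * G = (\<Sum>n\<in>Poly_Mapping.keys F. \<Sum>k\<in>Poly_Mapping.keys G.
    Poly_Mapping.single (n + k) (Poly_Mapping.lookup F n * Poly_Mapping.lookup G k))"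
  by (subst sum_singles[of F, symmetric], subst sum_singles[of G, symmetric])
    (simp add: sum_product mult_single)

lemma section_ring_mult:
  assumes "F \<in> section_ring" "G \<in> section_ring"
  shows "F * G \<in> section_ring"
  unfolding mult_sum_singles
  by (intro section_ring_sum section_ring_single piece_mult) (use assms in \<open>auto simp: section_ring_def\<close>)

lemma laurent_value_mult:
  assumes uv: "u \<noteq> 0" "bieval T u v \<noteq> 0" and s: "s \<noteq> 0" and F: "F \<in> section_ring" and G: "G \<in> section_ring"
  shows "laurent_value (F * G) u v s = laurent_value F u v s * laurent_value G u v s"
proof -
  have piece: "Poly_Mapping.lookup F n \<in> piece n" "Poly_Mapping.lookup G n \<in> piece n" for n
    using F G by (auto simp: section_ring_def)
  note reg = piece_regular[OF uv piece(1)] piece_regular[OF uv piece(2)]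
  have mem: "Poly_Mapping.single (n + k) (Poly_Mapping.lookup F n * Poly_Mapping.lookup G k) \<in> section_ring" for n k
    by (intro section_ring_single piece_mult piece)
  show ?thesis
    unfolding mult_sum_singles
    by (simp add: laurent_value_sum[OF uv] section_ring_sum mem regular_hom[OF reg] power_int_add s)
      (simp add: laurent_value_def sum_product mult_ac)
qed

text \<open>A point of the threefold with \<open>yzt \<noteq> 0\<close>, written through \<open>\<eta>\<close> with \<open>\<eta>\<^sup>m = y\<close>, lies over the
  point \<open>(u', v')\<close> of the plane with \<open>u' = z\<^sup>\<alpha>\<^sup>2 \<eta>\<^sup>d\<close> and \<open>v' = x \<eta>\<close>; the section \<open>z\<^sup>a t\<^sup>b\<close> has degree
  one.\<close>

definition over :: "complex \<Rightarrow> complex \<Rightarrow> complex \<Rightarrow> complex \<Rightarrow> complex \<Rightarrow> bool" where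
  "over u v \<eta> z t \<longleftrightarrow> \<eta> \<noteq> 0 \<and> u \<noteq> 0 \<and> bieval T u v \<noteq> 0 \<and> z ^ \<alpha>\<^sub>2 * \<eta> ^ d = u \<and> t ^ \<alpha>\<^sub>3 * \<eta> = - bieval T u v"

definition represents :: "(point4 \<Rightarrow> complex) \<Rightarrow> (int \<Rightarrow>\<^sub>0 plane_field) \<Rightarrow> bool" where
  "represents f F \<longleftrightarrow> F \<in> section_ring \<and>
     (\<forall>u v \<eta> z t. over u v \<eta> z t \<longrightarrow> f (v / \<eta>, \<eta> ^ m, z, t) = laurent_value F u v (z powi a * t powi b))"

lemma over_nonzero: "over u v \<eta> z t \<Longrightarrow> z \<noteq> 0 \<and> t \<noteq> 0"
  using \<alpha>_pos by (auto simp: over_def power_0_left)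

lemma represents_add: "\<lbrakk>represents f F; represents g G\<rbrakk> \<Longrightarrow> represents (\<lambda>p. f p + g p) (F + G)"
  unfolding represents_def by (auto simp: section_ring_add laurent_value_add over_def)

lemma represents_mult:
  assumes "represents f F" "represents g G"
  shows "represents (\<lambda>p. f p * g p) (F * G)"
proof -
  have "laurent_value (F * G) u v (z powi a * t powi b) =
      laurent_value F u v (z powi a * t powi b) * laurent_value G u v (z powi a * t powi b)"
    if "over u v \<eta> z t" for u v \<eta> z t
    using that over_nonzero[OF that] assms
    by (intro laurent_value_mult) (auto simp: over_def represents_def)
  then show ?thesis using assms unfolding represents_def by (auto simp: section_ring_mult)
qed

lemma represents_sum:
  "(\<And>i. i \<in> A \<Longrightarrow> represents (f i) (F i)) \<Longrightarrow> represents (\<lambda>p. \<Sum>i\<in>A. f i p) (sum F A)"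
proof (induction A rule: infinite_finite_induct)
  case (insert i A)
  then show ?case using represents_add[of "f i" "F i" "\<lambda>p. \<Sum>i\<in>A. f i p" "sum F A"] by simp
qed (auto simp: represents_def section_ring_0)

text \<open>Substituting \<open>u' = z\<^sup>\<alpha>\<^sup>2 \<eta>\<^sup>d\<close> and \<open>- T = t\<^sup>\<alpha>\<^sup>3 \<eta>\<close> turns the orders at \<open>D\<^sub>3\<close>, \<open>D\<^sub>2\<close> and \<open>E\<close> into the
  exponents of \<open>z\<close>, \<open>t\<close> and \<open>\<eta>\<close>.\<close>

lemma laurent_at_point:
  assumes "over u v \<eta> z t"
  shows "field_eval u v (laurent i j k) * (z powi a * t powi b) powi n =
    z powi (int \<alpha>\<^sub>2 * i + a * n) * t powi (int \<alpha>\<^sub>3 * j + b * n) * \<eta> powi (int d * i + j) * v ^ k"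
proof -
  have nz: "\<eta> \<noteq> 0" "z \<noteq> 0" "t \<noteq> 0" using assms over_nonzero[OF assms] by (auto simp: over_def)
  have u: "u = z powi int \<alpha>\<^sub>2 * \<eta> powi int d" and W: "- bieval T u v = t powi int \<alpha>\<^sub>3 * \<eta>"
    using assms by (auto simp: over_def)
  have "field_eval u v (laurent i j k) = u powi i * (- bieval T u v) powi j * v ^ k"
    using assms by (intro laurent_eval) (auto simp: over_def)
  also have "u powi i = z powi (int \<alpha>\<^sub>2 * i) * \<eta> powi (int d * i)"
    by (subst u) (simp only: power_int_mult_distrib power_int_mult)
  also have "(- bieval T u v) powi j = t powi (int \<alpha>\<^sub>3 * j) * \<eta> powi j"
    by (subst W) (simp only: power_int_mult_distrib power_int_mult)
  finally show ?thesis
    using nz by (simp add: power_int_mult_distrib power_int_add flip: power_int_mult)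
qed

lemma represents_const: "represents (\<lambda>_. c) (Poly_Mapping.single 0 (plane_const c))"
  unfolding represents_def by (auto simp: section_ring_single piece_const)

lemma represents_laurent:
  assumes "int d * i + j + int k = int m * r" "0 \<le> r" "0 \<le> int \<alpha>\<^sub>2 * i + a * n" "0 \<le> int \<alpha>\<^sub>3 * j + b * n"
    and "\<And>x y z t \<eta>. \<lbrakk>y = \<eta> ^ m; \<eta> \<noteq> 0\<rbrakk> \<Longrightarrow> f (x, y, z, t) =
      z powi (int \<alpha>\<^sub>2 * i + a * n) * t powi (int \<alpha>\<^sub>3 * j + b * n) * \<eta> powi (int d * i + j) * (x * \<eta>) ^ k"
  shows "represents f (Poly_Mapping.single n (laurent i j k))"
  unfolding represents_def
proof (intro conjI allI impI)
  show "Poly_Mapping.single n (laurent i j k) \<in> section_ring"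
    by (intro section_ring_single laurent_in_piece[OF assms(1-4)])
  fix u v \<eta> z t assume o: "over u v \<eta> z t"
  then show "f (v / \<eta>, \<eta> ^ m, z, t) =
      laurent_value (Poly_Mapping.single n (laurent i j k)) u v (z powi a * t powi b)"
    using laurent_at_point[OF o] assms(5)[of "\<eta> ^ m" \<eta>] by (simp add: over_def)
qed

text \<open>The exponents are found by solving the exponent formulas above for \<open>x = v'/\<eta>\<close>, \<open>y = \<eta>\<^sup>m\<close>, \<open>z\<close> and
  \<open>t\<close>.\<close>

lemma represents_coords:
  "represents (\<lambda>(x, y, z, t). x) (Poly_Mapping.single (int \<alpha>\<^sub>2 * int \<alpha>\<^sub>3) (laurent (- a * int \<alpha>\<^sub>3) (- b * int \<alpha>\<^sub>2) 1))"
  "represents (\<lambda>(x, y, z, t). y) (Poly_Mapping.single (- int m * int \<alpha>\<^sub>2 * int \<alpha>\<^sub>3)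
     (laurent (a * int \<alpha>\<^sub>3 * int m) (b * int \<alpha>\<^sub>2 * int m) 0))"
  "represents (\<lambda>(x, y, z, t). z) (Poly_Mapping.single (int d * int \<alpha>\<^sub>3) (laurent b (- (int d * b)) 0))"
  "represents (\<lambda>(x, y, z, t). t) (Poly_Mapping.single (int \<alpha>\<^sub>2) (laurent (- a) (int d * a) 0))"
proof -
  have bz: "int d * (a * int \<alpha>\<^sub>3) = 1 - b * int \<alpha>\<^sub>2" using bezout by (simp add: mult_ac)
  have x: "int d * (- a * int \<alpha>\<^sub>3) + (- b * int \<alpha>\<^sub>2) = - 1" using bz by (simp add: algebra_simps)
  have y: "int d * (a * int \<alpha>\<^sub>3 * int m) + b * int \<alpha>\<^sub>2 * int m = int m"
    using arg_cong[OF bz, of "\<lambda>k. k * int m"] by (simp add: algebra_simps)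
  have z: "int \<alpha>\<^sub>2 * b + a * (int d * int \<alpha>\<^sub>3) = 1" and t: "int \<alpha>\<^sub>3 * (int d * a) + b * int \<alpha>\<^sub>2 = 1"
    using bz by (simp_all add: mult_ac)
  show "represents (\<lambda>(x, y, z, t). x) (Poly_Mapping.single (int \<alpha>\<^sub>2 * int \<alpha>\<^sub>3) (laurent (- a * int \<alpha>\<^sub>3) (- b * int \<alpha>\<^sub>2) 1))"
    by (rule represents_laurent[where r = 0], unfold x) (simp_all add: power_int_minus)
  show "represents (\<lambda>(x, y, z, t). y) (Poly_Mapping.single (- int m * int \<alpha>\<^sub>2 * int \<alpha>\<^sub>3)
      (laurent (a * int \<alpha>\<^sub>3 * int m) (b * int \<alpha>\<^sub>2 * int m) 0))"
    by (rule represents_laurent[where r = 1], unfold y) (simp_all add: mult_ac)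
  show "represents (\<lambda>(x, y, z, t). z) (Poly_Mapping.single (int d * int \<alpha>\<^sub>3) (laurent b (- (int d * b)) 0))"
    by (rule represents_laurent[where r = 0], unfold z) (simp_all add: mult_ac)
  show "represents (\<lambda>(x, y, z, t). t) (Poly_Mapping.single (int \<alpha>\<^sub>2) (laurent (- a) (int d * a) 0))"
    by (rule represents_laurent[where r = 0], unfold t) (simp_all add: mult_ac)
qed

lemma polyfun_represents: "f \<in> polynomial_functions4 \<Longrightarrow> \<exists>F. represents f F"
  by (induction rule: polynomial_functions4.induct)
    (use represents_const represents_coords represents_add represents_mult in blast)+

end

text \<open>After multiplication by a power of \<open>s\<close> this is a polynomial with infinitely many zeros.\<close>

lemma laurent_sum_eq_0:
  fixes c :: "int \<Rightarrow> complex"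
  assumes "finite A" "\<And>s. s \<noteq> 0 \<Longrightarrow> (\<Sum>n\<in>A. c n * s powi n) = 0" "n \<in> A"
  shows "c n = 0"
proof -
  define N where "N = Max ((\<lambda>n. nat (- n)) ` A)"
  have N: "0 \<le> n + int N" if "n \<in> A" for n
  proof -
    have "nat (- n) \<le> N" unfolding N_def using assms(1) that by (intro Max_ge) auto
    then show ?thesis by linarith
  qed
  define p where "p = (\<Sum>n\<in>A. Polynomial.monom (c n) (nat (n + int N)))"
  have "poly p s = 0" if "s \<noteq> 0" for s
  proof -
    have "poly p s = (\<Sum>n\<in>A. c n * s powi (n + int N))"
      unfolding p_def poly_sum poly_monom
      by (intro sum.cong refl) (use N in \<open>auto simp: power_int_def\<close>)
    also have "\<dots> = s powi int N * (\<Sum>n\<in>A. c n * s powi n)"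
      using that by (simp add: power_int_add sum_distrib_left mult_ac)
    finally show ?thesis using assms(2) that by simp
  qed
  then have "UNIV - {0} \<subseteq> {s. poly p s = 0}" by auto
  moreover have "infinite (UNIV - {0::complex})" using infinite_UNIV_char_0 by simp
  ultimately have "p = 0" using poly_roots_finite finite_subset by blast
  moreover have "poly.coeff p (nat (n + int N)) = (\<Sum>k\<in>A. if n = k then c k else 0)"
    unfolding p_def coeff_sum
    by (intro sum.cong refl) (use N assms(3) in \<open>auto simp: nat_eq_iff2\<close>)
  ultimately show ?thesis using assms(1,3) by simp
qed

context koras_russell_data
begin

section \<open>The isomorphism\<close>

text \<open>The weight of every monomial of \<open>h\<close> is determined modulo \<open>m\<close> by the invariance of the
  section.\<close>

lemma monomial_weight:
  assumes g: "laurent i j 0 * to_fract h \<in> L" and pq: "bicoeff h p q \<noteq> 0"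
  shows "int m dvd int d * i + j + int (d * p + q)"
proof -
  obtain \<zeta> :: complex where \<zeta>: "\<zeta> ^ m = 1" "\<And>i j. \<zeta> ^ i = \<zeta> ^ j \<Longrightarrow> int m dvd int i - int j"
    using primitive_root_difference[OF m_pos] by blast
  have nz: "\<zeta> \<noteq> 0" using root_of_unity_nonzero \<zeta>(1) m_pos by blast
  \<comment> \<open>Replace the weight \<open>- (di + j)\<close> by a nonnegative exponent in the same class modulo \<open>m\<close>.\<close>
  define k where "k = nat ((- (int d * i + j)) mod int m)"
  have k: "int m dvd int d * i + j + int k"
  proof -
    have "int k = (- (int d * i + j)) mod int m" using m_pos by (simp add: k_def)
    then have "(int d * i + j + int k) mod int m = 0" by (simp add: mod_add_right_eq)
    then show ?thesis by auto
  qed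
  then obtain r where "int d * i + j + int k = int m * r" by (auto simp: dvd_def)
  then have "laurent i j k \<in> L" by (rule laurent_invariant)
  then have "laurent i j 0 * to_fract h / laurent i j k \<in> L" by (rule L_divide[OF g])
  moreover have "laurent i j 0 * to_fract h / laurent i j k = to_fract h / to_fract (X_v ^ k)"
    using prime_X_u prime_X_v by (auto simp: laurent_def plane_generators to_fract_power)
  ultimately have "to_fract h / to_fract (X_v ^ k) \<in> L" by simp
  then have "root_act_field d \<zeta> (to_fract h / to_fract (X_v ^ k)) = to_fract h / to_fract (X_v ^ k)"
    using \<zeta>(1) by (simp only: invariants_def mem_Collect_eq)
  moreover have v: "X_v ^ k \<noteq> 0" and rv: "root_act d \<zeta> (X_v ^ k) = const2 (\<zeta> ^ k) * X_v ^ k"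
    using prime_X_v by (auto simp: root_act_hom power_mult_distrib const2_power)
  ultimately have "root_act d \<zeta> h * X_v ^ k = h * (const2 (\<zeta> ^ k) * X_v ^ k)"
    using nz by (simp only: root_act_field_quotient quotient_eq_iff mult_eq_0_iff const2_hom(5)
        power_eq_0_iff root_act_eq_0_iff simp_thms)
  then have "root_act d \<zeta> h * X_v ^ k = const2 (\<zeta> ^ k) * h * X_v ^ k" by (simp only: mult_ac)
  then have "root_act d \<zeta> h = const2 (\<zeta> ^ k) * h" by (simp only: mult_right_cancel[OF v])
  then have "bicoeff (root_act d \<zeta> h) p q = bicoeff (const2 (\<zeta> ^ k) * h) p q" by simp
  then have "\<zeta> ^ (d * p + q) = \<zeta> ^ k" using pq by (simp add: bicoeff_root_act)
  then have "int m dvd int (d * p + q) - int k" by (rule \<zeta>(2))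
  then have "int m dvd (int d * i + j + int k) + (int (d * p + q) - int k)" by (rule dvd_add[OF k])
  then show ?thesis by (simp add: algebra_simps)
qed

text \<open>Each monomial \<open>u'\<^sup>p v'\<^sup>q\<close> of the polynomial part \<open>h\<close> gives a monomial in \<open>x, y, z, t\<close>: the exponents of
  \<open>z\<close> and \<open>t\<close> are nonnegative by the conditions at \<open>D\<^sub>3\<close> and \<open>D\<^sub>2\<close>, and the exponent of \<open>\<eta>\<close> is a
  nonnegative multiple of \<open>m\<close> by the condition at \<open>E\<close> and by invariance.\<close>

lemma represents_piece:
  assumes "g \<in> piece n"
  shows "\<exists>f\<in>polynomial_functions4. represents f (Poly_Mapping.single n g)"
proof (cases "g = 0")
  case True
  then show ?thesis
    by (intro bexI[of _ "\<lambda>_. 0"] polynomial_functions4.const) (simp add: represents_def section_ring_0)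
next
  case False
  obtain i j h where h: "h \<noteq> 0" "g = laurent i j 0 * to_fract h"
    and ij: "0 \<le> int \<alpha>\<^sub>2 * i + a * n" "0 \<le> int \<alpha>\<^sub>3 * j + b * n"
    and wt: "0 \<le> int d * i + j + int (exc_weight d h)"
    by (rule piece_form[OF assms False])
  define e1 where "e1 = nat (int \<alpha>\<^sub>2 * i + a * n)"
  define e2 where "e2 = nat (int \<alpha>\<^sub>3 * j + b * n)"
  define r where "r p q = nat ((int d * i + j + int (d * p + q)) div int m)" for p q
  have r: "int d * i + j + int (d * p + q) = int (m * r p q)" if pq: "(p, q) \<in> monomials h" for p q
  proof -
    have c: "bicoeff h p q \<noteq> 0" using pq by (simp add: monomials_def)
    have "exc_weight d h \<le> d * p + q" using exc_weight_ge_iff[OF h(1), of "exc_weight d h" d] c by blast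
    then have "0 \<le> int d * i + j + int (d * p + q)" using wt by linarith
    moreover have "int m dvd int d * i + j + int (d * p + q)"
      using monomial_weight[OF _ c] piece_L[OF assms] h(2) by simp
    ultimately show ?thesis using m_pos by (simp add: r_def pos_imp_zdiv_nonneg_iff)
  qed
  define F where "F = (\<lambda>P :: point4. \<Sum>pq\<in>monomials h.
    (\<lambda>(x, y, z, t). bicoeff h (fst pq) (snd pq) * x ^ snd pq * y ^ r (fst pq) (snd pq) *
      z ^ (e1 + \<alpha>\<^sub>2 * fst pq) * t ^ e2) P)"
  have "F \<in> polynomial_functions4"
    unfolding F_def by (intro polyfun_sum polyfun_monomial)
  moreover have "represents F (Poly_Mapping.single n g)"
    unfolding represents_def
  proof (intro conjI allI impI)
    show "Poly_Mapping.single n g \<in> section_ring" by (rule section_ring_single[OF assms])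
    fix u v \<eta> z t assume o: "over u v \<eta> z t"
    then have nz: "\<eta> \<noteq> 0" and u: "u = z ^ \<alpha>\<^sub>2 * \<eta> ^ d" and uT: "u \<noteq> 0" "bieval T u v \<noteq> 0"
      by (auto simp: over_def)
    have eta: "\<eta> powi (int d * i + j) * (\<eta> ^ (d * p) * v ^ q) = (v / \<eta>) ^ q * (\<eta> ^ m) ^ r p q"
      if "(p, q) \<in> monomials h" for p q
    proof -
      have "\<eta> powi (int d * i + j) * \<eta> ^ (d * p) * \<eta> ^ q = \<eta> powi (int d * i + j + int (d * p + q))"
        using nz by (simp add: power_int_add power_add flip: power_int_of_nat)
      also have "\<dots> = (\<eta> ^ m) ^ r p q" unfolding r[OF that] by (simp only: power_int_of_nat power_mult)
      finally show ?thesis using nz by (simp add: power_divide field_simps)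
    qed
    have "field_eval u v g = field_eval u v (laurent i j 0) * bieval h u v"
      unfolding h(2) by (subst regular_hom(4)[OF laurent_eval(1)[OF uT] regular_to_fract]) simp
    then have "laurent_value (Poly_Mapping.single n g) u v (z powi a * t powi b) =
        (field_eval u v (laurent i j 0) * (z powi a * t powi b) powi n) * bieval h u v"
      by simp
    also have "field_eval u v (laurent i j 0) * (z powi a * t powi b) powi n =
        z ^ e1 * t ^ e2 * \<eta> powi (int d * i + j)"
    proof -
      have "int \<alpha>\<^sub>2 * i + a * n = int e1" "int \<alpha>\<^sub>3 * j + b * n = int e2" using ij by (simp_all add: e1_def e2_def)
      then show ?thesis by (simp only: laurent_at_point[OF o] power_int_of_nat power_0 mult_1_right)
    qed
    also have "bieval h u v = (\<Sum>pq\<in>monomials h. bicoeff h (fst pq) (snd pq) * u ^ fst pq * v ^ snd pq)"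
      by (subst sum_monomials) (simp add: bieval_sum case_prod_unfold)
    also have "z ^ e1 * t ^ e2 * \<eta> powi (int d * i + j) * \<dots> = F (v / \<eta>, \<eta> ^ m, z, t)"
      unfolding F_def sum_distrib_left
    proof (rule sum.cong[OF refl])
      fix pq assume "pq \<in> monomials h"
      then obtain p q where pq: "pq = (p, q)" "(p, q) \<in> monomials h" by (cases pq) auto
      have "z ^ e1 * t ^ e2 * \<eta> powi (int d * i + j) * (bicoeff h p q * u ^ p * v ^ q) =
          bicoeff h p q * z ^ (e1 + \<alpha>\<^sub>2 * p) * t ^ e2 * (\<eta> powi (int d * i + j) * (\<eta> ^ (d * p) * v ^ q))"
        by (simp add: u power_mult_distrib power_add mult_ac flip: power_mult)
      then show "z ^ e1 * t ^ e2 * \<eta> powi (int d * i + j) * (bicoeff h (fst pq) (snd pq) * u ^ fst pq * v ^ snd pq) =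
          (\<lambda>(x, y, z, t). bicoeff h (fst pq) (snd pq) * x ^ snd pq * y ^ r (fst pq) (snd pq) *
            z ^ (e1 + \<alpha>\<^sub>2 * fst pq) * t ^ e2) (v / \<eta>, \<eta> ^ m, z, t)"
        unfolding eta[OF pq(2)] pq(1) by (simp add: mult_ac)
    qed
    finally show "F (v / \<eta>, \<eta> ^ m, z, t) = laurent_value (Poly_Mapping.single n g) u v (z powi a * t powi b)"
      by simp
  qed
  ultimately show ?thesis by blast
qed

lemma section_ring_represented:
  assumes "F \<in> section_ring"
  shows "\<exists>f\<in>polynomial_functions4. represents f F"
proof -
  have "\<forall>n. \<exists>f. f \<in> polynomial_functions4 \<and> represents f (Poly_Mapping.single n (Poly_Mapping.lookup F n))"
    using assms represents_piece by (simp add: section_ring_def) blast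
  then obtain f where f: "\<And>n. f n \<in> polynomial_functions4"
    "\<And>n. represents (f n) (Poly_Mapping.single n (Poly_Mapping.lookup F n))" by metis
  have "represents (\<lambda>p. \<Sum>n\<in>Poly_Mapping.keys F. f n p) F"
    using represents_sum[of "Poly_Mapping.keys F" f "\<lambda>n. Poly_Mapping.single n (Poly_Mapping.lookup F n)"] f(2)
    by (simp add: sum_singles)
  then show ?thesis using polyfun_sum[of "Poly_Mapping.keys F" f] f(1) by blast
qed

text \<open>The points over a given \<open>(u', v')\<close> form a \<open>\<complex>\<^sup>*\<close>-orbit on which \<open>z\<^sup>a t\<^sup>b\<close> takes every nonzero
  value, so a function determines the coefficients of the Laurent polynomial.\<close>

lemma over_exists:
  assumes "u \<noteq> 0" "bieval T u v \<noteq> 0" "s \<noteq> 0"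
  shows "\<exists>\<eta> z t. over u v \<eta> z t \<and> z powi a * t powi b = s"
proof -
  obtain z where z: "z ^ \<alpha>\<^sub>2 = u" using root_exists \<alpha>_pos by blast
  obtain t where t: "t ^ \<alpha>\<^sub>3 = - bieval T u v" using root_exists \<alpha>_pos by blast
  have nz: "z \<noteq> 0" "t \<noteq> 0" using z t assms \<alpha>_pos by (auto simp: power_0_left)
  define c where "c = s / (z powi a * t powi b)"
  have c: "c \<noteq> 0" using assms nz by (simp add: c_def)
  let ?z = "c ^ (d * \<alpha>\<^sub>3) * z" and ?t = "c ^ \<alpha>\<^sub>2 * t" and ?\<eta> = "inverse (c ^ (\<alpha>\<^sub>2 * \<alpha>\<^sub>3))"
  have "?z ^ \<alpha>\<^sub>2 * ?\<eta> ^ d = u" "?t ^ \<alpha>\<^sub>3 * ?\<eta> = - bieval T u v"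
    using c z t by (simp_all add: power_mult_distrib power_inverse field_simps flip: power_mult)
  then have "over u v ?\<eta> ?z ?t" using c assms by (simp add: over_def)
  moreover have "?z powi a * ?t powi b = c powi (int (d * \<alpha>\<^sub>3) * a + int \<alpha>\<^sub>2 * b) * (z powi a * t powi b)"
  proof -
    have "(c ^ k) powi e = c powi (int k * e)" for k e by (simp only: power_int_mult power_int_of_nat)
    then show ?thesis using c by (simp add: power_int_mult_distrib power_int_add)
  qed
  moreover have "int (d * \<alpha>\<^sub>3) * a + int \<alpha>\<^sub>2 * b = 1" using bezout by (simp add: mult_ac)
  ultimately have "over u v ?\<eta> ?z ?t \<and> ?z powi a * ?t powi b = s" using nz by (simp add: c_def)
  then show ?thesis by blast
qed

lemma represents_unique:
  assumes "represents f F" "represents f G"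
  shows "F = G"
proof -
  have mem: "F \<in> section_ring" "G \<in> section_ring" using assms by (auto simp: represents_def)
  define H where "H = F - G"
  have H: "H \<in> section_ring" using section_ring_diff mem by (simp add: H_def)
  have zero: "laurent_value H u v s = 0" if uv: "u \<noteq> 0" "bieval T u v \<noteq> 0" and s: "s \<noteq> 0" for u v s
  proof -
    obtain \<eta> z t where o: "over u v \<eta> z t" "z powi a * t powi b = s"
      using over_exists[OF uv s] by blast
    then have "laurent_value F u v s = laurent_value G u v s" using assms by (auto simp: represents_def)
    moreover have "laurent_value (H + G) u v s = laurent_value H u v s + laurent_value G u v s"
      by (rule laurent_value_add[OF uv H mem(2)])
    ultimately show ?thesis by (simp add: H_def)
  qed
  have "Poly_Mapping.lookup H n = 0" for n
  proof (cases "n \<in> Poly_Mapping.keys H")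
    case True
    show ?thesis
    proof (rule piece_eval_0_imp)
      show "Poly_Mapping.lookup H n \<in> piece n" using H by (simp add: section_ring_def)
      show "field_eval u v (Poly_Mapping.lookup H n) = 0" if "u \<noteq> 0" "bieval T u v \<noteq> 0" for u v
        using laurent_sum_eq_0[OF finite_keys _ True, of "\<lambda>n. field_eval u v (Poly_Mapping.lookup H n)"]
          zero[OF that] by (simp add: laurent_value_def)
    qed
  qed (simp add: in_keys_iff)
  then have "H = 0" by (intro poly_mapping_eqI) simp
  then show ?thesis by (simp add: H_def)
qed

abbreviation "threefold \<equiv> koras_russell d l \<alpha>\<^sub>2 \<alpha>\<^sub>3"

lemma bieval_T: "bieval T u v = v + (u + v ^ d) ^ l"
  by (simp add: curve_eq_def)

text \<open>The equation of the threefold, multiplied by \<open>\<eta>\<close>, using \<open>\<eta>\<^sup>m \<eta> = (\<eta>\<^sup>d)\<^sup>l\<close>.\<close>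

lemma over_point_iff:
  assumes "\<eta> \<noteq> 0"
  shows "(v / \<eta>, \<eta> ^ m, z, t) \<in> threefold \<longleftrightarrow> t ^ \<alpha>\<^sub>3 * \<eta> = - bieval T (z ^ \<alpha>\<^sub>2 * \<eta> ^ d) v"
proof -
  have dl: "\<eta> ^ m * \<eta> = (\<eta> ^ d) ^ l" by (simp only: power_Suc2[symmetric] dl_eq[symmetric] power_mult)
  define e where "e = v / \<eta> + \<eta> ^ m * ((v / \<eta>) ^ d + z ^ \<alpha>\<^sub>2) ^ l + t ^ \<alpha>\<^sub>3"
  have "e * \<eta> = v + (\<eta> ^ m * \<eta>) * ((v / \<eta>) ^ d + z ^ \<alpha>\<^sub>2) ^ l + t ^ \<alpha>\<^sub>3 * \<eta>"
    unfolding e_def distrib_right using assms by (simp add: mult_ac)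
  also have "(\<eta> ^ m * \<eta>) * ((v / \<eta>) ^ d + z ^ \<alpha>\<^sub>2) ^ l = (\<eta> ^ d * ((v / \<eta>) ^ d + z ^ \<alpha>\<^sub>2)) ^ l"
    by (simp only: dl power_mult_distrib)
  also have "\<eta> ^ d * ((v / \<eta>) ^ d + z ^ \<alpha>\<^sub>2) = z ^ \<alpha>\<^sub>2 * \<eta> ^ d + v ^ d"
    using assms by (simp add: distrib_left power_divide mult.commute)
  finally have e: "e * \<eta> = bieval T (z ^ \<alpha>\<^sub>2 * \<eta> ^ d) v + t ^ \<alpha>\<^sub>3 * \<eta>"
    by (simp add: bieval_T)
  have "(v / \<eta>, \<eta> ^ m, z, t) \<in> threefold \<longleftrightarrow> e * \<eta> = 0"
    using assms by (simp add: koras_russell_def e_def)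
  also have "\<dots> \<longleftrightarrow> t ^ \<alpha>\<^sub>3 * \<eta> = - bieval T (z ^ \<alpha>\<^sub>2 * \<eta> ^ d) v"
    unfolding e by (simp only: eq_neg_iff_add_eq_0 add.commute)
  finally show ?thesis .
qed

lemma over_point: "over u v \<eta> z t \<Longrightarrow> (v / \<eta>, \<eta> ^ m, z, t) \<in> threefold"
  by (simp add: over_point_iff over_def)

text \<open>Perturb \<open>y\<close> and \<open>z\<close> away from zero, then \<open>x\<close> away from the finitely many values that force \<open>t = 0\<close>,
  and solve the equation for the \<open>t\<close> closest to \<open>t\<^sub>0\<close>.\<close>

lemma over_dense:
  assumes P: "(x0, y0, z0, t0) \<in> threefold"
  obtains xs ys zs ts where "xs \<longlonglongrightarrow> x0" "ys \<longlonglongrightarrow> y0" "zs \<longlonglongrightarrow> z0" "ts \<longlonglongrightarrow> t0"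
    "\<And>n::nat. (xs n, ys n, zs n, ts n) \<in> threefold \<and> ys n \<noteq> 0 \<and> zs n \<noteq> 0 \<and> ts n \<noteq> 0"
proof -
  have perturb: "\<exists>cs. cs \<longlonglongrightarrow> c \<and> (\<forall>n::nat. cs n \<noteq> 0)" for c :: complex
  proof (cases "c = 0")
    case True
    have "(\<lambda>n::nat. 1 / of_nat (Suc n) :: complex) \<longlonglongrightarrow> 0"
      using LIMSEQ_Suc[OF lim_1_over_n] by simp
    then show ?thesis using True by (intro exI[of _ "\<lambda>n. 1 / of_nat (Suc n)"]) (auto simp del: of_nat_Suc)
  next
    case False
    then show ?thesis by (intro exI[of _ "\<lambda>_. c"]) auto
  qed
  obtain ys where ys: "ys \<longlonglongrightarrow> y0" "\<And>n. ys n \<noteq> 0" using perturb by blast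
  obtain zs where zs: "zs \<longlonglongrightarrow> z0" "\<And>n. zs n \<noteq> 0" using perturb by blast
  define q where "q x y z = - (x + y * (x ^ d + z ^ \<alpha>\<^sub>2) ^ l)" for x y z :: complex
  have "\<exists>x. norm (x - x0) \<le> 1 / real (Suc n) \<and> q x (ys n) (zs n) \<noteq> 0" for n
  proof -
    define p where "p = [:0, 1:] + Polynomial.smult (ys n) ((Polynomial.monom 1 d + [:zs n ^ \<alpha>\<^sub>2:]) ^ l)"
    have deg: "degree (Polynomial.monom 1 d + [:zs n ^ \<alpha>\<^sub>2:]) = d"
      using d_ge by (subst degree_add_eq_left) (auto simp: Polynomial.degree_monom_eq)
    then have "Polynomial.monom 1 d + [:zs n ^ \<alpha>\<^sub>2:] \<noteq> 0" using d_ge by fastforce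
    then have "degree (Polynomial.smult (ys n) ((Polynomial.monom 1 d + [:zs n ^ \<alpha>\<^sub>2:]) ^ l)) = d * l"
      using ys(2) by (simp add: degree_power_eq deg mult.commute)
    then have "degree p = d * l"
      unfolding p_def using dl_eq m_pos by (subst degree_add_eq_right) auto
    then have "p \<noteq> 0" using dl_eq by auto
    then have fin: "finite {x. poly p x = 0}" by (rule poly_roots_finite)
    have "inj (\<lambda>k::nat. x0 + 1 / of_nat (Suc (n + k)))" by (auto simp: inj_def simp del: of_nat_Suc)
    then have "infinite (range (\<lambda>k::nat. x0 + 1 / of_nat (Suc (n + k))))"
      by (rule range_inj_infinite)
    then have "\<not> range (\<lambda>k::nat. x0 + 1 / of_nat (Suc (n + k))) \<subseteq> {x. poly p x = 0}"
      using finite_subset fin by blast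
    then obtain k :: nat where k: "poly p (x0 + 1 / of_nat (Suc (n + k))) \<noteq> 0" by auto
    have "norm (1 / of_nat (Suc (n + k)) :: complex) \<le> 1 / real (Suc n)"
      by (simp add: norm_divide frac_le del: of_nat_Suc)
    moreover have "poly p x = - q x (ys n) (zs n)" for x
      by (simp add: p_def q_def poly_monom poly_power)
    ultimately show ?thesis using k by (intro exI[of _ "x0 + 1 / of_nat (Suc (n + k))"]) simp
  qed
  then obtain xs where xs: "\<And>n. norm (xs n - x0) \<le> 1 / real (Suc n)" "\<And>n. q (xs n) (ys n) (zs n) \<noteq> 0"
    by metis
  have xs_lim: "xs \<longlonglongrightarrow> x0"
  proof (rule LIM_zero_cancel, rule tendsto_norm_zero_cancel)
    have lim: "(\<lambda>n. 1 / real (Suc n)) \<longlonglongrightarrow> 0" using LIMSEQ_Suc[OF lim_1_over_n] by simp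
    show "(\<lambda>n. norm (xs n - x0)) \<longlonglongrightarrow> 0"
      by (rule tendsto_sandwich[OF _ _ tendsto_const lim]) (use xs(1) in auto)
  qed
  have "\<exists>t. t ^ \<alpha>\<^sub>3 = q (xs n) (ys n) (zs n) \<and> norm (t - t0) ^ \<alpha>\<^sub>3 \<le> norm (t0 ^ \<alpha>\<^sub>3 - q (xs n) (ys n) (zs n))" for n
    using nearest_root \<alpha>_pos by blast
  then obtain ts where ts: "\<And>n. ts n ^ \<alpha>\<^sub>3 = q (xs n) (ys n) (zs n)"
    "\<And>n. norm (ts n - t0) ^ \<alpha>\<^sub>3 \<le> norm (t0 ^ \<alpha>\<^sub>3 - q (xs n) (ys n) (zs n))" by metis
  have "(\<lambda>n. q (xs n) (ys n) (zs n)) \<longlonglongrightarrow> q x0 y0 z0"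
    unfolding q_def by (intro tendsto_intros xs_lim ys zs)
  moreover have q0: "q x0 y0 z0 = t0 ^ \<alpha>\<^sub>3"
  proof -
    have "x0 + y0 * (x0 ^ d + z0 ^ \<alpha>\<^sub>2) ^ l + t0 ^ \<alpha>\<^sub>3 = 0" using P by (simp add: koras_russell_def)
    then show ?thesis unfolding q_def by (metis add_eq_0_iff)
  qed
  ultimately have "(\<lambda>n. norm (t0 ^ \<alpha>\<^sub>3 - q (xs n) (ys n) (zs n))) \<longlonglongrightarrow> 0"
    by (auto intro!: tendsto_eq_intros)
  then have ts_pow: "(\<lambda>n. norm (ts n - t0) ^ \<alpha>\<^sub>3) \<longlonglongrightarrow> 0"
    by (rule tendsto_sandwich[OF _ _ tendsto_const, rotated 2]) (use ts(2) in auto)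
  have "ts \<longlonglongrightarrow> t0"
  proof (rule LIMSEQ_I)
    fix e :: real assume "0 < e"
    then have "0 < e ^ \<alpha>\<^sub>3" by simp
    then have "\<exists>N. \<forall>n\<ge>N. norm (norm (ts n - t0) ^ \<alpha>\<^sub>3 - 0) < e ^ \<alpha>\<^sub>3"
      by (rule LIMSEQ_D[OF ts_pow])
    then obtain N where N: "\<forall>n\<ge>N. norm (norm (ts n - t0) ^ \<alpha>\<^sub>3 - 0) < e ^ \<alpha>\<^sub>3" ..
    have "norm (ts n - t0) < e" if "N \<le> n" for n
    proof (rule power_less_imp_less_base)
      show "norm (ts n - t0) ^ \<alpha>\<^sub>3 < e ^ \<alpha>\<^sub>3" using N that by simp
    qed (use \<open>0 < e\<close> in simp)
    then show "\<exists>N. \<forall>n\<ge>N. norm (ts n - t0) < e" by (intro exI[of _ N]) simp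
  qed
  moreover have "(xs n, ys n, zs n, ts n) \<in> threefold \<and> ys n \<noteq> 0 \<and> zs n \<noteq> 0 \<and> ts n \<noteq> 0" for n
    using ts(1)[of n] xs(2)[of n] ys(2)[of n] zs(2)[of n] \<alpha>_pos
    by (auto simp: koras_russell_def q_def power_0_left)
  ultimately show ?thesis using that xs_lim ys(1) zs(1) by blast
qed

lemma polyfun_determined:
  assumes fg: "f \<in> polynomial_functions4" "g \<in> polynomial_functions4"
    and eq: "\<And>u v \<eta> z t. over u v \<eta> z t \<Longrightarrow> f (v / \<eta>, \<eta> ^ m, z, t) = g (v / \<eta>, \<eta> ^ m, z, t)"
    and p: "p \<in> threefold"
  shows "f p = g p"
proof -
  have open_part: "f (x, y, z, t) = g (x, y, z, t)"
    if xyzt: "(x, y, z, t) \<in> threefold" "y \<noteq> 0" "z \<noteq> 0" "t \<noteq> 0" for x y z t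
  proof -
    obtain \<eta> where \<eta>: "\<eta> ^ m = y" using root_exists m_pos by blast
    then have nz: "\<eta> \<noteq> 0" using xyzt(2) m_pos by (auto simp: power_0_left)
    define v where "v = x * \<eta>"
    have x: "x = v / \<eta>" using nz by (simp add: v_def)
    have W: "t ^ \<alpha>\<^sub>3 * \<eta> = - bieval T (z ^ \<alpha>\<^sub>2 * \<eta> ^ d) v"
      using xyzt(1) unfolding x \<eta>[symmetric] over_point_iff[OF nz] .
    moreover have "t ^ \<alpha>\<^sub>3 * \<eta> \<noteq> 0" using xyzt(4) nz by simp
    ultimately have "over (z ^ \<alpha>\<^sub>2 * \<eta> ^ d) v \<eta> z t" using nz xyzt(3) by (auto simp: over_def)
    then show ?thesis unfolding x \<eta>[symmetric] by (rule eq)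
  qed
  obtain x0 y0 z0 t0 where p0: "p = (x0, y0, z0, t0)" by (cases p)
  obtain xs ys zs ts where s: "xs \<longlonglongrightarrow> x0" "ys \<longlonglongrightarrow> y0" "zs \<longlonglongrightarrow> z0" "ts \<longlonglongrightarrow> t0"
    and mem: "\<And>n::nat. (xs n, ys n, zs n, ts n) \<in> threefold \<and> ys n \<noteq> 0 \<and> zs n \<noteq> 0 \<and> ts n \<noteq> 0"
    using over_dense p[unfolded p0] by metis
  have "(\<lambda>n. f (xs n, ys n, zs n, ts n)) \<longlonglongrightarrow> g p"
    using polyfun_tendsto[OF fg(2) s] open_part mem by (simp add: p0)
  then show ?thesis using polyfun_tendsto[OF fg(1) s] LIMSEQ_unique p0 by blast
qed

lemma represents_cong:
  assumes "\<And>p. p \<in> threefold \<Longrightarrow> f p = g p"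
  shows "represents f F \<longleftrightarrow> represents g F"
proof -
  have "f (v / \<eta>, \<eta> ^ m, z, t) = g (v / \<eta>, \<eta> ^ m, z, t)" if "over u v \<eta> z t" for u v \<eta> z t
    using assms over_point[OF that] by blast
  then show ?thesis unfolding represents_def by auto
qed

lemma represents_smult:
  assumes "represents f F"
  shows "represents (\<lambda>p. c * f p) (Poly_Mapping.map (\<lambda>g. plane_const c * g) F)"
proof -
  have "Poly_Mapping.map (\<lambda>g. plane_const c * g) F = Poly_Mapping.single 0 (plane_const c) * F"
  proof (rule poly_mapping_eqI)
    fix n
    have "Poly_Mapping.single 0 (plane_const c) * F =
        (\<Sum>n\<in>Poly_Mapping.keys F. Poly_Mapping.single n (plane_const c * Poly_Mapping.lookup F n))"
      by (subst sum_singles[of F, symmetric]) (simp add: sum_distrib_left mult_single)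
    then show "Poly_Mapping.lookup (Poly_Mapping.map (\<lambda>g. plane_const c * g) F) n =
        Poly_Mapping.lookup (Poly_Mapping.single 0 (plane_const c) * F) n"
      by (simp add: Poly_Mapping.map.rep_eq lookup_sum lookup_single when_def in_keys_iff)
  qed
  then show ?thesis using represents_mult[OF represents_const assms] by simp
qed

abbreviation "weight_action \<equiv> linear_cstar_action (int (\<alpha>\<^sub>2 * \<alpha>\<^sub>3)) (- int (m * \<alpha>\<^sub>2 * \<alpha>\<^sub>3)) (int (d * \<alpha>\<^sub>3)) (int \<alpha>\<^sub>2)"

text \<open>The torus moves a point within the fibre over \<open>(u', v')\<close>.\<close>

lemma over_act:
  assumes s: "s \<noteq> 0" and o: "over u v \<eta> z t"
  defines "\<eta>' \<equiv> inverse (s ^ (\<alpha>\<^sub>2 * \<alpha>\<^sub>3)) * \<eta>" and "z' \<equiv> s ^ (d * \<alpha>\<^sub>3) * z" and "t' \<equiv> s ^ \<alpha>\<^sub>2 * t"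
  shows "over u v \<eta>' z' t'" "(v / \<eta>', \<eta>' ^ m, z', t') = weight_action s (v / \<eta>, \<eta> ^ m, z, t)"
    "z' powi a * t' powi b = s * (z powi a * t powi b)"
proof -
  have nz: "\<eta> \<noteq> 0" using o by (simp add: over_def)
  have "z' ^ \<alpha>\<^sub>2 * \<eta>' ^ d = z ^ \<alpha>\<^sub>2 * \<eta> ^ d" "t' ^ \<alpha>\<^sub>3 * \<eta>' = t ^ \<alpha>\<^sub>3 * \<eta>"
    unfolding z'_def \<eta>'_def t'_def using s
    by (simp_all add: power_mult_distrib power_inverse field_simps flip: power_mult)
  moreover have "\<eta>' \<noteq> 0" using s nz by (simp add: \<eta>'_def)
  ultimately show "over u v \<eta>' z' t'" using o by (simp add: over_def)
  have neg: "s powi (- int k) = inverse (s ^ k)" for k by (simp add: power_int_minus)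
  have "\<eta>' ^ m = inverse (s ^ (m * \<alpha>\<^sub>2 * \<alpha>\<^sub>3)) * \<eta> ^ m"
    by (simp add: \<eta>'_def power_mult_distrib power_inverse mult_ac flip: power_mult)
  then show "(v / \<eta>', \<eta>' ^ m, z', t') = weight_action s (v / \<eta>, \<eta> ^ m, z, t)"
    unfolding linear_cstar_action_def prod.case prod.inject neg power_int_of_nat
    using s nz by (simp add: z'_def t'_def \<eta>'_def field_simps)
  have pow: "(s ^ k) powi e = s powi (int k * e)" for k e by (simp only: power_int_mult power_int_of_nat)
  have "z' powi a * t' powi b = s powi (int (d * \<alpha>\<^sub>3) * a + int \<alpha>\<^sub>2 * b) * (z powi a * t powi b)"
    unfolding z'_def t'_def using s by (simp add: power_int_mult_distrib power_int_add pow)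
  moreover have "int (d * \<alpha>\<^sub>3) * a + int \<alpha>\<^sub>2 * b = 1" using bezout by (simp add: mult_ac)
  ultimately show "z' powi a * t' powi b = s * (z powi a * t powi b)" by simp
qed

lemma represents_act:
  assumes s: "s \<noteq> 0" and f: "represents f F"
  shows "represents (\<lambda>p. f (weight_action s p))
    (Poly_Mapping.mapp (\<lambda>n g. plane_const (s powi n) * g) F)" (is "represents _ ?G")
proof -
  have lookup: "Poly_Mapping.lookup ?G n = plane_const (s powi n) * Poly_Mapping.lookup F n" for n
    by (simp add: mapp.rep_eq in_keys_iff)
  have F: "Poly_Mapping.lookup F n \<in> piece n" for n using f by (simp add: represents_def section_ring_def)
  have G: "?G \<in> section_ring" unfolding section_ring_def using F piece_smult by (simp add: lookup)
  show ?thesis unfolding represents_def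
  proof (intro conjI allI impI G)
    fix u v \<eta> z t assume o: "over u v \<eta> z t"
    then have uv: "u \<noteq> 0" "bieval T u v \<noteq> 0" by (auto simp: over_def)
    note act = over_act[OF s o]
    have "f (weight_action s (v / \<eta>, \<eta> ^ m, z, t)) = laurent_value F u v (s * (z powi a * t powi b))"
      unfolding act(2)[symmetric] act(3)[symmetric] using f act(1) unfolding represents_def by blast
    also have "\<dots> = (\<Sum>n\<in>Poly_Mapping.keys F.
        field_eval u v (Poly_Mapping.lookup ?G n) * (z powi a * t powi b) powi n)"
      unfolding laurent_value_def lookup regular_hom(4)[OF field_eval_consts(8) piece_regular[OF uv F]]
      by (simp add: power_int_mult_distrib mult_ac)
    also have "\<dots> = laurent_value ?G u v (z powi a * t powi b)"
      by (rule laurent_value_superset[symmetric]) (auto simp: in_keys_iff lookup)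
    finally show "f (weight_action s (v / \<eta>, \<eta> ^ m, z, t)) = laurent_value ?G u v (z powi a * t powi b)" .
  qed
qed

lemma threefold_isomorphic:
  assumes "\<And>n. sections Z (pdiv_eval \<D> n) = piece n"
  shows "cstar_isomorphic (affine_cstar_variety threefold weight_action) (S_variety Z \<D>)"
proof -
  let ?A = "affine_cstar_variety threefold weight_action" and ?S = "S_variety Z \<D>"
  have S: "carrier ?S = section_ring" by (simp add: S_variety_def section_ring_def assms)
  have A: "f \<in> carrier ?A \<longleftrightarrow> (\<exists>g\<in>polynomial_functions4. f = restrict g threefold)" for f
    by (auto simp: affine_cstar_variety_def)
  define h where "h f = (THE F. represents f F)" for f
  have h_eq: "h f = F" if "represents f F" for f F
    unfolding h_def by (rule the_equality, rule that) (rule represents_unique[OF _ that])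
  have rep: "represents f (h f)" if "f \<in> carrier ?A" for f
  proof -
    from that obtain g where g: "g \<in> polynomial_functions4" "f = restrict g threefold" unfolding A by blast
    obtain F where "represents g F" using polyfun_represents[OF g(1)] by blast
    then have "represents f F" using represents_cong[of f g F] by (simp add: g(2))
    then show ?thesis by (simp add: h_eq)
  qed
  have "bij_betw h (carrier ?A) section_ring"
  proof (rule bij_betwI')
    fix f g assume fg: "f \<in> carrier ?A" "g \<in> carrier ?A"
    obtain f0 where f0: "f0 \<in> polynomial_functions4" "f = restrict f0 threefold" using fg(1) unfolding A by blast
    obtain g0 where g0: "g0 \<in> polynomial_functions4" "g = restrict g0 threefold" using fg(2) unfolding A by blast
    have "f0 p = g0 p" if eq: "h f = h g" and p: "p \<in> threefold" for p
    proof (rule polyfun_determined[OF f0(1) g0(1) _ p])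
      fix u v \<eta> z t assume o: "over u v \<eta> z t"
      then have "f (v / \<eta>, \<eta> ^ m, z, t) = g (v / \<eta>, \<eta> ^ m, z, t)"
        using rep[OF fg(1)] rep[OF fg(2)] eq by (simp add: represents_def)
      then show "f0 (v / \<eta>, \<eta> ^ m, z, t) = g0 (v / \<eta>, \<eta> ^ m, z, t)"
        using over_point[OF o] by (simp add: f0(2) g0(2))
    qed
    then show "h f = h g \<longleftrightarrow> f = g" by (auto simp: f0(2) g0(2) restrict_def)
  next
    show "h f \<in> section_ring" if "f \<in> carrier ?A" for f using rep[OF that] by (simp add: represents_def)
  next
    fix F assume "F \<in> section_ring"
    then obtain g where g: "g \<in> polynomial_functions4" "represents g F" using section_ring_represented by blast
    then have "represents (restrict g threefold) F" using represents_cong[of "restrict g threefold" g F] by simp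
    then have "h (restrict g threefold) = F" by (rule h_eq)
    moreover have "restrict g threefold \<in> carrier ?A" using g(1) unfolding A by blast
    ultimately show "\<exists>f\<in>carrier ?A. F = h f" by blast
  qed
  moreover have "h \<in> ring_hom ?A ?S"
  proof (rule ring_hom_memI)
    fix f g assume fg: "f \<in> carrier ?A" "g \<in> carrier ?A"
    show "h f \<in> carrier ?S" using rep[OF fg(1)] by (simp add: S represents_def)
    have "represents (f \<otimes>\<^bsub>?A\<^esub> g) (h f * h g)"
      using represents_mult[OF rep[OF fg(1)] rep[OF fg(2)]]
        represents_cong[of "f \<otimes>\<^bsub>?A\<^esub> g" "\<lambda>p. f p * g p" "h f * h g"] by (simp add: affine_cstar_variety_def)
    then show "h (f \<otimes>\<^bsub>?A\<^esub> g) = h f \<otimes>\<^bsub>?S\<^esub> h g" by (simp add: h_eq S_variety_def)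
    have "represents (f \<oplus>\<^bsub>?A\<^esub> g) (h f + h g)"
      using represents_add[OF rep[OF fg(1)] rep[OF fg(2)]]
        represents_cong[of "f \<oplus>\<^bsub>?A\<^esub> g" "\<lambda>p. f p + g p" "h f + h g"] by (simp add: affine_cstar_variety_def)
    then show "h (f \<oplus>\<^bsub>?A\<^esub> g) = h f \<oplus>\<^bsub>?S\<^esub> h g" by (simp add: h_eq S_variety_def)
  next
    have "Poly_Mapping.single 0 (plane_const 1) = (1 :: int \<Rightarrow>\<^sub>0 plane_field)"
      by (simp add: plane_generators)
    then have "represents \<one>\<^bsub>?A\<^esub> 1"
      using represents_const[of 1] represents_cong[of "\<one>\<^bsub>?A\<^esub>" "\<lambda>_. 1" 1] by (simp add: affine_cstar_variety_def)
    then show "h \<one>\<^bsub>?A\<^esub> = \<one>\<^bsub>?S\<^esub>" by (simp add: h_eq S_variety_def)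
  qed
  ultimately have "h \<in> ring_iso ?A ?S" by (simp add: ring_iso_def S)
  moreover have "h (c \<odot>\<^bsub>?A\<^esub> f) = c \<odot>\<^bsub>?S\<^esub> h f" if f: "f \<in> carrier ?A" for c f
  proof -
    have "represents (c \<odot>\<^bsub>?A\<^esub> f) (Poly_Mapping.map (\<lambda>g. plane_const c * g) (h f))"
      using represents_smult[OF rep[OF f], of c] represents_cong[of "c \<odot>\<^bsub>?A\<^esub> f" "\<lambda>p. c * f p"]
      by (simp add: affine_cstar_variety_def)
    then show ?thesis by (simp add: h_eq S_variety_def)
  qed
  moreover have "h (cstar_act ?A s f) = cstar_act ?S s (h f)" if s: "s \<noteq> 0" and f: "f \<in> carrier ?A" for s f
  proof -
    have "represents (cstar_act ?A s f) (Poly_Mapping.mapp (\<lambda>n g. plane_const (s powi n) * g) (h f))"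
      using represents_act[OF s rep[OF f]] represents_cong[of "cstar_act ?A s f" "\<lambda>p. f (weight_action s p)"]
      by (simp add: affine_cstar_variety_def)
    then show ?thesis by (simp add: h_eq S_variety_def)
  qed
  ultimately show ?thesis unfolding cstar_isomorphic_def by blast
qed

section \<open>Pull-back by the quotient morphism\<close>

lemma restricted_UNIV:
  "prime_elem q \<Longrightarrow> restricted_valuation (curve_val q) UNIV 1" "restricted_valuation (exc_val d) UNIV 1"
proof -
  assume q: "prime_elem q"
  then have "curve_val q (to_fract q) = 1" "to_fract q \<noteq> 0" by (auto simp: curve_val_to_fract)
  then have "\<exists>p\<in>(UNIV :: plane_field set). p \<noteq> 0 \<and> curve_val q p = 1" by blast
  then show "restricted_valuation (curve_val q) UNIV 1"
    by (intro restricted_valuation.intro restricted_valuation_axioms.intro discrete_valuation_curve[OF q]) simp_all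
next
  have "\<exists>p\<in>UNIV. p \<noteq> 0 \<and> exc_val d p = 1"
    by (intro bexI[of _ plane_v]) (simp_all add: exc_val_uv)
  then show "restricted_valuation (exc_val d) UNIV 1"
    by (intro restricted_valuation.intro restricted_valuation_axioms.intro exc.discrete_valuation_axioms) simp_all
qed

lemma invariant_subfield_UNIV: "invariant_subfield d UNIV"
  using plane_blow_up_axioms
  by (intro invariant_subfield.intro invariant_subfield_axioms.intro) auto

text \<open>When a single point \<open>V\<close> lies over the divisor, the multiplicity is the order along \<open>V\<close> of a
  uniformizer downstairs, that is, the ramification index.\<close>

lemma pullback_prime_single:
  assumes fibre: "\<And>R. R \<in> prime_divisors Y \<Longrightarrow> R \<inter> L = V \<inter> L \<Longrightarrow> R = V" and V: "V \<in> prime_divisors Y"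
    and e: "\<exists>p. uniformizer (V \<inter> L) p" "\<And>p. uniformizer (V \<inter> L) p \<Longrightarrow> ord_at V p = e"
  shows "pullback_prime Y (\<lambda>R. R \<inter> L) (V \<inter> L) = Poly_Mapping.single V e"
proof -
  have "{R. R \<in> prime_divisors Y \<and> R \<inter> L = V \<inter> L} = {V}" using fibre V by blast
  moreover have "(THE e. \<exists>p. uniformizer (V \<inter> L) p \<and> e = ord_at V p) = e"
    using e by (intro the_equality) auto
  ultimately show ?thesis by (simp add: pullback_prime_def)
qed

lemma pullback_primes:
  "pullback_prime Y (\<lambda>R. R \<inter> L) (D3 \<inter> L) = Poly_Mapping.single D3 1"
  "pullback_prime Y (\<lambda>R. R \<inter> L) (D2 \<inter> L) = Poly_Mapping.single D2 1"
  "pullback_prime Y (\<lambda>R. R \<inter> L) (exc_ring \<inter> L) = Poly_Mapping.single exc_ring (int m)"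
proof -
  interpret U: invariant_subfield d UNIV by (rule invariant_subfield_UNIV)
  have UY: "(\<lambda>R. R \<inter> UNIV) ` Y = Y" by simp
  note unif = restricted_valuation.uniformizer_iff
  have ord: "ord_at D3 p = curve_val X_u p" "ord_at D2 p = curve_val T p" "ord_at exc_ring p = exc_val d p"
    if "p \<noteq> 0" for p
    using restricted_valuation.ord_at_val_ring[OF restricted_UNIV(1)[OF prime_X_u], of p]
      restricted_valuation.ord_at_val_ring[OF restricted_UNIV(1)[OF prime_curve_eq], of p d l]
      restricted_valuation.ord_at_val_ring[OF restricted_UNIV(2), of p] that by simp_all
  show "pullback_prime Y (\<lambda>R. R \<inter> L) (D3 \<inter> L) = Poly_Mapping.single D3 1"
  proof (rule pullback_prime_single)
    fix R assume R: "R \<in> prime_divisors Y" "R \<inter> L = D3 \<inter> L"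
    then obtain p where "R \<in> Y" "uniformizer (R \<inter> UNIV) p" by (auto simp: prime_divisors_def)
    then show "R = D3"
      using U.curve_unique[OF _ _ prime_X_u, of R p] D3_fibre[OF _ R(2)] by (simp add: plane_generators)
  next
    show "D3 \<in> prime_divisors Y" using U.curve_prime_divisor[OF prime_X_u] unfolding UY by simp
    show "\<exists>p. uniformizer (D3 \<inter> L) p" using restricted_valuation.has_uniformizer[OF curve_u_restricted] .
    show "ord_at D3 p = 1" if "uniformizer (D3 \<inter> L) p" for p
      using that unfolding unif[OF curve_u_restricted] by (simp add: ord)
  qed
  show "pullback_prime Y (\<lambda>R. R \<inter> L) (D2 \<inter> L) = Poly_Mapping.single D2 1"
  proof (rule pullback_prime_single)
    fix R assume R: "R \<in> prime_divisors Y" "R \<inter> L = D2 \<inter> L"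
    then obtain p where "R \<in> Y" "uniformizer (R \<inter> UNIV) p" by (auto simp: prime_divisors_def)
    then show "R = D2"
      using U.curve_unique[OF _ _ prime_curve_eq, of R p d l] D2_fibre[OF _ R(2)] by simp
  next
    show "D2 \<in> prime_divisors Y" using U.curve_prime_divisor[OF prime_curve_eq] unfolding UY by simp
    show "\<exists>p. uniformizer (D2 \<inter> L) p" using restricted_valuation.has_uniformizer[OF curve_T_restricted] .
    show "ord_at D2 p = 1" if "uniformizer (D2 \<inter> L) p" for p
      using that unfolding unif[OF curve_T_restricted] by (simp add: ord)
  qed
  show "pullback_prime Y (\<lambda>R. R \<inter> L) (exc_ring \<inter> L) = Poly_Mapping.single exc_ring (int m)"
  proof (rule pullback_prime_single)
    fix R assume R: "R \<in> prime_divisors Y" "R \<inter> L = exc_ring \<inter> L"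
    then obtain p where "R \<in> Y" "uniformizer (R \<inter> UNIV) p" by (auto simp: prime_divisors_def)
    then show "R = exc_ring"
      using U.exc_unique[of R p] E_fibre[OF _ R(2)] by simp
  next
    show "exc_ring \<in> prime_divisors Y" using U.exc_prime_divisor unfolding UY by simp
    show "\<exists>p. uniformizer (exc_ring \<inter> L) p" using restricted_valuation.has_uniformizer[OF exc_restricted_m] .
    show "ord_at exc_ring p = int m" if "uniformizer (exc_ring \<inter> L) p" for p
      using that unfolding unif[OF exc_restricted_m] by (simp add: ord)
  qed
qed

text \<open>The sum runs over all three divisors even when one of the intervals vanishes, as the extra terms
  are then zero.\<close>

lemma pullback_three:
  assumes \<D>: "\<D> = Poly_Mapping.single (D3 \<inter> L) \<Delta>3 + Poly_Mapping.single (D2 \<inter> L) \<Delta>2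
      + Poly_Mapping.single (exc_ring \<inter> L) \<Delta>E"
  shows "pdiv_pullback Y (\<lambda>R. R \<inter> L) \<D> = Poly_Mapping.single D3 \<Delta>3 + Poly_Mapping.single D2 \<Delta>2
      + Poly_Mapping.single exc_ring (interval_of (of_nat m) * \<Delta>E)"
proof -
  let ?g = "\<lambda>P. pdiv_tensor (Poly_Mapping.lookup \<D> P) (pullback_prime Y (\<lambda>R. R \<inter> L) P)"
  have tensor: "pdiv_tensor \<Delta> (Poly_Mapping.single R e) = Poly_Mapping.single R (interval_of (of_int e) * \<Delta>)"
    if "e \<noteq> 0" for \<Delta> and R :: "plane_field set" and e
    using that by (simp add: pdiv_tensor_def)
  have one: "interval_of 1 * \<Delta> = \<Delta>" for \<Delta> :: "rat interval"
    by (simp add: interval_eq_iff lower_times upper_times)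
  have lookups: "Poly_Mapping.lookup \<D> (D3 \<inter> L) = \<Delta>3" "Poly_Mapping.lookup \<D> (D2 \<inter> L) = \<Delta>2"
    "Poly_Mapping.lookup \<D> (exc_ring \<inter> L) = \<Delta>E"
    using divisors_distinct divisors_distinct[symmetric] by (auto simp: \<D> lookup_add lookup_single when_def)
  have "pdiv_pullback Y (\<lambda>R. R \<inter> L) \<D> = sum ?g {D3 \<inter> L, D2 \<inter> L, exc_ring \<inter> L}"
    unfolding pdiv_pullback_def
  proof (rule sum.mono_neutral_left)
    show "Poly_Mapping.keys \<D> \<subseteq> {D3 \<inter> L, D2 \<inter> L, exc_ring \<inter> L}"
      by (auto simp: \<D> in_keys_iff lookup_add lookup_single when_def split: if_splits)
    show "\<forall>P\<in>{D3 \<inter> L, D2 \<inter> L, exc_ring \<inter> L} - Poly_Mapping.keys \<D>. ?g P = 0"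
      by (auto simp: in_keys_iff pdiv_tensor_def)
  qed simp
  also have "\<dots> = ?g (D3 \<inter> L) + (?g (D2 \<inter> L) + ?g (exc_ring \<inter> L))"
    using divisors_distinct by simp
  also have "\<dots> = Poly_Mapping.single D3 \<Delta>3 + Poly_Mapping.single D2 \<Delta>2
      + Poly_Mapping.single exc_ring (interval_of (of_nat m) * \<Delta>E)"
    unfolding lookups pullback_primes using m_pos by (simp add: tensor one add.assoc)
  finally show ?thesis .
qed

lemma strict_transforms:
  "strict_transform Y (plane_curve plane_u) = D3"
  "strict_transform Y (plane_curve (plane_v + (plane_u + plane_v ^ d) ^ l)) = D2"
proof -
  have "plane_v + (plane_u + plane_v ^ d) ^ l = to_fract T"
    by (simp add: curve_eq_def plane_generators to_fract_power)
  then show "strict_transform Y (plane_curve plane_u) = D3"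
    "strict_transform Y (plane_curve (plane_v + (plane_u + plane_v ^ d) ^ l)) = D2"
    using val_u.strict_transform_val_ring[OF curve_ring_in_blown_up_plane[OF prime_X_u]]
      val_T.strict_transform_val_ring[OF curve_ring_in_blown_up_plane[OF prime_curve_eq]]
    by (simp_all add: plane_generators(2) curve_ring_eq_localization prime_X_u prime_curve_eq)
qed

lemma exceptional_divisors:
  "exceptional_divisor Y plane_origin = exc_ring"
  "exceptional_divisor Y' (plane_origin \<inter> L) = exc_ring \<inter> L"
  using invariant_subfield.exceptional_divisor_quotient[OF invariant_subfield_UNIV, of 1]
    exceptional_divisor_quotient[OF m_pos invariant_functions(3,4)] by simp_all

end

theorem proposition3p4:
  fixes d l \<alpha>\<^sub>2 \<alpha>\<^sub>3 :: nat and a b :: int and a' b' :: rat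
    and Y :: "plane_field set set"
    and \<mu> :: "(plane_field \<Rightarrow> plane_field) set"
    and D\<^sub>2 D\<^sub>3 E D\<^sub>2' D\<^sub>3' E' :: "plane_field set"
    and \<D> \<D>' :: "plane_field polyhedral_divisor"
  assumes "d \<ge> 2" and "l \<ge> 1" and "2 \<le> \<alpha>\<^sub>2" and "\<alpha>\<^sub>2 < \<alpha>\<^sub>3"
    and "coprime \<alpha>\<^sub>2 d" and "coprime \<alpha>\<^sub>2 \<alpha>\<^sub>3"
    and "a * int \<alpha>\<^sub>3 + b * int \<alpha>\<^sub>2 = 1"
    and "int d dvd a"
    and "a' = of_int a / of_nat d" and "b' = of_int b"
    and "Y = blown_up_plane d"
    and "\<mu> = root_group d (d * l - 1)"
    and "D\<^sub>3 = strict_transform Y (plane_curve plane_u)"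
    and "D\<^sub>2 = strict_transform Y (plane_curve (plane_v + (plane_u + plane_v ^ d) ^ l))"
    and "E = exceptional_divisor Y plane_origin"
    and "D\<^sub>3' = quotient_map \<mu> D\<^sub>3" and "D\<^sub>2' = quotient_map \<mu> D\<^sub>2" and "E' = quotient_map \<mu> E"
    and "\<D> = Poly_Mapping.single D\<^sub>3 (interval_of (a' / of_nat \<alpha>\<^sub>2))
           + Poly_Mapping.single D\<^sub>2 (interval_of (b' / of_nat \<alpha>\<^sub>3))
           + Poly_Mapping.single E (Interval (0, 1 / of_nat (\<alpha>\<^sub>2 * \<alpha>\<^sub>3)))"
    and "\<D>' = Poly_Mapping.single D\<^sub>3' (interval_of (a' / of_nat \<alpha>\<^sub>2))
            + Poly_Mapping.single D\<^sub>2' (interval_of (b' / of_nat \<alpha>\<^sub>3))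
            + Poly_Mapping.single E' (Interval (0, 1 / of_nat ((d * l - 1) * \<alpha>\<^sub>2 * \<alpha>\<^sub>3)))"
  shows "cstar_isomorphic
           (affine_cstar_variety (koras_russell d l \<alpha>\<^sub>2 \<alpha>\<^sub>3)
             (linear_cstar_action (int (\<alpha>\<^sub>2 * \<alpha>\<^sub>3)) (- int ((d * l - 1) * \<alpha>\<^sub>2 * \<alpha>\<^sub>3))
                (int (d * \<alpha>\<^sub>3)) (int \<alpha>\<^sub>2)))
           (S_variety (group_quotient Y \<mu>) \<D>')
         \<and> \<D> = pdiv_pullback Y (quotient_map \<mu>) \<D>'
         \<and> E' = exceptional_divisor (group_quotient Y \<mu>) (quotient_map \<mu> plane_origin)"
proof -
  obtain a0 where a0: "a = int d * a0" using assms(8) by (auto simp: dvd_def)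
  have d0: "0 < d" using assms(1) by simp
  interpret K: koras_russell_data d l \<alpha>\<^sub>2 \<alpha>\<^sub>3 a0 b
    using assms(1-4,7) by unfold_locales (auto simp: a0)
  have a': "a' = of_int a0" using d0 by (simp add: assms(9) a0)
  have \<mu>: "quotient_map \<mu> = (\<lambda>R. R \<inter> K.L)"
    using quotient_map_root_group[OF K.m_pos] by (simp add: assms(12) K.m_def)
  have divisors: "D\<^sub>3 = K.D3" "D\<^sub>2 = K.D2" "E = K.exc_ring"
    using assms(11,13-15) K.strict_transforms K.exceptional_divisors by simp_all
  have \<D>': "\<D>' = Poly_Mapping.single (K.D3 \<inter> K.L) (interval_of (of_int a0 / of_nat \<alpha>\<^sub>2))
      + Poly_Mapping.single (K.D2 \<inter> K.L) (interval_of (of_int b / of_nat \<alpha>\<^sub>3))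
      + Poly_Mapping.single (K.exc_ring \<inter> K.L) (Interval (0, 1 / of_nat (K.m * \<alpha>\<^sub>2 * \<alpha>\<^sub>3)))"
    unfolding assms(20) assms(16-18) divisors \<mu> a' assms(10) K.m_def ..
  have quotient: "group_quotient Y \<mu> = K.Y'"
    by (simp add: group_quotient_def \<mu> assms(11))
  have "interval_of (of_nat K.m) * Interval (0, 1 / of_nat (K.m * \<alpha>\<^sub>2 * \<alpha>\<^sub>3)) =
      Interval (0, 1 / of_nat (\<alpha>\<^sub>2 * \<alpha>\<^sub>3) :: rat)"
  proof -
    have Int: "lower (Interval (0, c)) = 0" "upper (Interval (0, c)) = c" if "0 \<le> c" for c :: rat
      using that by (simp_all add: lower.rep_eq upper.rep_eq Interval_inverse)
    have "of_nat K.m * (1 / of_nat (K.m * \<alpha>\<^sub>2 * \<alpha>\<^sub>3)) = (1 / of_nat (\<alpha>\<^sub>2 * \<alpha>\<^sub>3) :: rat)"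
      using K.m_pos by simp
    then show ?thesis
      by (simp only: interval_eq_iff lower_times upper_times Int lower_interval_of upper_interval_of
          zero_le_divide_1_iff of_nat_0_le_iff mult_zero_right) simp
  qed
  then have "\<D> = pdiv_pullback Y (quotient_map \<mu>) \<D>'"
    unfolding \<mu> assms(11) K.pullback_three[OF \<D>'] unfolding assms(19) divisors a' assms(10) by simp
  moreover have "E' = exceptional_divisor (group_quotient Y \<mu>) (quotient_map \<mu> plane_origin)"
    unfolding quotient unfolding \<mu> K.exceptional_divisors assms(18) divisors ..
  moreover have "cstar_isomorphic (affine_cstar_variety K.threefold K.weight_action)
      (S_variety (group_quotient Y \<mu>) \<D>')"
    unfolding quotient by (rule K.threefold_isomorphic[OF K.sections_eq_piece[OF \<D>']])
  ultimately show ?thesis unfolding K.m_def by blast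
qed

end
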